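(* Let $G$ be a nontrivial finite group whose character graph associated with codegrees $\Gamma(G)$ has no triangles. Then $G$ is solvable.
   Context: $\operatorname{Irr}(G)$ is the set of complex irreducible characters of the finite group $G$, and $1_G$ is the principal character. For a character $\chi$ of $G$, the codegree is $a(\chi):=\frac{|G:\ker\chi|}{\chi(1)}$. The character graph $\Gamma(G)$ of $G$ associated with codegrees is the simple graph with vertex set $\operatorname{Irr}(G)\setminus\{1_G\}$ in which two distinct vertices $\chi,\psi$ are joined by an edge if and only if $\gcd(a(\chi),a(\psi))\neq 1$. A triangle is a set of three distinct pairwise adjacent vertices. *)

theory Defs
  imports
    "HOL-Algebra.Elementary_Groups"
    "HOL-Algebra.Solvable_Groups"
    "Jordan_Normal_Form.VS_Connect"
    "Graph_Theory.Pair_Digraph"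
begin

text \<open>
  Complex representations of degree \<open>n\<close> are homomorphisms into the unit group of the ring of
  complex \<open>n \<times> n\<close> matrices.
\<close>

abbreviation GL_complex :: "nat \<Rightarrow> complex mat monoid" where
  "GL_complex n \<equiv> units_of (ring_mat TYPE(complex) n ())"

definition complex_rep :: "('a, 'b) monoid_scheme \<Rightarrow> nat \<Rightarrow> ('a \<Rightarrow> complex mat) \<Rightarrow> bool" where
  "complex_rep G n \<rho> \<longleftrightarrow> \<rho> \<in> hom G (GL_complex n)"

definition irreducible_rep :: "('a, 'b) monoid_scheme \<Rightarrow> nat \<Rightarrow> ('a \<Rightarrow> complex mat) \<Rightarrow> bool" where
  "irreducible_rep G n \<rho> \<longleftrightarrow>
     complex_rep G n \<rho> \<and> n > 0 \<and>
     (\<forall>W. VectorSpace.subspace class_ring W (module_vec TYPE(complex) n) \<and>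
          (\<forall>g\<in>carrier G. \<forall>w\<in>W. \<rho> g *\<^sub>v w \<in> W) \<longrightarrow>
          W = {0\<^sub>v n} \<or> W = carrier_vec n)"

definition mat_trace :: "'a :: comm_monoid_add mat \<Rightarrow> 'a" where
  "mat_trace A = (\<Sum>i<dim_row A. A $$ (i, i))"

text \<open>
  Characters are functions on \<^term>\<open>carrier G\<close>. They take the value \<^term>\<open>undefined\<close> outside the
  carrier, so that equality of HOL functions is equality of characters.
\<close>

definition rep_character :: "('a, 'b) monoid_scheme \<Rightarrow> ('a \<Rightarrow> complex mat) \<Rightarrow> 'a \<Rightarrow> complex" where
  "rep_character G \<rho> = (\<lambda>g\<in>carrier G. mat_trace (\<rho> g))"

definition Irr :: "('a, 'b) monoid_scheme \<Rightarrow> ('a \<Rightarrow> complex) set" where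
  "Irr G = {\<chi>. \<exists>n \<rho>. irreducible_rep G n \<rho> \<and> \<chi> = rep_character G \<rho>}"

definition principal_character :: "('a, 'b) monoid_scheme \<Rightarrow> 'a \<Rightarrow> complex" where
  "principal_character G = (\<lambda>g\<in>carrier G. 1)"

definition character_kernel :: "('a, 'b) monoid_scheme \<Rightarrow> ('a \<Rightarrow> complex) \<Rightarrow> 'a set" where
  "character_kernel G \<chi> = {g \<in> carrier G. \<chi> g = \<chi> \<one>\<^bsub>G\<^esub>}"

text \<open>
  The codegree is the quotient of the index of the kernel by the degree. For an irreducible
  character the degree divides the index, so the quotient is a natural number; it is taken in the
  type \<^typ>\<open>nat\<close> because the graph below uses greatest common divisors of codegrees.
\<close>

definition codegree :: "('a, 'b) monoid_scheme \<Rightarrow> ('a \<Rightarrow> complex) \<Rightarrow> nat" where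
  "codegree G \<chi> =
     (THE a. of_nat a = of_nat (card (rcosets\<^bsub>G\<^esub> (character_kernel G \<chi>))) / \<chi> \<one>\<^bsub>G\<^esub>)"

text \<open>
  A simple graph is encoded as a symmetric loop-free digraph: every edge is the pair of its two arcs.
\<close>

definition codegree_graph :: "('a, 'b) monoid_scheme \<Rightarrow> ('a \<Rightarrow> complex) pair_pre_digraph" where
  "codegree_graph G =
     \<lparr> pverts = Irr G - {principal_character G},
       parcs = {(\<chi>, \<psi>). \<chi> \<in> Irr G - {principal_character G} \<and>
                        \<psi> \<in> Irr G - {principal_character G} \<and>
                        \<chi> \<noteq> \<psi> \<and> gcd (codegree G \<chi>) (codegree G \<psi>) \<noteq> 1} \<rparr>"

lemma codegree_graph_simple: "pair_bidirected_digraph (codegree_graph G)"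
  by unfold_locales (auto simp: codegree_graph_def symmetric_def gcd.commute intro!: symI)

definition is_triangle :: "'v pair_pre_digraph \<Rightarrow> 'v set \<Rightarrow> bool" where
  "is_triangle \<Gamma> T \<longleftrightarrow>
     T \<subseteq> pverts \<Gamma> \<and> card T = 3 \<and> (\<forall>u\<in>T. \<forall>v\<in>T. u \<noteq> v \<longrightarrow> (u, v) \<in> parcs \<Gamma>)"

end

theory Submission
  imports Defs "Jordan_Normal_Form.Spectral_Radius" "HOL-Algebra.Multiplicative_Group"
    "HOL-Algebra.Sylow" "HOL-Number_Theory.Cong"
begin

text \<open>
  The two halves of the argument meet in one quotient of \<open>G\<close>. Suppose that \<open>G\<close> is not solvable. The
  last term \<open>D\<close> of the derived series is a nontrivial perfect normal subgroup. Choose a normal subgroup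
  \<open>M\<close> maximal subject to not containing \<open>D\<close>. In \<open>H = G / M\<close> the image \<open>N\<close> of \<open>D\<close> is perfect,
  nontrivial, and contained in every nontrivial normal subgroup of \<open>H\<close>
  (\<open>quotient_with_perfect_minimal_normal\<close>). Irreducible characters of \<open>H\<close> inflate to irreducible
  characters of \<open>G\<close> with the same codegree, so a triangle for \<open>H\<close> gives a triangle for \<open>G\<close>.

  Characters bound the number of conjugacy classes. An irreducible character of \<open>H\<close> is either trivial on
  \<open>N\<close> or faithful. Any two distinct faithful irreducible characters are adjacent: their codegrees are
  \<open>|H| / n\<close> and \<open>|H| / m\<close>, and if these divisors of \<open>|H|\<close> were coprime, their product would divide
  \<open>|H|\<close>, so that \<open>|H| \<le> n m\<close>, against \<open>n\<^sup>2 + m\<^sup>2 \<le> |H|\<close>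
  (\<open>faithful_codegrees_not_coprime\<close>). Hence there are at most two faithful irreducible characters. On
  \<open>N\<close> every character is a combination of the constant function and these two, and irreducible characters
  separate conjugacy classes, so \<open>N\<close> meets at most three classes of \<open>H\<close>
  (\<open>card_nonconjugate_le\<close>).

  Elementary group theory excludes such an \<open>N\<close> (\<open>perfect_minimal_normal_four_classes\<close>). The
  nonidentity elements of \<open>N\<close> form at most two classes of \<open>H\<close>, so at most two primes divide \<open>|N|\<close>.
  If there is only one, the centre of \<open>N\<close> is nontrivial and normal in \<open>H\<close>, so \<open>N\<close> is abelian and not
  perfect. If there are two, \<open>p\<close> and \<open>q\<close>, every nonidentity element of \<open>N\<close> has order \<open>p\<close> or
  \<open>q\<close>, and conjugacy in \<open>H\<close> makes all centralizers of elements of order \<open>p\<close> equally large. They turn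
  out to be Sylow subgroups, and the nonidentity elements of their centres partition the elements of order
  \<open>p\<close>. Counting the elements of \<open>N\<close> then makes a Sylow subgroup of \<open>N\<close> unique, hence normal in \<open>H\<close>, which contradicts
  minimality (\<open>two_prime_exponents_sylow_unique\<close>). This count replaces Burnside's theorem on groups of
  order \<open>p\<^sup>a q\<^sup>b\<close>.

  The facts on characters are proved for matrix representations: Schur's lemma, the orthogonality relations,
  the integrality of \<open>|G| / n\<close>, the description of characters by roots of unity, and the completeness of
  the irreducible characters among class functions.
\<close>

section \<open>Linear algebra in coordinates\<close>

text \<open>
  Gaussian elimination: an equation with a nonzero coefficient at \<open>p\<close> is solved for the unknown \<open>x p\<close>
  and substituted into the others, which leaves one equation and one unknown less.
\<close>
lemma homogeneous_system_nontrivial_solution: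
  fixes M :: "'j \<Rightarrow> 'i \<Rightarrow> 'k :: field"
  assumes "finite J" "finite I" "card J < card I"
  shows "\<exists>x. (\<exists>i\<in>I. x i \<noteq> 0) \<and> (\<forall>j\<in>J. (\<Sum>i\<in>I. M j i * x i) = 0)"
  using assms
proof (induction J arbitrary: I M rule: finite_induct)
  case empty
  then have "I \<noteq> {}" by auto
  then show ?case by (intro exI[of _ "\<lambda>_. 1"]) auto
next
  case (insert j J)
  show ?case
  proof (cases "\<forall>i\<in>I. M j i = 0")
    case True
    have "card J < card I" using insert by simp
    then obtain x where "\<exists>i\<in>I. x i \<noteq> 0" "\<forall>j\<in>J. (\<Sum>i\<in>I. M j i * x i) = 0"
      using insert.IH[of I M] insert.prems by blast
    with True show ?thesis by (intro exI[of _ x]) auto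
  next
    case False
    then obtain p where p: "p \<in> I" "M j p \<noteq> 0" by auto
    \<comment> \<open>\<open>M'\<close> is the system after eliminating the unknown with index \<open>p\<close>.\<close>
    define M' where "M' k i = M k i - M k p * M j i / M j p" for k i
    have "card J < card (I - {p})"
      using insert p by simp
    then obtain y where y: "\<exists>i\<in>I - {p}. y i \<noteq> 0" "\<forall>k\<in>J. (\<Sum>i\<in>I - {p}. M' k i * y i) = 0"
      using insert.IH[of "I - {p}" M'] insert.prems by auto
    define x where "x i = (if i = p then - (\<Sum>i\<in>I - {p}. M j i * y i) / M j p else y i)" for i
    have split: "(\<Sum>i\<in>I. M k i * x i) = M k p * x p + (\<Sum>i\<in>I - {p}. M k i * y i)" for k
      using p insert.prems by (simp add: sum.remove x_def)
    have "(\<Sum>i\<in>I. M k i * x i) = 0" if "k \<in> insert j J" for k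
    proof (cases "k = j")
      case True
      then show ?thesis using p by (simp add: split) (simp add: x_def)
    next
      case False
      then have "0 = (\<Sum>i\<in>I - {p}. M' k i * y i)" using that y by simp
      also have "\<dots> = (\<Sum>i\<in>I - {p}. M k i * y i) - M k p / M j p * (\<Sum>i\<in>I - {p}. M j i * y i)"
        by (simp add: M'_def algebra_simps sum_subtractf sum_distrib_left)
      finally show ?thesis using p by (simp add: split) (simp add: x_def)
    qed
    moreover have "\<exists>i\<in>I. x i \<noteq> 0" using y(1) by (auto simp: x_def)
    ultimately show ?thesis by (intro exI[of _ x]) auto
  qed
qed

text \<open>
  If there were more indices than coordinates, the vectors \<open>\<lambda>j. Q j i\<close> would be linearly dependent,
  and pairing a dependency with the dual family \<open>P\<close> kills all its coefficients.
\<close>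
lemma card_le_if_biorthogonal:
  fixes P :: "'i \<Rightarrow> 'j \<Rightarrow> 'k :: field"
  assumes fin: "finite I" "finite J"
    and bi: "\<And>i i'. i \<in> I \<Longrightarrow> i' \<in> I \<Longrightarrow> (\<Sum>j\<in>J. P i j * Q j i') = (if i = i' then 1 else 0)"
  shows "card I \<le> card J"
proof (rule ccontr)
  assume "\<not> card I \<le> card J"
  then obtain x where x: "\<exists>i\<in>I. x i \<noteq> 0" "\<forall>j\<in>J. (\<Sum>i\<in>I. Q j i * x i) = 0"
    using homogeneous_system_nontrivial_solution[OF fin(2,1), of Q] by auto
  have "x i = 0" if "i \<in> I" for i
  proof -
    have "x i = (\<Sum>i'\<in>I. (if i = i' then 1 else 0) * x i')"
      using that fin by (simp add: if_distrib[of "\<lambda>y. y * _"] cong: if_cong)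
    also have "\<dots> = (\<Sum>i'\<in>I. (\<Sum>j\<in>J. P i j * Q j i') * x i')"
      using bi that by (intro sum.cong) auto
    also have "\<dots> = (\<Sum>j\<in>J. P i j * (\<Sum>i'\<in>I. Q j i' * x i'))"
      by (simp add: sum_distrib_left sum_distrib_right mult.assoc) (rule sum.swap)
    finally show ?thesis using x by simp
  qed
  with x show False by blast
qed

lemma left_inverse_dim_le:
  fixes B :: "'k :: field mat"
  assumes "B \<in> carrier_mat n d" "C \<in> carrier_mat d n" "C * B = 1\<^sub>m d"
  shows "d \<le> n"
proof -
  have "card {..<d} \<le> card {..<n}"
  proof (rule card_le_if_biorthogonal[where P = "\<lambda>i j. C $$ (i,j)" and Q = "\<lambda>i j. B $$ (i,j)"])
    fix i i' assume i: "i \<in> {..<d}" "i' \<in> {..<d}"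
    then have "(\<Sum>j<n. C $$ (i, j) * B $$ (j, i')) = (C * B) $$ (i, i')"
      using assms(1,2) by (simp add: scalar_prod_def atLeast0LessThan)
    then show "(\<Sum>j<n. C $$ (i, j) * B $$ (j, i')) = (if i = i' then 1 else 0)"
      unfolding assms(3) using i by simp
  qed auto
  then show ?thesis by simp
qed

definition lin_subspace :: "nat \<Rightarrow> 'k :: field vec set \<Rightarrow> bool" where
  "lin_subspace n W \<longleftrightarrow> W \<subseteq> carrier_vec n \<and> 0\<^sub>v n \<in> W \<and>
     (\<forall>v\<in>W. \<forall>w\<in>W. v + w \<in> W) \<and> (\<forall>c. \<forall>v\<in>W. c \<cdot>\<^sub>v v \<in> W)"

lemma subspace_iff_lin_subspace:
  "VectorSpace.subspace class_ring W (module_vec TYPE('k :: field) n) \<longleftrightarrow> lin_subspace n W"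
proof -
  have mod: "Module.module (class_ring :: 'k ring) (module_vec TYPE('k) n)" by (rule vec_module)
  have vs: "vectorspace (class_ring :: 'k ring) (module_vec TYPE('k) n)" by (rule vec_vs)
  show ?thesis
    unfolding VectorSpace.subspace_def lin_subspace_def submodule_def
    using vs mod by (auto simp: module_vec_simps class_ring_simps)
qed

lemma exists_nonzero_coordinate:
  assumes "v \<in> carrier_vec n" "v \<noteq> 0\<^sub>v n"
  obtains i where "i < n" "v $ i \<noteq> 0"
  using assms by (metis carrier_vecD eq_vecI index_zero_vec)

lemma mult_unit_vec:
  fixes A :: "'k :: semiring_1 mat"
  assumes "A \<in> carrier_mat n d" "j < d"
  shows "A *\<^sub>v unit_vec d j = col A j"
  using assms by (intro eq_vecI) auto

lemma lin_subspace_image: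
  fixes A :: "'k :: field mat"
  assumes A: "A \<in> carrier_mat n m"
  shows "lin_subspace n {A *\<^sub>v v | v. v \<in> carrier_vec m}"
  unfolding lin_subspace_def
proof (intro conjI ballI allI)
  show "0\<^sub>v n \<in> {A *\<^sub>v v | v. v \<in> carrier_vec m}"
    using A by (auto intro!: exI[of _ "0\<^sub>v m"])
  fix v w assume "v \<in> {A *\<^sub>v v | v. v \<in> carrier_vec m}" "w \<in> {A *\<^sub>v v | v. v \<in> carrier_vec m}"
  then obtain x y where "x \<in> carrier_vec m" "y \<in> carrier_vec m" "v = A *\<^sub>v x" "w = A *\<^sub>v y"
    by blast
  then show "v + w \<in> {A *\<^sub>v v | v. v \<in> carrier_vec m}"
    using A by (auto simp: mult_add_distrib_mat_vec[of _ n m] intro!: exI[of _ "x + y"])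
next
  fix c v assume "v \<in> {A *\<^sub>v v | v. v \<in> carrier_vec m}"
  then obtain x where "x \<in> carrier_vec m" "v = A *\<^sub>v x" by blast
  then show "c \<cdot>\<^sub>v v \<in> {A *\<^sub>v v | v. v \<in> carrier_vec m}"
    using A by (auto simp: mult_mat_vec[of _ n m] intro!: exI[of _ "c \<cdot>\<^sub>v x"])
qed (use A in auto)

text \<open>
  A subspace \<open>W\<close> is parametrised by a matrix \<open>B\<close> whose left inverse \<open>C\<close> computes coordinates. Take
  \<open>B\<close> of maximal width among the left-invertible matrices with columns in \<open>W\<close>. If \<open>w\<close> in \<open>W\<close> were
  not fixed by \<open>B C\<close>, the error \<open>u = w - B C w\<close> would be a nonzero vector of \<open>W\<close> killed by \<open>C\<close>
  and could be added as a further column.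
\<close>
lemma subspace_coordinates:
  fixes W :: "'k :: field vec set"
  assumes W: "lin_subspace n W"
  obtains d B C where "B \<in> carrier_mat n d" "C \<in> carrier_mat d n" "C * B = 1\<^sub>m d"
    "\<And>v. v \<in> carrier_vec d \<Longrightarrow> B *\<^sub>v v \<in> W" "\<And>w. w \<in> W \<Longrightarrow> B *\<^sub>v (C *\<^sub>v w) = w"
proof -
  define Q where "Q d \<longleftrightarrow> (\<exists>B C. B \<in> carrier_mat n d \<and> C \<in> carrier_mat d n \<and> C * B = 1\<^sub>m d \<and>
     (\<forall>v\<in>carrier_vec d. B *\<^sub>v v \<in> W))" for d
  have "Q 0"
    unfolding Q_def
  proof (rule exI[of _ "0\<^sub>m n 0"], rule exI[of _ "0\<^sub>m 0 n"], intro conjI ballI, goal_cases)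
    case 3
    show ?case by (intro eq_matI) auto
  next
    case (4 v)
    then have "0\<^sub>m n 0 *\<^sub>v v = 0\<^sub>v n" by (intro eq_vecI) (auto simp: scalar_prod_def)
    then show ?case using W by (simp add: lin_subspace_def)
  qed auto
  moreover have "\<And>d. Q d \<Longrightarrow> d \<le> n"
    using left_inverse_dim_le unfolding Q_def by blast
  ultimately obtain d where d: "Q d" and max: "\<And>d'. Q d' \<Longrightarrow> d' \<le> d"
    using Nat.ex_has_greatest_nat[of Q 0 n] by auto
  from d obtain B C where B: "B \<in> carrier_mat n d" and C: "C \<in> carrier_mat d n"
    and CB: "C * B = 1\<^sub>m d" and BW: "\<And>v. v \<in> carrier_vec d \<Longrightarrow> B *\<^sub>v v \<in> W"
    unfolding Q_def by blast
  have "B *\<^sub>v (C *\<^sub>v w) = w" if w: "w \<in> W" for w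
  proof (rule ccontr)
    assume neq: "B *\<^sub>v (C *\<^sub>v w) \<noteq> w"
    have wn: "w \<in> carrier_vec n" using w W by (auto simp: lin_subspace_def)
    define u where "u = w + (-1) \<cdot>\<^sub>v (B *\<^sub>v (C *\<^sub>v w))"
    have un: "u \<in> carrier_vec n" using wn B C by (simp add: u_def)
    have uW: "u \<in> W"
      using w W BW[of "C *\<^sub>v w"] C wn unfolding u_def lin_subspace_def by auto
    have "u \<noteq> 0\<^sub>v n"
    proof
      assume u0: "u = 0\<^sub>v n"
      have "(B *\<^sub>v (C *\<^sub>v w)) $ i = w $ i" if "i < n" for i
      proof -
        have "u $ i = 0" using u0 that by simp
        then show ?thesis using that B C wn by (simp add: u_def)
      qed
      then have "B *\<^sub>v (C *\<^sub>v w) = w" using B wn by (intro eq_vecI) auto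
      with neq show False ..
    qed
    then obtain i where i: "i < n" "u $ i \<noteq> 0"
      using exists_nonzero_coordinate[OF un] by blast
    have CBv: "C *\<^sub>v (B *\<^sub>v v) = v" if "v \<in> carrier_vec d" for v
      using that B C CB by (metis assoc_mult_mat_vec one_mult_mat_vec)
    have Cu: "C *\<^sub>v u = 0\<^sub>v d"
    proof -
      have "C *\<^sub>v u = C *\<^sub>v w + (-1) \<cdot>\<^sub>v (C *\<^sub>v (B *\<^sub>v (C *\<^sub>v w)))"
        unfolding u_def using B C wn
        by (simp add: mult_add_distrib_mat_vec[of _ d n] mult_mat_vec[of _ d n])
      also have "\<dots> = 0\<^sub>v d" using CBv[of "C *\<^sub>v w"] C wn by (intro eq_vecI) auto
      finally show ?thesis .
    qed
    \<comment> \<open>The new row of the left inverse: it takes the value 1 at \<open>u\<close> and vanishes on the image of \<open>B\<close>.\<close>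
    define r where "r = vec n (\<lambda>j. ((if j = i then 1 else 0) - row (B * C) i $ j) / u $ i)"
    have rn: "r \<in> carrier_vec n" by (simp add: r_def)
    have r_scalar: "r \<bullet> v = (v $ i - (B *\<^sub>v (C *\<^sub>v v)) $ i) / u $ i" if v: "v \<in> carrier_vec n" for v
    proof -
      have "r \<bullet> v = (\<Sum>j<n. ((if j = i then 1 else 0) - row (B * C) i $ j) / u $ i * v $ j)"
        using v by (simp add: scalar_prod_def r_def atLeast0LessThan)
      also have "\<dots> = ((\<Sum>j<n. (if j = i then 1 else 0) * v $ j) - (\<Sum>j<n. row (B * C) i $ j * v $ j)) / u $ i"
        by (simp add: sum_divide_distrib sum_subtractf[symmetric] algebra_simps diff_divide_distrib)
      also have "(\<Sum>j<n. (if j = i then 1 else 0) * v $ j) = v $ i"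
        using i by (simp add: if_distrib[of "\<lambda>x. x * _"] cong: if_cong)
      also have "(\<Sum>j<n. row (B * C) i $ j * v $ j) = ((B * C) *\<^sub>v v) $ i"
        using v i B by (simp add: scalar_prod_def atLeast0LessThan)
      also have "(B * C) *\<^sub>v v = B *\<^sub>v (C *\<^sub>v v)" using B C v by simp
      finally show ?thesis .
    qed
    have ru: "r \<bullet> u = 1"
      using r_scalar[OF un] Cu B i by (simp add: scalar_prod_def)
    have rB: "r \<bullet> (B *\<^sub>v v) = 0" if "v \<in> carrier_vec d" for v
      using r_scalar[of "B *\<^sub>v v"] B CBv[OF that] that by simp
    define B' where "B' = mat n (Suc d) (\<lambda>(a,b). if b < d then B $$ (a,b) else u $ a)"
    define C' where "C' = mat (Suc d) n (\<lambda>(a,b). if a < d then C $$ (a,b) else r $ b)"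
    have B'[simp]: "B' \<in> carrier_mat n (Suc d)" and C'[simp]: "C' \<in> carrier_mat (Suc d) n"
      by (auto simp: B'_def C'_def)
    have colB': "col B' b = (if b < d then col B b else u)" if "b < Suc d" for b
      using that B un by (intro eq_vecI) (auto simp: B'_def)
    have rowC': "row C' a = (if a < d then row C a else r)" if "a < Suc d" for a
      using that C rn by (intro eq_vecI) (auto simp: C'_def)
    have colB: "col B b = B *\<^sub>v unit_vec d b" if "b < d" for b
      using that B by (simp add: mult_unit_vec[of _ n])
    have "C' * B' = 1\<^sub>m (Suc d)"
    proof (rule eq_matI)
      fix a b assume ab: "a < dim_row (1\<^sub>m (Suc d) :: 'k mat)" "b < dim_col (1\<^sub>m (Suc d) :: 'k mat)"
      have "(C' * B') $$ (a, b) = row C' a \<bullet> col B' b"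
        using ab B' C' by (simp del: B' C' add: B'_def C'_def)
      also have "\<dots> = 1\<^sub>m (Suc d) $$ (a, b)"
      proof (cases "a < d"; cases "b < d")
        assume "a < d" "b < d"
        then have "row C a \<bullet> col B b = (C * B) $$ (a, b)" using B C by simp
        then show ?thesis using CB \<open>a < d\<close> \<open>b < d\<close> by (simp add: colB' rowC')
      next
        assume "a < d" "\<not> b < d"
        then have "row C a \<bullet> u = (C *\<^sub>v u) $ a" using C by simp
        then show ?thesis using Cu \<open>a < d\<close> \<open>\<not> b < d\<close> ab by (simp add: colB' rowC')
      next
        assume "\<not> a < d" "b < d"
        then show ?thesis using ab rB[of "unit_vec d b"] by (simp add: colB' rowC' colB)
      next
        assume "\<not> a < d" "\<not> b < d"
        then show ?thesis using ab ru by (simp add: colB' rowC')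
      qed
      finally show "(C' * B') $$ (a, b) = 1\<^sub>m (Suc d) $$ (a, b)" .
    qed (auto simp: B'_def C'_def)
    moreover have "B' *\<^sub>v v \<in> W" if v: "v \<in> carrier_vec (Suc d)" for v
    proof -
      have "B' *\<^sub>v v = B *\<^sub>v vec d (\<lambda>i. v $ i) + v $ d \<cdot>\<^sub>v u"
        using v B un by (intro eq_vecI) (auto simp: B'_def scalar_prod_def)
      then show ?thesis using W uW BW[of "vec d (\<lambda>i. v $ i)"] by (simp add: lin_subspace_def)
    qed
    ultimately have "Q (Suc d)" unfolding Q_def using B' C' by blast
    then show False using max by fastforce
  qed
  with B C CB BW show ?thesis using that by blast
qed

lemma mat_eq_if_mult_vec_eq:
  fixes A B :: "'k :: semiring_1 mat"
  assumes A: "A \<in> carrier_mat n m" and B: "B \<in> carrier_mat n m"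
    and eq: "\<And>v. v \<in> carrier_vec m \<Longrightarrow> A *\<^sub>v v = B *\<^sub>v v"
  shows "A = B"
proof (rule eq_matI)
  fix i j assume "i < dim_row B" "j < dim_col B"
  then have ij: "i < n" "j < m" using B by auto
  have "col A j = col B j"
    using eq[of "unit_vec m j"] mult_unit_vec[OF A ij(2)] mult_unit_vec[OF B ij(2)] by simp
  then have "col A j $ i = col B j $ i" by simp
  then show "A $$ (i, j) = B $$ (i, j)" using ij A B by simp
qed (use A B in auto)

text \<open>
  In the coordinates \<open>B\<close>, \<open>C\<close> of an invariant subspace, \<open>A\<close> acts by the matrix \<open>C A B\<close>.
\<close>
lemma restrict_to_coordinates:
  fixes A :: "'k :: field mat"
  assumes A: "A \<in> carrier_mat n n" and B: "B \<in> carrier_mat n d" and C: "C \<in> carrier_mat d n"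
    and BW: "\<And>v. v \<in> carrier_vec d \<Longrightarrow> B *\<^sub>v v \<in> W" and BC: "\<And>w. w \<in> W \<Longrightarrow> B *\<^sub>v (C *\<^sub>v w) = w"
    and inv: "\<And>w. w \<in> W \<Longrightarrow> A *\<^sub>v w \<in> W"
  shows "A * B = B * (C * (A * B))"
proof (rule mat_eq_if_mult_vec_eq)
  fix v :: "'k vec" assume v: "v \<in> carrier_vec d"
  have AB: "A * B \<in> carrier_mat n d" using A B by simp
  have "B * (C * (A * B)) *\<^sub>v v = B *\<^sub>v (C *\<^sub>v ((A * B) *\<^sub>v v))"
    using assoc_mult_mat_vec[OF B _ v, of "C * (A * B)"] assoc_mult_mat_vec[OF C AB v] C AB by simp
  also have "\<dots> = B *\<^sub>v (C *\<^sub>v (A *\<^sub>v (B *\<^sub>v v)))"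
    by (simp only: assoc_mult_mat_vec[OF A B v])
  also have "\<dots> = A *\<^sub>v (B *\<^sub>v v)" by (intro BC inv BW v)
  also have "\<dots> = (A * B) *\<^sub>v v" by (simp only: assoc_mult_mat_vec[OF A B v])
  finally show "(A * B) *\<^sub>v v = B * (C * (A * B)) *\<^sub>v v" by simp
qed (use A B C in auto)

lemma mat_trace_carrier: "A \<in> carrier_mat n m \<Longrightarrow> mat_trace A = (\<Sum>i<n. A $$ (i,i))"
  by (simp add: mat_trace_def)

lemma mat_mult_entry:
  "A \<in> carrier_mat n m \<Longrightarrow> B \<in> carrier_mat m l \<Longrightarrow> i < n \<Longrightarrow> j < l \<Longrightarrow>
   (A * B) $$ (i, j) = (\<Sum>r<m. A $$ (i, r) * B $$ (r, j))"
  by (simp add: scalar_prod_def atLeast0LessThan)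

lemma mat_trace_mult_commute:
  fixes A :: "'k :: comm_semiring_0 mat"
  assumes "A \<in> carrier_mat n m" "B \<in> carrier_mat m n"
  shows "mat_trace (A * B) = mat_trace (B * A)"
proof -
  have "mat_trace (A * B) = (\<Sum>i<n. \<Sum>r<m. A $$ (i, r) * B $$ (r, i))"
    using assms by (simp add: mat_trace_def mat_mult_entry scalar_prod_def atLeast0LessThan)
  also have "\<dots> = (\<Sum>r<m. \<Sum>i<n. B $$ (r, i) * A $$ (i, r))"
    by (subst sum.swap) (simp add: mult.commute)
  also have "\<dots> = mat_trace (B * A)"
    using assms by (simp add: mat_trace_def mat_mult_entry scalar_prod_def atLeast0LessThan)
  finally show ?thesis .
qed

text \<open>
  In coordinates \<open>B\<close>, \<open>C\<close> of the image one has \<open>E = B (C E)\<close> and \<open>(C E) B = 1\<close>, so the trace is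
  that of an identity matrix.
\<close>
lemma idempotent_trace:
  fixes E :: "'k :: field mat"
  assumes E: "E \<in> carrier_mat n n" and idem: "E * E = E"
  obtains d where "mat_trace E = of_nat d" "d = 0 \<Longrightarrow> E = 0\<^sub>m n n"
proof -
  define W where "W = {E *\<^sub>v v | v. v \<in> carrier_vec n}"
  have W: "lin_subspace n W"
    unfolding W_def using E by (rule lin_subspace_image)
  obtain d B C where B: "B \<in> carrier_mat n d" and C: "C \<in> carrier_mat d n"
    and CB: "C * B = 1\<^sub>m d" and BW: "\<And>v. v \<in> carrier_vec d \<Longrightarrow> B *\<^sub>v v \<in> W"
    and BC: "\<And>w. w \<in> W \<Longrightarrow> B *\<^sub>v (C *\<^sub>v w) = w"
    by (rule subspace_coordinates[OF W], rule that)
  have EW: "E *\<^sub>v w = w" if "w \<in> W" for w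
  proof -
    obtain v where v: "v \<in> carrier_vec n" "w = E *\<^sub>v v" using \<open>w \<in> W\<close> by (auto simp: W_def)
    then show ?thesis using assoc_mult_mat_vec[OF E E v(1)] idem by simp
  qed
  have "B * (C * E) = E"
  proof (rule eq_matI)
    fix i j assume "i < dim_row E" "j < dim_col E"
    then have ij: "i < n" "j < n" using E by auto
    have "B * (C * E) *\<^sub>v unit_vec n j = B *\<^sub>v (C *\<^sub>v (E *\<^sub>v unit_vec n j))"
      using assoc_mult_mat_vec[OF B, of "C * E" n "unit_vec n j"]
        assoc_mult_mat_vec[OF C E, of "unit_vec n j"] C E by simp
    also have "\<dots> = E *\<^sub>v unit_vec n j"
      by (rule BC) (auto simp: W_def)
    finally have "(B * (C * E) *\<^sub>v unit_vec n j) $ i = (E *\<^sub>v unit_vec n j) $ i" by simp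
    then show "(B * (C * E)) $$ (i, j) = E $$ (i, j)" using ij E B C
      by (simp add: mult_unit_vec[of _ n])
  qed (use B C E in auto)
  moreover have "C * E * B = 1\<^sub>m d"
  proof -
    have "E * B = B"
    proof (rule eq_matI)
      fix i j assume "i < dim_row B" "j < dim_col B"
      then have ij: "i < n" "j < d" using B by auto
      have "E * B *\<^sub>v unit_vec d j = B *\<^sub>v unit_vec d j"
        using EW[OF BW[of "unit_vec d j"]] assoc_mult_mat_vec[OF E B, of "unit_vec d j"] by simp
      then have "(E * B *\<^sub>v unit_vec d j) $ i = (B *\<^sub>v unit_vec d j) $ i" by simp
      then show "(E * B) $$ (i, j) = B $$ (i, j)" using ij E B by (simp add: mult_unit_vec[of _ n d])
    qed (use B E in auto)
    then show ?thesis using CB B C E by (simp add: assoc_mult_mat[of _ d n _ n _ d])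
  qed
  ultimately have "mat_trace E = mat_trace (1\<^sub>m d :: 'k mat)"
    using mat_trace_mult_commute[of B n d "C * E"] B C E by simp
  then have tr: "mat_trace E = of_nat d" by (simp add: mat_trace_def)
  have "E = 0\<^sub>m n n" if "d = 0"
  proof -
    have "B * (C * E) = 0\<^sub>m n n" using B C E that by (intro eq_matI) (auto simp: scalar_prod_def)
    then show ?thesis using \<open>B * (C * E) = E\<close> by simp
  qed
  with tr show ?thesis using that by blast
qed

section \<open>Matrices of finite order and integer matrices\<close>

lemma sum_powers_root_of_unity:
  fixes z :: "'k :: field"
  assumes "z ^ k = 1" "z \<noteq> 1"
  shows "(\<Sum>j<k. z ^ j) = 0"
  using assms geometric_sum[of z k] by simp

lemma cis_root_power_neq_one:
  assumes "0 < j" "j < k"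
  shows "cis (2 * pi / real k) ^ j \<noteq> 1"
proof
  assume "cis (2 * pi / real k) ^ j = 1"
  then have "cis (2 * pi * real j / real k) = cis (2 * pi * real 0 / real k)"
    by (simp add: DeMoivre mult.commute)
  moreover have "inj_on (\<lambda>j. cis (2 * pi * real j / real k)) {..<k}"
    using bij_betw_roots_unity[of k] assms by (auto simp: bij_betw_def)
  ultimately have "j = 0" using assms by (subst (asm) inj_on_eq_iff) auto
  with assms show False by simp
qed

lemma cis_root_power_order: "0 < k \<Longrightarrow> cis (2 * pi / real k) ^ k = 1"
  by (simp add: DeMoivre)

lemma pow_mat_Suc_left:
  assumes "A \<in> carrier_mat n n"
  shows "A * A ^\<^sub>m t = A ^\<^sub>m Suc t"
proof (induction t)
  case (Suc t)
  have "A * A ^\<^sub>m Suc t = A * A ^\<^sub>m t * A"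
    using assms by (simp add: assoc_mult_mat[of _ n n _ n _ n])
  then show ?case using Suc by simp
qed (use assms in auto)

text \<open>
  For \<open>w\<close> a primitive \<open>k\<close>-th root of unity, the matrices
  \<open>E j = (1/k) \<Sum>t<k. w\<^bsup>-jt\<^esup> A\<^sup>t\<close> are idempotents that sum to the identity and satisfy
  \<open>A (E j) = w\<^sup>j (E j)\<close>: they are the spectral projections of \<open>A\<close>. The multiplicity \<open>r j\<close> of the
  eigenvalue \<open>w\<^sup>j\<close> is the trace of \<open>E j\<close>.
\<close>
lemma finite_order_trace:
  fixes A :: "complex mat"
  assumes A: "A \<in> carrier_mat n n" and k: "0 < k" and Ak: "A ^\<^sub>m k = 1\<^sub>m n"
  defines "w \<equiv> cis (2 * pi / real k)"
  obtains r :: "nat \<Rightarrow> nat" where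
    "\<And>t. mat_trace (A ^\<^sub>m t) = (\<Sum>j<k. of_nat (r j) * w ^ (j * t))"
    "(\<And>j. 0 < j \<Longrightarrow> j < k \<Longrightarrow> r j = 0) \<Longrightarrow> A = 1\<^sub>m n"
proof -
  define c where "c = cnj w"
  have wk: "w ^ k = 1" unfolding w_def by (rule cis_root_power_order[OF k])
  have cw: "c * w = 1" by (simp add: c_def w_def cis_cnj cis_mult)
  have ck: "c ^ k = 1" using wk cw by (metis mult.right_neutral power_mult_distrib power_one)
  have c_neq: "c ^ t \<noteq> 1" if "0 < t" "t < k" for t
    using cis_root_power_neq_one[OF that] cw
    by (metis complex_cnj_cnj complex_cnj_one complex_cnj_power c_def w_def)
  have At[simp]: "A ^\<^sub>m t \<in> carrier_mat n n" for t using A by simp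
  define E where "E j = mat n n (\<lambda>(a, b). (\<Sum>t<k. c ^ (j * t) * (A ^\<^sub>m t) $$ (a, b)) / of_nat k)" for j
  have E: "E j \<in> carrier_mat n n" for j by (simp add: E_def)
  have AE: "A * E j = w ^ j \<cdot>\<^sub>m E j" for j
  proof (rule eq_matI)
    fix a b assume "a < dim_row (w ^ j \<cdot>\<^sub>m E j)" "b < dim_col (w ^ j \<cdot>\<^sub>m E j)"
    then have ab: "a < n" "b < n" by (auto simp: E_def)
    define F where "F t = c ^ (j * t) * (A ^\<^sub>m t) $$ (a, b)" for t
    have "(A * E j) $$ (a, b) = (\<Sum>s<n. A $$ (a, s) * E j $$ (s, b))"
      by (rule mat_mult_entry[OF A E ab])
    also have "\<dots> = (\<Sum>s<n. \<Sum>t<k. c ^ (j * t) * (A $$ (a, s) * (A ^\<^sub>m t) $$ (s, b))) / of_nat k"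
      using ab by (simp add: E_def sum_distrib_left sum_divide_distrib mult.left_commute)
    also have "(\<Sum>s<n. \<Sum>t<k. c ^ (j * t) * (A $$ (a, s) * (A ^\<^sub>m t) $$ (s, b))) =
       (\<Sum>t<k. c ^ (j * t) * (A ^\<^sub>m Suc t) $$ (a, b))"
      by (subst sum.swap)
        (simp only: pow_mat_Suc_left[OF A, symmetric] mat_mult_entry[OF A At ab] sum_distrib_left)
    also have "\<dots> = (\<Sum>t<k. w ^ j * F (Suc t))"
    proof (rule sum.cong)
      fix t
      have "w ^ j * c ^ (j * Suc t) = (w * c) ^ j * c ^ (j * t)"
        by (simp add: power_add power_mult_distrib)
      then show "c ^ (j * t) * (A ^\<^sub>m Suc t) $$ (a, b) = w ^ j * F (Suc t)"
        using cw by (simp add: F_def mult.commute mult.assoc[symmetric])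
    qed simp
    also have "\<dots> = w ^ j * (\<Sum>t<k. F (Suc t))" by (simp add: sum_distrib_left)
    also have "(\<Sum>t<k. F (Suc t)) = (\<Sum>t<k. F t)"
    proof -
      have "F k = F 0" using Ak ck A by (simp add: F_def mult.commute[of j] power_mult)
      moreover have "F 0 + (\<Sum>t<k. F (Suc t)) = (\<Sum>t<k. F t) + F k"
        using sum.lessThan_Suc_shift[of F k] by simp
      ultimately show ?thesis by simp
    qed
    finally show "(A * E j) $$ (a, b) = (w ^ j \<cdot>\<^sub>m E j) $$ (a, b)"
      using ab by (simp add: F_def E_def)
  qed (use A E[of j] in auto)
  have AtE: "A ^\<^sub>m t * E j = w ^ (j * t) \<cdot>\<^sub>m E j" for t j
  proof (induction t)
    case 0
    then show ?case using A E[of j] by auto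
  next
    case (Suc t)
    have "A ^\<^sub>m Suc t * E j = A ^\<^sub>m t * (A * E j)"
      using assoc_mult_mat[OF At A E] by simp
    also have "\<dots> = w ^ j \<cdot>\<^sub>m (A ^\<^sub>m t * E j)"
      unfolding AE by (rule mult_smult_distrib[OF At E])
    also have "\<dots> = w ^ (j * Suc t) \<cdot>\<^sub>m E j"
      unfolding Suc by (intro eq_matI) (auto simp: power_add)
    finally show ?case .
  qed
  have idem: "E j * E j = E j" for j
  proof (rule eq_matI)
    fix a b assume "a < dim_row (E j)" "b < dim_col (E j)"
    then have ab: "a < n" "b < n" by (auto simp: E_def)
    have "(E j * E j) $$ (a, b) = (\<Sum>s<n. E j $$ (a, s) * E j $$ (s, b))"
      by (rule mat_mult_entry[OF E E ab])
    also have "\<dots> = (\<Sum>s<n. (\<Sum>t<k. c ^ (j * t) * ((A ^\<^sub>m t) $$ (a, s) * E j $$ (s, b))) / of_nat k)"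
    proof (rule sum.cong)
      fix s assume "s \<in> {..<n}"
      then have "E j $$ (a, s) = (\<Sum>t<k. c ^ (j * t) * (A ^\<^sub>m t) $$ (a, s)) / of_nat k"
        using ab by (simp add: E_def)
      then show "E j $$ (a, s) * E j $$ (s, b) =
          (\<Sum>t<k. c ^ (j * t) * ((A ^\<^sub>m t) $$ (a, s) * E j $$ (s, b))) / of_nat k"
        by (simp add: sum_distrib_right sum_divide_distrib mult.assoc)
    qed simp
    also have "\<dots> = (\<Sum>s<n. \<Sum>t<k. c ^ (j * t) * ((A ^\<^sub>m t) $$ (a, s) * E j $$ (s, b))) / of_nat k"
      by (simp add: sum_divide_distrib)
    also have "(\<Sum>s<n. \<Sum>t<k. c ^ (j * t) * ((A ^\<^sub>m t) $$ (a, s) * E j $$ (s, b))) =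
       (\<Sum>t<k. c ^ (j * t) * (A ^\<^sub>m t * E j) $$ (a, b))"
      by (subst sum.swap) (simp only: mat_mult_entry[OF At E ab] sum_distrib_left)
    also have "\<dots> = (\<Sum>t<k. E j $$ (a, b))"
    proof (rule sum.cong)
      fix t
      have "c ^ (j * t) * w ^ (j * t) = 1" using cw by (simp flip: power_mult_distrib)
      then show "c ^ (j * t) * (A ^\<^sub>m t * E j) $$ (a, b) = E j $$ (a, b)"
        unfolding AtE using ab E[of j] by (simp add: mult.assoc[symmetric])
    qed simp
    finally show "(E j * E j) $$ (a, b) = E j $$ (a, b)" using k by simp
  qed (use E in auto)
  have sumE: "(\<Sum>j<k. E j $$ (a, b)) = (1\<^sub>m n :: complex mat) $$ (a, b)" if ab: "a < n" "b < n" for a b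
  proof -
    have "(\<Sum>j<k. E j $$ (a, b)) = (\<Sum>j<k. \<Sum>t<k. c ^ (j * t) * (A ^\<^sub>m t) $$ (a, b)) / of_nat k"
      using ab by (simp add: E_def sum_divide_distrib)
    also have "(\<Sum>j<k. \<Sum>t<k. c ^ (j * t) * (A ^\<^sub>m t) $$ (a, b)) =
       (\<Sum>t<k. (\<Sum>j<k. (c ^ t) ^ j) * (A ^\<^sub>m t) $$ (a, b))"
      unfolding sum_distrib_right
      by (subst sum.swap) (simp add: power_mult[symmetric] mult.commute)
    also have "\<dots> = (\<Sum>t<k. if t = 0 then of_nat k * (A ^\<^sub>m 0) $$ (a, b) else 0)"
    proof (rule sum.cong)
      fix t assume "t \<in> {..<k}"
      then show "(\<Sum>j<k. (c ^ t) ^ j) * (A ^\<^sub>m t) $$ (a, b) = (if t = 0 then of_nat k * (A ^\<^sub>m 0) $$ (a, b) else 0)"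
        using c_neq[of t] sum_powers_root_of_unity[of "c ^ t" k] ck
        by (simp add: power_mult[symmetric] mult.commute[of t] power_mult[of c k])
    qed simp
    finally show ?thesis using k A ab by simp
  qed
  have At_sum: "(A ^\<^sub>m t) $$ (a, b) = (\<Sum>j<k. w ^ (j * t) * E j $$ (a, b))" if ab: "a < n" "b < n" for a b t
  proof -
    have "(A ^\<^sub>m t) $$ (a, b) = (A ^\<^sub>m t * 1\<^sub>m n) $$ (a, b)" by (simp only: right_mult_one_mat[OF At])
    also have "\<dots> = (\<Sum>s<n. (A ^\<^sub>m t) $$ (a, s) * (\<Sum>j<k. E j $$ (s, b)))"
      using ab by (subst mat_mult_entry[OF At _ ab]) (auto simp: sumE intro!: sum.cong)
    also have "\<dots> = (\<Sum>j<k. (A ^\<^sub>m t * E j) $$ (a, b))"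
      by (simp only: mat_mult_entry[OF At E ab] sum_distrib_left) (rule sum.swap)
    finally show ?thesis using ab by (simp add: AtE carrier_matD[OF E])
  qed
  have "\<forall>j. \<exists>d. mat_trace (E j) = of_nat d \<and> (d = 0 \<longrightarrow> E j = 0\<^sub>m n n)"
    using idempotent_trace[OF E idem] by metis
  then obtain r :: "nat \<Rightarrow> nat" where r: "\<And>j. mat_trace (E j) = of_nat (r j)" "\<And>j. r j = 0 \<Longrightarrow> E j = 0\<^sub>m n n"
    by metis
  show ?thesis
  proof (rule that[of r])
    fix t
    have "mat_trace (A ^\<^sub>m t) = (\<Sum>a<n. \<Sum>j<k. w ^ (j * t) * E j $$ (a, a))"
      by (simp add: mat_trace_carrier[OF At] At_sum)
    also have "\<dots> = (\<Sum>j<k. of_nat (r j) * w ^ (j * t))"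
      by (subst sum.swap) (simp add: r(1)[symmetric] mat_trace_carrier[OF E] sum_distrib_left mult.commute)
    finally show "mat_trace (A ^\<^sub>m t) = (\<Sum>j<k. of_nat (r j) * w ^ (j * t))" .
  next
    assume "\<And>j. 0 < j \<Longrightarrow> j < k \<Longrightarrow> r j = 0"
    then have E0: "E j $$ (a, b) = 0" if "0 < j" "j < k" "a < n" "b < n" for j a b
      using r(2)[of j] that by simp
    show "A = 1\<^sub>m n"
    proof (rule eq_matI)
      fix a b assume "a < dim_row (1\<^sub>m n :: complex mat)" "b < dim_col (1\<^sub>m n :: complex mat)"
      then have ab: "a < n" "b < n" by auto
      have "A $$ (a, b) = (\<Sum>j<k. w ^ (j * 1) * E j $$ (a, b))" using At_sum[OF ab, of 1] A by simp
      also have "\<dots> = (\<Sum>j<k. E j $$ (a, b))"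
        using E0 ab by (intro sum.cong) (auto, metis gr0I mult_1 power_0)
      finally show "A $$ (a, b) = 1\<^sub>m n $$ (a, b)" using sumE[OF ab] by simp
    qed (use A in auto)
  qed
qed

lemma det_cong:
  fixes A B :: "int mat"
  assumes A: "A \<in> carrier_mat m m" and B: "B \<in> carrier_mat m m"
    and cong: "\<And>i j. i < m \<Longrightarrow> j < m \<Longrightarrow> [A $$ (i, j) = B $$ (i, j)] (mod q)"
  shows "[det A = det B] (mod q)"
  unfolding det_def'[OF A] det_def'[OF B]
proof (rule cong_sum)
  fix p assume "p \<in> {p. p permutes {0..<m}}"
  then have "p i < m" if "i < m" for i using that permutes_in_image[of p "{0..<m}" i] by auto
  then have "[(\<Prod>i = 0..<m. A $$ (i, p i)) = (\<Prod>i = 0..<m. B $$ (i, p i))] (mod q)"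
    using cong by (intro cong_prod) auto
  then show "[signof p * (\<Prod>i = 0..<m. A $$ (i, p i)) = signof p * (\<Prod>i = 0..<m. B $$ (i, p i))] (mod q)"
    by (rule cong_scalar_left)
qed

text \<open>
  A rational eigenvalue \<open>p / q\<close> of an integer matrix is an integer: the integer matrix \<open>p 1 - q Z\<close> is
  singular, while modulo \<open>q\<close> its determinant is a power of \<open>p\<close>.
\<close>
lemma integer_matrix_rational_eigenvalue_denominator:
  fixes Z :: "'i \<Rightarrow> 'i \<Rightarrow> int" and v :: "'i \<Rightarrow> complex" and p q :: int
  assumes I: "finite I" and "coprime p q" and "q > 0"
    and v: "\<exists>i\<in>I. v i \<noteq> 0"
    and ev: "\<And>i. i \<in> I \<Longrightarrow> of_int p * v i = of_int q * (\<Sum>j\<in>I. of_int (Z i j) * v j)"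
  shows "q = 1"
proof -
  define m where "m = card I"
  obtain h where h: "bij_betw h {0..<m} I" using ex_bij_betw_nat_finite[OF I] by (auto simp: m_def)
  define M where "M = mat m m (\<lambda>(a, b). (if a = b then p else 0) - q * Z (h a) (h b))"
  have M: "M \<in> carrier_mat m m" by (simp add: M_def)
  define M' where "M' = map_mat (of_int :: int \<Rightarrow> complex) M"
  have M': "M' \<in> carrier_mat m m" using M by (simp add: M'_def)
  define u where "u = vec m (\<lambda>a. v (h a))"
  have "M' *\<^sub>v u = 0\<^sub>v m"
  proof (rule eq_vecI)
    fix a assume "a < dim_vec (0\<^sub>v m :: complex vec)"
    then have a: "a < m" by simp
    have ha: "h a \<in> I" using h a by (auto simp: bij_betw_def)
    have "(M' *\<^sub>v u) $ a = (\<Sum>b=0..<m. (if a = b then of_int p else 0) * v (h b) - of_int q * (of_int (Z (h a) (h b)) * v (h b)))"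
      using a by (auto simp: M'_def M_def u_def scalar_prod_def algebra_simps intro!: sum.cong)
    also have "\<dots> = of_int p * v (h a) - of_int q * (\<Sum>b=0..<m. of_int (Z (h a) (h b)) * v (h b))"
      using a by (simp add: sum_subtractf sum_distrib_left if_distrib[of "\<lambda>x. x * _"] cong: if_cong)
    also have "(\<Sum>b=0..<m. of_int (Z (h a) (h b)) * v (h b)) = (\<Sum>j\<in>I. of_int (Z (h a) j) * v j)"
      by (rule sum.reindex_bij_betw[OF h])
    finally show "(M' *\<^sub>v u) $ a = 0\<^sub>v m $ a" using ev[OF ha] a by simp
  qed (use M' in auto)
  moreover have "u \<noteq> 0\<^sub>v m"
  proof
    assume u0: "u = 0\<^sub>v m"
    obtain i where i: "i \<in> I" "v i \<noteq> 0" using v by blast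
    then obtain a where a: "a < m" "h a = i" using h by (auto simp: bij_betw_def)
    have "u $ a = 0" using u0 a by simp
    then show False using a i by (simp add: u_def)
  qed
  ultimately have "det M' = 0"
    using det_0_iff_vec_prod_zero[OF M'] by (metis u_def vec_carrier)
  then have "det M = 0" unfolding M'_def by (simp add: of_int_hom.hom_det)
  moreover have "[det M = det (p \<cdot>\<^sub>m 1\<^sub>m m)] (mod q)"
    by (rule det_cong[OF M]) (auto simp: M_def cong_iff_dvd_diff)
  ultimately have "[0 = p ^ m] (mod q)" by simp
  then have "q dvd p ^ m" using cong_0_iff cong_sym by blast
  moreover have "coprime q (p ^ m)" using \<open>coprime p q\<close> by (simp add: coprime_commute)
  ultimately have "is_unit q" by (metis coprime_absorb_left)
  then show ?thesis using \<open>q > 0\<close> by simp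
qed

section \<open>Matrix representations of finite groups\<close>

locale finite_group = group G for G (structure) +
  assumes finite_carrier [simp, intro]: "finite (carrier G)"
begin

lemma sum_left_translate:
  fixes f :: "'a \<Rightarrow> 'c :: comm_monoid_add"
  assumes "h \<in> carrier G"
  shows "(\<Sum>g\<in>carrier G. f (h \<otimes> g)) = (\<Sum>g\<in>carrier G. f g)"
  using assms by (intro sum.reindex_bij_witness[of _ "\<lambda>g. inv h \<otimes> g" "\<lambda>g. h \<otimes> g"])
    (auto simp: m_assoc[symmetric])

lemma sum_right_translate:
  fixes f :: "'a \<Rightarrow> 'c :: comm_monoid_add"
  assumes "h \<in> carrier G"
  shows "(\<Sum>g\<in>carrier G. f (g \<otimes> h)) = (\<Sum>g\<in>carrier G. f g)"
  using assms by (intro sum.reindex_bij_witness[of _ "\<lambda>g. g \<otimes> inv h" "\<lambda>g. g \<otimes> h"])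
    (auto simp: m_assoc)

lemma sum_inverse:
  fixes f :: "'a \<Rightarrow> 'c :: comm_monoid_add"
  shows "(\<Sum>g\<in>carrier G. f (inv g)) = (\<Sum>g\<in>carrier G. f g)"
  by (intro sum.reindex_bij_witness[of _ "\<lambda>g. inv g" "\<lambda>g. inv g"]) auto

lemma pow_order_eq_one: "g \<in> carrier G \<Longrightarrow> g [^] card (carrier G) = \<one>"
  using pow_order_eq_1 by (simp add: Coset.order_def)

end

lemma monoid_ring_mat: "Group.monoid (ring_mat TYPE('k :: semiring_1) n b)"
  by (unfold_locales) (auto simp: ring_mat_def)

context group
begin

lemma complex_rep_carrier:
  assumes "complex_rep G n \<rho>" "g \<in> carrier G"
  shows "\<rho> g \<in> carrier_mat n n"
proof -
  have "\<rho> g \<in> Units (ring_mat TYPE(complex) n ())"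
    using assms by (auto simp: complex_rep_def hom_def units_of_def)
  then show ?thesis by (auto simp: Units_def ring_mat_def)
qed

lemma complex_rep_mult:
  assumes "complex_rep G n \<rho>" "g \<in> carrier G" "h \<in> carrier G"
  shows "\<rho> (g \<otimes> h) = \<rho> g * \<rho> h"
  using assms by (auto simp: complex_rep_def hom_def units_of_def ring_mat_def)

lemma complex_rep_group_hom:
  assumes "complex_rep G n \<rho>"
  shows "group_hom G (GL_complex n) \<rho>"
proof -
  interpret M: Group.monoid "ring_mat TYPE(complex) n ()" by (rule monoid_ring_mat)
  show ?thesis using assms is_group M.units_group
    by (simp add: group_hom_def group_hom_axioms_def complex_rep_def)
qed

lemma complex_rep_one:
  assumes "complex_rep G n \<rho>"
  shows "\<rho> \<one> = 1\<^sub>m n"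
proof -
  have "\<rho> \<one> = \<one>\<^bsub>GL_complex n\<^esub>"
    using complex_rep_group_hom[OF assms] by (rule group_hom.hom_one)
  then show ?thesis by (simp add: units_of_def ring_mat_def)
qed

lemma complex_repI:
  assumes "\<And>g. g \<in> carrier G \<Longrightarrow> \<rho> g \<in> carrier_mat n n"
    and "\<And>g h. g \<in> carrier G \<Longrightarrow> h \<in> carrier G \<Longrightarrow> \<rho> (g \<otimes> h) = \<rho> g * \<rho> h"
    and "\<rho> \<one> = 1\<^sub>m n"
  shows "complex_rep G n \<rho>"
proof -
  have "\<rho> g \<in> Units (ring_mat TYPE(complex) n ())" if "g \<in> carrier G" for g
    unfolding Units_def using that assms(1)[of g] assms(1)[of "inv g"] assms(2)[of g "inv g"]
      assms(2)[of "inv g" g] assms(3)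
    by (auto simp: ring_mat_def intro!: bexI[of _ "\<rho> (inv g)"])
  then show ?thesis using assms(2)
    by (auto simp: complex_rep_def hom_def units_of_def ring_mat_def)
qed

lemma complex_rep_pow:
  assumes "complex_rep G n \<rho>" "g \<in> carrier G"
  shows "\<rho> (g [^] (k :: nat)) = \<rho> g ^\<^sub>m k"
proof (induction k)
  case 0
  then show ?case using assms complex_rep_one complex_rep_carrier[OF assms] by auto
next
  case (Suc k)
  then show ?case using assms by (simp add: complex_rep_mult)
qed

lemma rep_character_eq_trace: "g \<in> carrier G \<Longrightarrow> rep_character G \<rho> g = mat_trace (\<rho> g)"
  by (simp add: rep_character_def)

lemma rep_character_one: "complex_rep G n \<rho> \<Longrightarrow> rep_character G \<rho> \<one> = of_nat n"
  by (simp add: rep_character_def complex_rep_one mat_trace_def)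

lemma irreducible_repD:
  assumes "irreducible_rep G n \<rho>"
  shows "complex_rep G n \<rho>" "n > 0"
    "\<And>W. lin_subspace n W \<Longrightarrow> (\<And>g w. g \<in> carrier G \<Longrightarrow> w \<in> W \<Longrightarrow> \<rho> g *\<^sub>v w \<in> W) \<Longrightarrow>
        W = {0\<^sub>v n} \<or> W = carrier_vec n"
  using assms unfolding irreducible_rep_def subspace_iff_lin_subspace by auto

section \<open>Schur's lemma and orthogonality\<close>

text \<open>
  Schur's lemma: kernel and image of an intertwiner are invariant subspaces, so a nonzero one is bijective.
  The columns of the inverse are the preimages of the unit vectors.
\<close>
lemma intertwiner_invertible:
  assumes irr: "irreducible_rep G n \<rho>" "irreducible_rep G m \<sigma>"
    and A: "A \<in> carrier_mat n m"
    and comm: "\<And>g. g \<in> carrier G \<Longrightarrow> \<rho> g * A = A * \<sigma> g"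
    and nz: "A \<noteq> 0\<^sub>m n m"
  obtains D where "D \<in> carrier_mat m n" "D * A = 1\<^sub>m m" "A * D = 1\<^sub>m n"
proof -
  note rho = irreducible_repD[OF irr(1)] and sigma = irreducible_repD[OF irr(2)]
  have act: "\<rho> g *\<^sub>v (A *\<^sub>v v) = A *\<^sub>v (\<sigma> g *\<^sub>v v)" if "g \<in> carrier G" "v \<in> carrier_vec m" for g v
    using comm[OF that(1)] that(2) A complex_rep_carrier[OF rho(1) that(1)] complex_rep_carrier[OF sigma(1) that(1)]
    by (metis assoc_mult_mat_vec)
  obtain i j where ij: "i < n" "j < m" "A $$ (i, j) \<noteq> 0"
    using nz A by (metis carrier_matD(1) carrier_matD(2) eq_matI index_zero_mat(1) index_zero_mat(2) index_zero_mat(3))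
  have Aj: "A *\<^sub>v unit_vec m j \<noteq> 0\<^sub>v n"
  proof
    assume "A *\<^sub>v unit_vec m j = 0\<^sub>v n"
    then have "(A *\<^sub>v unit_vec m j) $ i = 0" using ij by simp
    then show False using ij A by (simp add: mult_unit_vec[of _ n])
  qed
  define K where "K = {v \<in> carrier_vec m. A *\<^sub>v v = 0\<^sub>v n}"
  have "lin_subspace m K"
    unfolding lin_subspace_def K_def using A
    by (auto simp: mult_add_distrib_mat_vec[of _ n m] mult_mat_vec[of _ n m])
  moreover have "\<sigma> g *\<^sub>v w \<in> K" if "g \<in> carrier G" "w \<in> K" for g w
  proof -
    have "\<rho> g *\<^sub>v 0\<^sub>v n = 0\<^sub>v n" using complex_rep_carrier[OF rho(1) that(1)] by auto
    then show ?thesis using that act[of g w] complex_rep_carrier[OF sigma(1) that(1)]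
      by (auto simp: K_def)
  qed
  ultimately have "K = {0\<^sub>v m} \<or> K = carrier_vec m" by (rule sigma(3))
  moreover have "unit_vec m j \<notin> K" using Aj by (simp add: K_def)
  ultimately have K: "K = {0\<^sub>v m}" using ij by auto
  have inj: "u = w" if "u \<in> carrier_vec m" "w \<in> carrier_vec m" "A *\<^sub>v u = A *\<^sub>v w" for u w
  proof -
    have "A *\<^sub>v (u - w) = 0\<^sub>v n" using that A by (simp add: mult_minus_distrib_mat_vec[of _ n m])
    then have "u - w \<in> K" using that unfolding K_def by auto
    then have "u - w = 0\<^sub>v m" using K by blast
    then have "(u - w) $ i = 0" if "i < m" for i using that by simp
    then show ?thesis using that by (intro eq_vecI) auto
  qed
  define W where "W = {A *\<^sub>v v | v. v \<in> carrier_vec m}"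
  have "lin_subspace n W"
    unfolding W_def using A by (rule lin_subspace_image)
  moreover have "\<rho> g *\<^sub>v w \<in> W" if g: "g \<in> carrier G" and w: "w \<in> W" for g w
  proof -
    obtain v where v: "v \<in> carrier_vec m" "w = A *\<^sub>v v" using w by (auto simp: W_def)
    then have "\<sigma> g *\<^sub>v v \<in> carrier_vec m" using complex_rep_carrier[OF sigma(1) g] by simp
    then show ?thesis using act[OF g v(1)] v(2) unfolding W_def by blast
  qed
  ultimately have "W = {0\<^sub>v n} \<or> W = carrier_vec n" by (rule rho(3))
  moreover have "A *\<^sub>v unit_vec m j \<in> W" unfolding W_def by auto
  ultimately have W: "W = carrier_vec n" using Aj by auto
  have "\<forall>k. \<exists>v. k < n \<longrightarrow> v \<in> carrier_vec m \<and> A *\<^sub>v v = unit_vec n k"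
  proof
    fix k
    have "unit_vec n k \<in> W" using W by simp
    then show "\<exists>v. k < n \<longrightarrow> v \<in> carrier_vec m \<and> A *\<^sub>v v = unit_vec n k"
      unfolding W_def by auto
  qed
  then obtain f where f: "\<And>k. k < n \<Longrightarrow> f k \<in> carrier_vec m" "\<And>k. k < n \<Longrightarrow> A *\<^sub>v f k = unit_vec n k"
    by metis
  define D where "D = mat m n (\<lambda>(a, k). f k $ a)"
  have D: "D \<in> carrier_mat m n" by (simp add: D_def)
  have colD: "col D k = f k" if "k < n" for k
    using that f(1)[OF that] by (intro eq_vecI) (auto simp: D_def)
  have AD: "A * D = 1\<^sub>m n"
  proof (rule eq_matI)
    fix a b assume "a < dim_row (1\<^sub>m n :: complex mat)" "b < dim_col (1\<^sub>m n :: complex mat)"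
    then have ab: "a < n" "b < n" by auto
    then have "(A * D) $$ (a, b) = (A *\<^sub>v f b) $ a" using A D by (simp add: colD)
    then show "(A * D) $$ (a, b) = 1\<^sub>m n $$ (a, b)" using ab f by simp
  qed (use A D in auto)
  have "D * A = 1\<^sub>m m"
  proof (rule eq_matI)
    fix a b assume "a < dim_row (1\<^sub>m m :: complex mat)" "b < dim_col (1\<^sub>m m :: complex mat)"
    then have ab: "a < m" "b < m" by auto
    have "A *\<^sub>v ((D * A) *\<^sub>v unit_vec m b) = (A * D) *\<^sub>v (A *\<^sub>v unit_vec m b)"
    proof -
      have "A *\<^sub>v unit_vec m b \<in> carrier_vec n" using A by simp
      then show ?thesis
        using assoc_mult_mat_vec[OF D A, of "unit_vec m b"] assoc_mult_mat_vec[OF A D, of "A *\<^sub>v unit_vec m b"]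
        by simp
    qed
    also have "\<dots> = A *\<^sub>v unit_vec m b" unfolding AD using A by simp
    finally have "(D * A) *\<^sub>v unit_vec m b = unit_vec m b" using A D by (rule_tac inj) auto
    then have "((D * A) *\<^sub>v unit_vec m b) $ a = unit_vec m b $ a" by simp
    then show "(D * A) $$ (a, b) = 1\<^sub>m m $$ (a, b)" using ab A D by (simp add: mult_unit_vec[of _ m])
  qed (use A D in auto)
  with D AD show ?thesis using that by blast
qed

text \<open>
  Schur's lemma over the complex numbers: \<open>A\<close> has an eigenvalue \<open>k\<close>, and \<open>A - k 1\<close> commutes with the
  representation without being injective.
\<close>
lemma commuting_matrix_scalar:
  assumes irr: "irreducible_rep G n \<rho>" and A: "A \<in> carrier_mat n n"
    and comm: "\<And>g. g \<in> carrier G \<Longrightarrow> \<rho> g * A = A * \<rho> g"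
  obtains c where "A = c \<cdot>\<^sub>m 1\<^sub>m n"
proof -
  note rho = irreducible_repD[OF irr]
  have "spectrum A \<noteq> {}" using A rho(2) by (simp add: spectrum_non_empty)
  then obtain k v where v: "v \<in> carrier_vec n" "v \<noteq> 0\<^sub>v n" "A *\<^sub>v v = k \<cdot>\<^sub>v v"
    using A unfolding spectrum_def eigenvalue_def eigenvector_def by auto
  define B where "B = A + (-k) \<cdot>\<^sub>m 1\<^sub>m n"
  have B: "B \<in> carrier_mat n n" using A by (simp add: B_def)
  have Bv: "B *\<^sub>v v = 0\<^sub>v n"
    using v A by (intro eq_vecI) (auto simp: B_def add_mult_distrib_mat_vec[of _ n n])
  have Bcomm: "\<rho> g * B = B * \<rho> g" if g: "g \<in> carrier G" for g
  proof -
    have R: "\<rho> g \<in> carrier_mat n n" by (rule complex_rep_carrier[OF rho(1) g])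
    have "\<rho> g * B = \<rho> g * A + \<rho> g * ((-k) \<cdot>\<^sub>m 1\<^sub>m n)"
      unfolding B_def using A R by (intro mult_add_distrib_mat) auto
    also have "\<rho> g * ((-k) \<cdot>\<^sub>m 1\<^sub>m n) = (-k) \<cdot>\<^sub>m 1\<^sub>m n * \<rho> g"
      using R mult_smult_distrib[of "\<rho> g" n n "1\<^sub>m n" n "-k"] mult_smult_assoc_mat[of "1\<^sub>m n" n n "\<rho> g" n "-k"]
      by simp
    also have "\<rho> g * A + (-k) \<cdot>\<^sub>m 1\<^sub>m n * \<rho> g = B * \<rho> g"
      unfolding B_def comm[OF g] using A R by (intro add_mult_distrib_mat[symmetric]) auto
    finally show ?thesis .
  qed
  have "B = 0\<^sub>m n n"
  proof (rule ccontr)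
    assume "B \<noteq> 0\<^sub>m n n"
    then obtain D where D: "D \<in> carrier_mat n n" "D * B = 1\<^sub>m n"
      using intertwiner_invertible[OF irr irr B Bcomm] by blast
    have "v = (D * B) *\<^sub>v v" unfolding D(2) using v(1) by simp
    also have "\<dots> = D *\<^sub>v (B *\<^sub>v v)" by (rule assoc_mult_mat_vec[OF D(1) B v(1)])
    also have "\<dots> = 0\<^sub>v n" unfolding Bv using D(1) by auto
    finally show False using v by simp
  qed
  have "A = k \<cdot>\<^sub>m 1\<^sub>m n"
  proof (rule eq_matI)
    fix i j assume "i < dim_row (k \<cdot>\<^sub>m 1\<^sub>m n :: complex mat)" "j < dim_col (k \<cdot>\<^sub>m 1\<^sub>m n :: complex mat)"
    then have ij: "i < n" "j < n" by auto
    have "B $$ (i, j) = 0" using \<open>B = 0\<^sub>m n n\<close> ij by simp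
    then show "A $$ (i, j) = (k \<cdot>\<^sub>m 1\<^sub>m n) $$ (i, j)" using ij A by (simp add: B_def)
  qed (use A in auto)
  then show ?thesis using that by blast
qed

end

context finite_group
begin

text \<open>
  The matrix \<open>A\<close> is the average of \<open>\<rho>(g) X \<sigma>(g\<^sup>-\<^sup>1)\<close> over the group for the matrix unit
  \<open>X\<close> at position \<open>(j, k)\<close>; translating the summation variable by \<open>h\<close> shows that it intertwines.
\<close>
lemma averaged_intertwiner:
  assumes \<rho>: "complex_rep G n \<rho>" and \<sigma>: "complex_rep G m \<sigma>" and jk: "j < n" "k < m"
    and h: "h \<in> carrier G"
  defines "A \<equiv> mat n m (\<lambda>(i, l). \<Sum>g\<in>carrier G. \<rho> g $$ (i, j) * \<sigma> (inv g) $$ (k, l))"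
  shows "\<rho> h * A = A * \<sigma> h"
proof (rule eq_matI)
  note [simp] = complex_rep_carrier[OF \<rho>] complex_rep_carrier[OF \<sigma>]
  fix i l assume "i < dim_row (A * \<sigma> h)" "l < dim_col (A * \<sigma> h)"
  then have il: "i < n" "l < m" using complex_rep_carrier[OF \<sigma> h] by (auto simp: A_def)
  have A: "A \<in> carrier_mat n m" by (simp add: A_def)
  define F where "F g = \<rho> g $$ (i, j) * \<sigma> (inv g \<otimes> h) $$ (k, l)" for g
  have "(\<rho> h * A) $$ (i, l) = (\<Sum>r<n. \<rho> h $$ (i, r) * A $$ (r, l))"
    using mat_mult_entry[OF complex_rep_carrier[OF \<rho> h] A il] .
  also have "\<dots> = (\<Sum>r<n. \<Sum>g\<in>carrier G. \<rho> h $$ (i, r) * \<rho> g $$ (r, j) * \<sigma> (inv g) $$ (k, l))"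
    using il by (intro sum.cong) (auto simp: A_def sum_distrib_left mult.assoc)
  also have "\<dots> = (\<Sum>g\<in>carrier G. \<Sum>r<n. \<rho> h $$ (i, r) * \<rho> g $$ (r, j) * \<sigma> (inv g) $$ (k, l))"
    by (rule sum.swap)
  also have "\<dots> = (\<Sum>g\<in>carrier G. F (h \<otimes> g))"
  proof (rule sum.cong)
    fix g assume g: "g \<in> carrier G"
    have "inv (h \<otimes> g) \<otimes> h = inv g" using g h by (simp add: inv_mult_group m_assoc)
    moreover have "\<rho> (h \<otimes> g) $$ (i, j) = (\<Sum>r<n. \<rho> h $$ (i, r) * \<rho> g $$ (r, j))"
      using mat_mult_entry[OF complex_rep_carrier[OF \<rho> h] complex_rep_carrier[OF \<rho> g]] il jk g h
      by (simp add: complex_rep_mult[OF \<rho>])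
    ultimately show "(\<Sum>r<n. \<rho> h $$ (i, r) * \<rho> g $$ (r, j) * \<sigma> (inv g) $$ (k, l)) = F (h \<otimes> g)"
      by (simp add: F_def sum_distrib_right)
  qed simp
  also have "\<dots> = (\<Sum>g\<in>carrier G. F g)" by (rule sum_left_translate[OF h])
  also have "\<dots> = (\<Sum>g\<in>carrier G. \<Sum>s<m. \<rho> g $$ (i, j) * \<sigma> (inv g) $$ (k, s) * \<sigma> h $$ (s, l))"
  proof (rule sum.cong)
    fix g assume g: "g \<in> carrier G"
    have "\<sigma> (inv g \<otimes> h) $$ (k, l) = (\<Sum>s<m. \<sigma> (inv g) $$ (k, s) * \<sigma> h $$ (s, l))"
      using mat_mult_entry[OF complex_rep_carrier[OF \<sigma>, of "inv g"] complex_rep_carrier[OF \<sigma> h]] il jk g h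
      by (simp add: complex_rep_mult[OF \<sigma>])
    then show "F g = (\<Sum>s<m. \<rho> g $$ (i, j) * \<sigma> (inv g) $$ (k, s) * \<sigma> h $$ (s, l))"
      by (simp add: F_def sum_distrib_left mult.assoc)
  qed simp
  also have "\<dots> = (\<Sum>s<m. \<Sum>g\<in>carrier G. \<rho> g $$ (i, j) * \<sigma> (inv g) $$ (k, s) * \<sigma> h $$ (s, l))"
    by (rule sum.swap)
  also have "\<dots> = (\<Sum>s<m. A $$ (i, s) * \<sigma> h $$ (s, l))"
    using il by (intro sum.cong) (auto simp: A_def sum_distrib_right)
  also have "\<dots> = (A * \<sigma> h) $$ (i, l)"
    using mat_mult_entry[OF A complex_rep_carrier[OF \<sigma> h] il] by simp
  finally show "(\<rho> h * A) $$ (i, l) = (A * \<sigma> h) $$ (i, l)" .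
qed (use complex_rep_carrier[OF \<rho> h] complex_rep_carrier[OF \<sigma> h] in \<open>auto simp: A_def\<close>)

text \<open>
  An invertible intertwiner would make the representations similar and their traces equal, so the averaged
  intertwiner vanishes.
\<close>
lemma coefficients_orthogonal_if_characters_differ:
  assumes irr: "irreducible_rep G n \<rho>" "irreducible_rep G m \<sigma>"
    and neq: "rep_character G \<rho> \<noteq> rep_character G \<sigma>"
    and ijkl: "i < n" "j < n" "k < m" "l < m"
  shows "(\<Sum>g\<in>carrier G. \<rho> g $$ (i, j) * \<sigma> (inv g) $$ (k, l)) = 0"
proof -
  note rho = irreducible_repD[OF irr(1)] and sigma = irreducible_repD[OF irr(2)]
  define A where "A = mat n m (\<lambda>(i, l). \<Sum>g\<in>carrier G. \<rho> g $$ (i, j) * \<sigma> (inv g) $$ (k, l))"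
  have A: "A \<in> carrier_mat n m" by (simp add: A_def)
  have comm: "\<And>h. h \<in> carrier G \<Longrightarrow> \<rho> h * A = A * \<sigma> h"
    unfolding A_def using averaged_intertwiner[OF rho(1) sigma(1) ijkl(2,3)] .
  have "A = 0\<^sub>m n m"
  proof (rule ccontr)
    assume "A \<noteq> 0\<^sub>m n m"
    then obtain D where D: "D \<in> carrier_mat m n" "D * A = 1\<^sub>m m" "A * D = 1\<^sub>m n"
      using intertwiner_invertible[OF irr A comm] by blast
    have "mat_trace (\<rho> g) = mat_trace (\<sigma> g)" if g: "g \<in> carrier G" for g
    proof -
      have R: "\<rho> g \<in> carrier_mat n n" and S: "\<sigma> g \<in> carrier_mat m m"
        using complex_rep_carrier[OF rho(1) g] complex_rep_carrier[OF sigma(1) g] .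
      have "\<rho> g = \<rho> g * (A * D)" using D R by simp
      also have "\<dots> = A * \<sigma> g * D" using assoc_mult_mat[OF R A D(1)] comm[OF g] by simp
      also have "\<dots> = A * (\<sigma> g * D)" using assoc_mult_mat[OF A S D(1)] .
      finally have "mat_trace (\<rho> g) = mat_trace (\<sigma> g * D * A)"
        using mat_trace_mult_commute[OF A, of "\<sigma> g * D"] S D by simp
      also have "\<sigma> g * D * A = \<sigma> g" using assoc_mult_mat[OF S D(1) A] D(2) S by simp
      finally show ?thesis .
    qed
    then have "rep_character G \<rho> = rep_character G \<sigma>"
      by (auto simp: rep_character_def restrict_def)
    with neq show False ..
  qed
  then have "A $$ (i, l) = 0" using ijkl by simp
  then show ?thesis using ijkl by (simp add: A_def)
qed

text \<open>
  The averaged intertwiner is a scalar, which its trace determines.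
\<close>
lemma coefficients_orthogonal:
  assumes irr: "irreducible_rep G n \<rho>" and ijkl: "i < n" "j < n" "k < n" "l < n"
  shows "(\<Sum>g\<in>carrier G. \<rho> g $$ (i, j) * \<rho> (inv g) $$ (k, l)) =
    (if i = l \<and> j = k then of_nat (card (carrier G)) / of_nat n else 0)"
proof -
  note rho = irreducible_repD[OF irr]
  define A where "A = mat n n (\<lambda>(i, l). \<Sum>g\<in>carrier G. \<rho> g $$ (i, j) * \<rho> (inv g) $$ (k, l))"
  have A: "A \<in> carrier_mat n n" by (simp add: A_def)
  have comm: "\<And>h. h \<in> carrier G \<Longrightarrow> \<rho> h * A = A * \<rho> h"
    unfolding A_def using averaged_intertwiner[OF rho(1) rho(1) ijkl(2,3)] .
  obtain c where c: "A = c \<cdot>\<^sub>m 1\<^sub>m n" using commuting_matrix_scalar[OF irr A comm] by blast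
  have "of_nat n * c = (\<Sum>a<n. A $$ (a, a))" by (simp add: c)
  also have "\<dots> = (\<Sum>g\<in>carrier G. \<Sum>a<n. \<rho> (inv g) $$ (k, a) * \<rho> g $$ (a, j))"
    by (subst sum.swap) (simp add: A_def mult.commute)
  also have "\<dots> = (\<Sum>g\<in>carrier G. if k = j then 1 else 0)"
  proof (rule sum.cong)
    fix g assume g: "g \<in> carrier G"
    have "\<rho> (inv g \<otimes> g) = \<rho> (inv g) * \<rho> g" using g by (intro complex_rep_mult[OF rho(1)]) auto
    then have "(\<Sum>a<n. \<rho> (inv g) $$ (k, a) * \<rho> g $$ (a, j)) = \<rho> (inv g \<otimes> g) $$ (k, j)"
      using mat_mult_entry[OF complex_rep_carrier[OF rho(1), of "inv g"] complex_rep_carrier[OF rho(1) g] ijkl(3,2)] g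
      by (simp only: inv_closed)
    then show "(\<Sum>a<n. \<rho> (inv g) $$ (k, a) * \<rho> g $$ (a, j)) = (if k = j then 1 else 0)"
      using g ijkl by (simp add: complex_rep_one[OF rho(1)])
  qed simp
  finally have "c = (if k = j then of_nat (card (carrier G)) / of_nat n else 0)"
    using rho(2) by (auto simp: field_simps split: if_splits)
  moreover have "A $$ (i, l) = (if i = l then c else 0)" using ijkl by (simp add: c)
  ultimately show ?thesis using ijkl by (auto simp: A_def)
qed

text \<open>
  The element \<open>\<Sum>g. \<chi>(g\<^sup>-\<^sup>1) g\<close> of the group algebra acts as the scalar \<open>|G| / n\<close>.
\<close>
lemma character_averages_to_scalar:
  assumes irr: "irreducible_rep G n \<rho>" and il: "i < n" "l < n"
  shows "(\<Sum>g\<in>carrier G. \<rho> g $$ (i, l) * mat_trace (\<rho> (inv g))) =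
    (if i = l then of_nat (card (carrier G)) / of_nat n else 0)"
proof -
  note rho = irreducible_repD[OF irr]
  have "(\<Sum>g\<in>carrier G. \<rho> g $$ (i, l) * mat_trace (\<rho> (inv g))) =
    (\<Sum>g\<in>carrier G. \<Sum>k<n. \<rho> g $$ (i, l) * \<rho> (inv g) $$ (k, k))"
    by (intro sum.cong) (auto simp: mat_trace_carrier[OF complex_rep_carrier[OF rho(1)]] sum_distrib_left)
  also have "\<dots> = (\<Sum>k<n. \<Sum>g\<in>carrier G. \<rho> g $$ (i, l) * \<rho> (inv g) $$ (k, k))" by (rule sum.swap)
  also have "\<dots> = (\<Sum>k<n. if k = l then (if i = l then of_nat (card (carrier G)) / of_nat n else 0) else 0)"
    using coefficients_orthogonal[OF irr il] by (intro sum.cong) auto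
  finally show ?thesis using il by simp
qed

text \<open>
  By orthogonality the \<open>n\<^sup>2 + m\<^sup>2\<close> matrix coefficients of both representations have a dual family,
  so as functions on the group they are linearly independent.
\<close>
lemma degree_squares_le:
  assumes irr: "irreducible_rep G n \<rho>" "irreducible_rep G m \<sigma>"
    and neq: "rep_character G \<rho> \<noteq> rep_character G \<sigma>"
  shows "n * n + m * m \<le> card (carrier G)"
proof -
  define N where "N = (of_nat (card (carrier G)) :: complex)"
  have N: "N \<noteq> 0" unfolding N_def using finite_carrier one_closed by (auto simp: card_eq_0_iff)
  note rho = irreducible_repD[OF irr(1)] and sigma = irreducible_repD[OF irr(2)]
  define P where "P s g = (case s of Inl (i, j) \<Rightarrow> \<rho> g $$ (i, j) | Inr (i, j) \<Rightarrow> \<sigma> g $$ (i, j))"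
    for s :: "nat \<times> nat + nat \<times> nat" and g
  define Q where "Q g s = (case s of Inl (i, j) \<Rightarrow> of_nat n / N * \<rho> (inv g) $$ (j, i)
      | Inr (i, j) \<Rightarrow> of_nat m / N * \<sigma> (inv g) $$ (j, i))"
    for s :: "nat \<times> nat + nat \<times> nat" and g
  have "card (({..<n} \<times> {..<n}) <+> ({..<m} \<times> {..<m})) \<le> card (carrier G)"
  proof (rule card_le_if_biorthogonal[where P = P and Q = Q])
    fix s t assume "s \<in> {..<n} \<times> {..<n} <+> {..<m} \<times> {..<m}" "t \<in> {..<n} \<times> {..<n} <+> {..<m} \<times> {..<m}"
    moreover have swap: "(\<Sum>g\<in>carrier G. a g * (c * b g) / N) = c * (\<Sum>g\<in>carrier G. a g * b g) / N"
      for a b :: "'a \<Rightarrow> complex" and c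
      by (simp add: sum_distrib_left sum_divide_distrib mult.left_commute)
    ultimately show "(\<Sum>g\<in>carrier G. P s g * Q g t) = (if s = t then 1 else 0)"
      using N rho(2) sigma(2)
        coefficients_orthogonal[OF irr(1)] coefficients_orthogonal[OF irr(2)]
        coefficients_orthogonal_if_characters_differ[OF irr neq]
        coefficients_orthogonal_if_characters_differ[OF irr(2,1) neq[symmetric]]
      by (auto simp: P_def Q_def swap simp flip: N_def split: if_splits)
  qed auto
  then show ?thesis by (simp add: card_Plus)
qed

end

section \<open>Character values and degrees\<close>

context finite_group
begin

lemma card_carrier_pos: "0 < card (carrier G)"
  using finite_carrier one_closed card_gt_0_iff by blast

text \<open>
  Character values are sums of \<open>|G|\<close>-th roots of unity, because the order of \<open>\<rho> g\<close> divides \<open>|G|\<close>.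
\<close>
lemma character_values:
  assumes \<rho>: "complex_rep G n \<rho>" and g: "g \<in> carrier G"
  defines "N \<equiv> card (carrier G)"
  defines "w \<equiv> cis (2 * pi / real N)"
  obtains r :: "nat \<Rightarrow> nat" where
    "mat_trace (\<rho> g) = (\<Sum>j<N. of_nat (r j) * w ^ j)"
    "mat_trace (\<rho> (inv g)) = cnj (mat_trace (\<rho> g))"
    "(\<Sum>j<N. r j) = n"
    "(\<forall>j. 0 < j \<longrightarrow> j < N \<longrightarrow> r j = 0) \<Longrightarrow> \<rho> g = 1\<^sub>m n"
proof -
  have N: "0 < N" using card_carrier_pos by (simp add: N_def)
  have A: "\<rho> g \<in> carrier_mat n n" by (rule complex_rep_carrier[OF \<rho> g])
  have "\<rho> g ^\<^sub>m N = \<rho> (g [^] N)" by (rule complex_rep_pow[OF \<rho> g, symmetric])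
  also have "\<dots> = 1\<^sub>m n" using pow_order_eq_one[OF g] complex_rep_one[OF \<rho>] by (simp add: N_def)
  finally have AN: "\<rho> g ^\<^sub>m N = 1\<^sub>m n" .
  obtain r :: "nat \<Rightarrow> nat" where
    tr: "\<And>t. mat_trace (\<rho> g ^\<^sub>m t) = (\<Sum>j<N. of_nat (r j) * w ^ (j * t))"
    and triv: "(\<forall>j. 0 < j \<longrightarrow> j < N \<longrightarrow> r j = 0) \<Longrightarrow> \<rho> g = 1\<^sub>m n"
    by (rule finite_order_trace[OF A N AN, folded w_def], rule that, assumption, blast)
  have tr1: "mat_trace (\<rho> g) = (\<Sum>j<N. of_nat (r j) * w ^ j)" using tr[of 1] A by simp
  have "(of_nat (\<Sum>j<N. r j) :: complex) = mat_trace (1\<^sub>m n :: complex mat)" using tr[of 0] A by simp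
  also have "\<dots> = of_nat n" by (simp add: mat_trace_def)
  finally have deg: "(\<Sum>j<N. r j) = n" by (simp only: of_nat_eq_iff)
  have "inv g = g [^] (N - 1)"
  proof (rule inv_equality)
    have "g [^] (N - 1) \<otimes> g = g [^] Suc (N - 1)" by simp
    also have "\<dots> = \<one>" using pow_order_eq_one[OF g] N by (simp add: N_def del: nat_pow_Suc)
    finally show "g [^] (N - 1) \<otimes> g = \<one>" .
  qed (use g in auto)
  then have "mat_trace (\<rho> (inv g)) = (\<Sum>j<N. of_nat (r j) * w ^ (j * (N - 1)))"
    using tr[of "N - 1"] complex_rep_pow[OF \<rho> g] by simp
  also have "\<dots> = (\<Sum>j<N. of_nat (r j) * cnj (w ^ j))"
  proof (rule sum.cong)
    fix j
    have "w ^ (j * (N - 1)) * w ^ j = w ^ (j * N)"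
      using N by (simp flip: power_add) (simp add: algebra_simps mult_eq_if)
    also have "\<dots> = 1"
      using cis_root_power_order[OF N] by (simp add: w_def mult.commute[of j] power_mult)
    finally have "w ^ (j * (N - 1)) * w ^ j = 1" .
    moreover have "cnj (w ^ j) * w ^ j = 1"
      by (simp add: w_def cis_cnj cis_mult flip: power_mult_distrib)
    moreover have "w ^ j \<noteq> 0" by (simp add: w_def)
    ultimately have "w ^ (j * (N - 1)) = cnj (w ^ j)" by (metis mult_right_cancel)
    then show "of_nat (r j) * w ^ (j * (N - 1)) = of_nat (r j) * cnj (w ^ j)" by simp
  qed simp
  finally have inv: "mat_trace (\<rho> (inv g)) = cnj (mat_trace (\<rho> g))" using tr1 by simp
  show ?thesis by (rule that[OF tr1 inv deg triv])
qed

text \<open>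
  A sum of \<open>n\<close> roots of unity equals \<open>n\<close> only if all of them are \<open>1\<close>: compare real parts.
\<close>
lemma trace_eq_degree_imp_one:
  assumes \<rho>: "complex_rep G n \<rho>" and g: "g \<in> carrier G" and tr: "mat_trace (\<rho> g) = of_nat n"
  shows "\<rho> g = 1\<^sub>m n"
proof -
  define N where "N = card (carrier G)"
  define w where "w = cis (2 * pi / real N)"
  obtain r :: "nat \<Rightarrow> nat" where r: "mat_trace (\<rho> g) = (\<Sum>j<N. of_nat (r j) * w ^ j)"
    "mat_trace (\<rho> (inv g)) = cnj (mat_trace (\<rho> g))"
    "(\<Sum>j<N. r j) = n" "(\<forall>j. 0 < j \<longrightarrow> j < N \<longrightarrow> r j = 0) \<Longrightarrow> \<rho> g = 1\<^sub>m n"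
    by (rule character_values[OF \<rho> g, folded N_def, folded w_def], rule that)
  have nw: "cmod (w ^ j) = 1" for j by (simp add: w_def norm_power)
  have "(\<Sum>j<N. real (r j) * Re (w ^ j)) = Re (mat_trace (\<rho> g))" by (simp add: r(1))
  also have "\<dots> = (\<Sum>j<N. real (r j))" using tr r(3) by (simp flip: of_nat_sum)
  finally have "(\<Sum>j<N. real (r j) * (1 - Re (w ^ j))) = 0" by (simp add: algebra_simps sum_subtractf)
  moreover have "0 \<le> real (r j) * (1 - Re (w ^ j))" for j
    using complex_Re_le_cmod[of "w ^ j"] nw[of j] by simp
  ultimately have z: "real (r j) * (1 - Re (w ^ j)) = 0" if "j < N" for j
    using that by (subst (asm) sum_nonneg_eq_0_iff) auto
  have "r j = 0" if j: "0 < j" "j < N" for j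
  proof (rule ccontr)
    assume "r j \<noteq> 0"
    then have Re: "Re (w ^ j) = 1" using z[OF j(2)] by simp
    then have "Im (w ^ j) = 0" using nw[of j] by (simp add: cmod_def)
    then have "w ^ j = 1" using Re by (simp add: complex_eq_iff)
    then show False using cis_root_power_neq_one[OF j] by (simp add: w_def)
  qed
  then show ?thesis using r(4) by blast
qed

lemma character_kernel_rep:
  assumes "complex_rep G n \<rho>"
  shows "character_kernel G (rep_character G \<rho>) = {g \<in> carrier G. \<rho> g = 1\<^sub>m n}"
proof -
  have "mat_trace (\<rho> g) = of_nat n \<longleftrightarrow> \<rho> g = 1\<^sub>m n" if "g \<in> carrier G" for g
  proof
    assume "\<rho> g = 1\<^sub>m n"
    then show "mat_trace (\<rho> g) = of_nat n" by (simp add: mat_trace_def)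
  next
    assume "mat_trace (\<rho> g) = of_nat n"
    then show "\<rho> g = 1\<^sub>m n" by (rule trace_eq_degree_imp_one[OF assms that])
  qed
  then show ?thesis
    unfolding character_kernel_def rep_character_one[OF assms]
    by (intro Collect_cong conj_cong refl) (simp only: rep_character_eq_trace)
qed

text \<open>
  The numbers \<open>v (j, h) = w\<^sup>j \<rho>(h)\<^sub>0\<^sub>0\<close> generate an additive group that is stable under \<open>|G| / n\<close>.
  Indeed, multiplying \<open>\<rho>(h)\<close> by \<open>\<Sum>g. \<chi>(g\<^sup>-\<^sup>1) \<rho>(g) = |G| / n\<close> expresses \<open>(|G| / n) v\<close> through \<open>v\<close> with
  the integer matrix \<open>Z\<close>, because character values are integral combinations of powers of \<open>w\<close>. Hence
  \<open>|G| / n\<close> is a rational eigenvalue of an integer matrix.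
\<close>
lemma degree_dvd_card:
  assumes irr: "irreducible_rep G n \<rho>"
  shows "n dvd card (carrier G)"
proof -
  note rho = irreducible_repD[OF irr]
  define N where "N = card (carrier G)"
  define w where "w = cis (2 * pi / real N)"
  have N: "0 < N" using card_carrier_pos by (simp add: N_def)
  have wN: "w ^ N = 1" unfolding w_def by (rule cis_root_power_order[OF N])
  have wmod: "w ^ (s mod N) = w ^ s" for s
  proof -
    have "w ^ s = w ^ (N * (s div N) + s mod N)" by simp
    also have "\<dots> = w ^ (s mod N)" by (simp only: power_add power_mult wN power_one mult_1)
    finally show ?thesis by simp
  qed
  have "\<exists>r :: nat \<Rightarrow> nat. mat_trace (\<rho> g) = (\<Sum>j<N. of_nat (r j) * w ^ j)"
    if "g \<in> carrier G" for g
    by (rule character_values[OF rho(1) that, folded N_def, folded w_def]) (rule exI)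
  then obtain r :: "'a \<Rightarrow> nat \<Rightarrow> nat"
    where r: "\<And>g. g \<in> carrier G \<Longrightarrow> mat_trace (\<rho> g) = (\<Sum>j<N. of_nat (r g j) * w ^ j)"
    by metis
  define v where "v x = w ^ fst x * \<rho> (snd x) $$ (0, 0)" for x :: "nat \<times> 'a"
  \<comment> \<open>Powers of \<open>w\<close> are reduced modulo \<open>N\<close>, so that the index set of \<open>v\<close> is finite.\<close>
  define Z where "Z x y = (\<Sum>s<N. if (s + fst x) mod N = fst y then int (r (snd x \<otimes> inv (snd y)) s) else 0)"
    for x y :: "nat \<times> 'a"
  define I where "I = {..<N} \<times> carrier G"
  have ev: "of_nat N * v x = of_nat n * (\<Sum>y\<in>I. of_int (Z x y) * v y)" if x: "x \<in> I" for x
  proof -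
    obtain j h where x': "x = (j, h)" "j < N" "h \<in> carrier G" using x by (auto simp: I_def)
    have "(\<Sum>y\<in>I. of_int (Z x y) * v y) =
      (\<Sum>g\<in>carrier G. \<Sum>t<N. of_int (Z x (t, g)) * v (t, g))"
      unfolding I_def by (subst sum.swap) (simp add: sum.cartesian_product case_prod_unfold)
    also have "\<dots> = (\<Sum>g\<in>carrier G. w ^ j * (mat_trace (\<rho> (h \<otimes> inv g)) * \<rho> g $$ (0, 0)))"
    proof (rule sum.cong)
      fix g assume g: "g \<in> carrier G"
      have "(\<Sum>t<N. of_int (Z x (t, g)) * v (t, g)) =
        (\<Sum>t<N. \<Sum>s<N. if (s + j) mod N = t then of_nat (r (h \<otimes> inv g) s) * (w ^ t * \<rho> g $$ (0, 0)) else 0)"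
        by (intro sum.cong) (auto simp: Z_def v_def x' of_int_sum sum_distrib_right intro!: sum.cong)
      also have "\<dots> = (\<Sum>s<N. \<Sum>t<N. if (s + j) mod N = t then of_nat (r (h \<otimes> inv g) s) * (w ^ t * \<rho> g $$ (0, 0)) else 0)"
        by (rule sum.swap)
      also have "\<dots> = (\<Sum>s<N. of_nat (r (h \<otimes> inv g) s) * (w ^ (s + j) * \<rho> g $$ (0, 0)))"
        using N by (simp add: wmod)
      also have "\<dots> = w ^ j * (mat_trace (\<rho> (h \<otimes> inv g)) * \<rho> g $$ (0, 0))"
        using r[of "h \<otimes> inv g"] g x' by (simp add: sum_distrib_left sum_distrib_right power_add mult_ac)
      finally show "(\<Sum>t<N. of_int (Z x (t, g)) * v (t, g)) =
        w ^ j * (mat_trace (\<rho> (h \<otimes> inv g)) * \<rho> g $$ (0, 0))" .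
    qed simp
    also have "\<dots> = w ^ j * (\<Sum>g\<in>carrier G. mat_trace (\<rho> (h \<otimes> inv g)) * \<rho> g $$ (0, 0))"
      by (simp add: sum_distrib_left)
    also have "(\<Sum>g\<in>carrier G. mat_trace (\<rho> (h \<otimes> inv g)) * \<rho> g $$ (0, 0)) =
      (\<Sum>g\<in>carrier G. mat_trace (\<rho> (h \<otimes> inv (g \<otimes> h))) * \<rho> (g \<otimes> h) $$ (0, 0))"
      by (rule sum_right_translate[OF x'(3), symmetric])
    also have "\<dots> = (\<Sum>g\<in>carrier G. \<Sum>l<n. \<rho> h $$ (l, 0) * (\<rho> g $$ (0, l) * mat_trace (\<rho> (inv g))))"
    proof (rule sum.cong)
      fix g assume g: "g \<in> carrier G"
      have "h \<otimes> inv (g \<otimes> h) = inv g" using g x' by (simp add: inv_mult_group m_assoc[symmetric])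
      moreover have "\<rho> (g \<otimes> h) $$ (0, 0) = (\<Sum>l<n. \<rho> g $$ (0, l) * \<rho> h $$ (l, 0))"
        unfolding complex_rep_mult[OF rho(1) g x'(3)]
        by (rule mat_mult_entry[OF complex_rep_carrier[OF rho(1) g] complex_rep_carrier[OF rho(1) x'(3)] rho(2,2)])
      ultimately show "mat_trace (\<rho> (h \<otimes> inv (g \<otimes> h))) * \<rho> (g \<otimes> h) $$ (0, 0) =
        (\<Sum>l<n. \<rho> h $$ (l, 0) * (\<rho> g $$ (0, l) * mat_trace (\<rho> (inv g))))"
        by (simp add: sum_distrib_left mult_ac)
    qed simp
    also have "\<dots> = (\<Sum>l<n. \<rho> h $$ (l, 0) * (\<Sum>g\<in>carrier G. \<rho> g $$ (0, l) * mat_trace (\<rho> (inv g))))"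
      by (subst sum.swap) (simp add: sum_distrib_left)
    also have "\<dots> = (\<Sum>l<n. if l = 0 then \<rho> h $$ (0, 0) * (of_nat N / of_nat n) else 0)"
      using character_averages_to_scalar[OF irr rho(2)] by (intro sum.cong) (auto simp: N_def)
    also have "\<dots> = \<rho> h $$ (0, 0) * (of_nat N / of_nat n)" using rho(2) by simp
    finally show ?thesis using rho(2) by (simp add: v_def x')
  qed
  \<comment> \<open>\<open>N / n = p / q\<close> in lowest terms\<close>
  define d where "d = gcd N n"
  obtain p q where pq: "N = d * p" "n = d * q" "coprime p q"
  proof -
    have "gcd N n \<noteq> 0" using N by simp
    from gcd_coprime_exists[OF this] obtain p q
      where e: "N = p * gcd N n" "n = q * gcd N n" "coprime p q" by blast
    have "N = d * p" unfolding d_def using e(1) by (rule trans) (rule mult.commute)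
    moreover have "n = d * q" unfolding d_def using e(2) by (rule trans) (rule mult.commute)
    ultimately show ?thesis using e(3) by (rule that)
  qed
  have "d > 0" "q > 0" using pq rho(2) N by auto
  have "int q = 1"
  proof (rule integer_matrix_rational_eigenvalue_denominator[of I "int p" "int q" v Z])
    show "finite I" by (simp add: I_def)
    show "coprime (int p) (int q)" using pq(3) by simp
    show "int q > 0" using \<open>q > 0\<close> by simp
    show "\<exists>i\<in>I. v i \<noteq> 0"
      using N rho(2) by (intro bexI[of _ "(0, \<one>)"]) (auto simp: v_def I_def complex_rep_one[OF rho(1)])
    fix x assume "x \<in> I"
    have "of_nat d * (of_nat p * v x) = of_nat d * (of_nat q * (\<Sum>y\<in>I. of_int (Z x y) * v y))"
      using ev[OF \<open>x \<in> I\<close>] unfolding arg_cong[OF pq(1), of "of_nat :: nat \<Rightarrow> complex"]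
        arg_cong[OF pq(2), of "of_nat :: nat \<Rightarrow> complex"] of_nat_mult by (simp only: mult.assoc)
    then show "of_int (int p) * v x = of_int (int q) * (\<Sum>y\<in>I. of_int (Z x y) * v y)"
      using \<open>d > 0\<close> by simp
  qed
  then have "n = d" using pq(2) by simp
  moreover have "d dvd N" unfolding d_def by simp
  ultimately show ?thesis unfolding N_def by blast
qed

section \<open>Codegrees of faithful characters\<close>

text \<open>
  Divisibility of \<open>|G|\<close> by the degree makes the definite description of the codegree well defined.
\<close>
lemma codegree_faithful:
  assumes irr: "irreducible_rep G n \<rho>"
    and faithful: "\<And>g. g \<in> carrier G \<Longrightarrow> \<rho> g = 1\<^sub>m n \<Longrightarrow> g = \<one>"
  shows "codegree G (rep_character G \<rho>) * n = card (carrier G)"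
proof -
  note rho = irreducible_repD[OF irr]
  have ker: "character_kernel G (rep_character G \<rho>) = {\<one>}"
    using faithful complex_rep_one[OF rho(1)] by (auto simp: character_kernel_rep[OF rho(1)])
  have "card (rcosets {\<one>}) * card {\<one>} = card (carrier G)"
    using lagrange[OF triv_subgroup] by (simp add: Coset.order_def)
  then have ind: "card (rcosets {\<one>}) = card (carrier G)" by simp
  obtain a where a: "card (carrier G) = n * a" using degree_dvd_card[OF irr] by auto
  have "codegree G (rep_character G \<rho>) = a"
    unfolding codegree_def ker ind rep_character_one[OF rho(1)]
  proof (rule the_equality)
    show "of_nat a = (of_nat (card (carrier G)) :: complex) / of_nat n" using a rho(2) by simp
    fix b assume "of_nat b = (of_nat (card (carrier G)) :: complex) / of_nat n"
    then have "of_nat b = (of_nat a :: complex)" using a rho(2) by simp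
    then show "b = a" by (simp only: of_nat_eq_iff)
  qed
  then show ?thesis using a by simp
qed

text \<open>
  Coprime codegrees \<open>|G| / n\<close> and \<open>|G| / m\<close> would force \<open>|G| \<le> n m\<close>, while
  \<open>2 n m \<le> n\<^sup>2 + m\<^sup>2 \<le> |G|\<close>.
\<close>
lemma faithful_codegrees_not_coprime:
  assumes irr: "irreducible_rep G n \<rho>" "irreducible_rep G m \<sigma>"
    and faithful: "\<And>g. g \<in> carrier G \<Longrightarrow> \<rho> g = 1\<^sub>m n \<Longrightarrow> g = \<one>" "\<And>g. g \<in> carrier G \<Longrightarrow> \<sigma> g = 1\<^sub>m m \<Longrightarrow> g = \<one>"
    and neq: "rep_character G \<rho> \<noteq> rep_character G \<sigma>"
  shows "gcd (codegree G (rep_character G \<rho>)) (codegree G (rep_character G \<sigma>)) \<noteq> 1"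
proof
  define a b N where "a = codegree G (rep_character G \<rho>)" and "b = codegree G (rep_character G \<sigma>)"
    and "N = card (carrier G)"
  assume "gcd (codegree G (rep_character G \<rho>)) (codegree G (rep_character G \<sigma>)) = 1"
  then have cop: "coprime a b" by (simp add: a_def b_def coprime_iff_gcd_eq_1)
  have aN: "a * n = N" and bN: "b * m = N"
    using codegree_faithful[OF irr(1) faithful(1)] codegree_faithful[OF irr(2) faithful(2)]
    by (auto simp: a_def b_def N_def)
  have "a dvd N" "b dvd N" using aN bN by (metis dvd_triv_left)+
  then have "a * b dvd N" using cop by (intro divides_mult)
  then have ab: "a * b \<le> N" using card_carrier_pos by (intro dvd_imp_le) (auto simp: N_def)
  have N: "N > 0" using card_carrier_pos by (simp add: N_def)
  have "N * N = (a * n) * (b * m)" by (simp only: aN bN)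
  also have "\<dots> = (a * b) * (n * m)" by (simp only: mult_ac)
  also have "\<dots> \<le> N * (n * m)" using ab by simp
  finally have "N \<le> n * m" using N by simp
  moreover have "n * n + m * m \<le> N" using degree_squares_le[OF irr neq] by (simp add: N_def)
  moreover have "2 * (n * m) \<le> n * n + m * m"
  proof -
    have "0 \<le> (int n - int m)\<^sup>2" by simp
    then have "2 * (int n * int m) \<le> int n * int n + int m * int m" by (simp add: power2_eq_square algebra_simps)
    then show ?thesis by (metis of_nat_add of_nat_le_iff of_nat_mult of_nat_numeral)
  qed
  ultimately show False using N by linarith
qed

end

section \<open>Completeness of the irreducible characters\<close>

context group
begin

text \<open>
  Among all parametrised nonzero invariant subspaces of \<open>W\<close> take one of least dimension \<open>d\<close>. Coordinates
  of an invariant subspace of \<open>\<complex>\<^sup>d\<close> compose with those of the chosen one, so minimality gives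
  irreducibility.
\<close>
lemma irreducible_subrepresentation:
  assumes \<rho>: "complex_rep G n \<rho>" and W: "lin_subspace n W" and nz: "W \<noteq> {0\<^sub>v n}"
    and inv: "\<And>g w. g \<in> carrier G \<Longrightarrow> w \<in> W \<Longrightarrow> \<rho> g *\<^sub>v w \<in> W"
  obtains d \<sigma> B C where "irreducible_rep G d \<sigma>" "B \<in> carrier_mat n d" "C \<in> carrier_mat d n" "C * B = 1\<^sub>m d"
    "\<And>v. v \<in> carrier_vec d \<Longrightarrow> B *\<^sub>v v \<in> W" "\<And>g. g \<in> carrier G \<Longrightarrow> \<rho> g * B = B * \<sigma> g"
proof -
  note R = complex_rep_carrier[OF \<rho>]
  define Q where "Q d B C \<longleftrightarrow> d > 0 \<and> B \<in> carrier_mat n d \<and> C \<in> carrier_mat d n \<and> C * B = 1\<^sub>m d \<and>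
     (\<forall>v\<in>carrier_vec d. B *\<^sub>v v \<in> W) \<and> (\<forall>g\<in>carrier G. \<rho> g * B = B * (C * (\<rho> g * B)))" for d B C
  have "\<exists>d B C. Q d B C"
  proof -
    obtain d B C where B: "B \<in> carrier_mat n d" and C: "C \<in> carrier_mat d n" and CB: "C * B = 1\<^sub>m d"
      and BW: "\<And>v. v \<in> carrier_vec d \<Longrightarrow> B *\<^sub>v v \<in> W" and BC: "\<And>w. w \<in> W \<Longrightarrow> B *\<^sub>v (C *\<^sub>v w) = w"
      by (rule subspace_coordinates[OF W], rule that)
    have "d > 0"
    proof (rule ccontr)
      assume "\<not> d > 0"
      have "w = 0\<^sub>v n" if w: "w \<in> W" for w
      proof -
        have "B *\<^sub>v (C *\<^sub>v w) = 0\<^sub>v n"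
          using B C \<open>\<not> d > 0\<close> by (intro eq_vecI) (auto simp: scalar_prod_def)
        then show ?thesis using BC[OF w] by simp
      qed
      moreover have "0\<^sub>v n \<in> W" using W by (simp add: lin_subspace_def)
      ultimately show False using nz by blast
    qed
    moreover have "\<rho> g * B = B * (C * (\<rho> g * B))" if g: "g \<in> carrier G" for g
      by (rule restrict_to_coordinates[OF R[OF g] B C BW BC inv[OF g]])
    ultimately have "Q d B C" unfolding Q_def using B C CB BW by blast
    then show ?thesis by blast
  qed
  then obtain d where d: "\<exists>B C. Q d B C" and min: "\<And>d'. \<exists>B C. Q d' B C \<Longrightarrow> d \<le> d'"
    using exists_least_iff[of "\<lambda>d. \<exists>B C. Q d B C"] not_less by metis
  obtain B C where Q: "Q d B C" using d by blast
  then have B: "B \<in> carrier_mat n d" and C: "C \<in> carrier_mat d n" and CB: "C * B = 1\<^sub>m d" and d0: "d > 0"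
    and BW: "\<And>v. v \<in> carrier_vec d \<Longrightarrow> B *\<^sub>v v \<in> W"
    and B\<sigma>: "\<And>g. g \<in> carrier G \<Longrightarrow> \<rho> g * B = B * (C * (\<rho> g * B))"
    unfolding Q_def by auto
  define \<sigma> where "\<sigma> g = C * (\<rho> g * B)" for g
  have S: "\<sigma> g \<in> carrier_mat d d" if "g \<in> carrier G" for g
    using R[OF that] B C by (simp add: \<sigma>_def)
  have inter: "\<rho> g * B = B * \<sigma> g" if "g \<in> carrier G" for g
    unfolding \<sigma>_def by (rule B\<sigma>[OF that])
  have cancel: "C * (B * X) = X" if "X \<in> carrier_mat d m" for X m
    using assoc_mult_mat[OF C B that] CB that by simp
  have rep: "complex_rep G d \<sigma>"
  proof (rule complex_repI)
    fix g h assume g: "g \<in> carrier G" and h: "h \<in> carrier G"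
    have "\<rho> (g \<otimes> h) * B = \<rho> g * (\<rho> h * B)"
      unfolding complex_rep_mult[OF \<rho> g h] by (rule assoc_mult_mat[OF R[OF g] R[OF h] B])
    also have "\<dots> = \<rho> g * B * \<sigma> h"
      unfolding inter[OF h] by (rule assoc_mult_mat[OF R[OF g] B S[OF h], symmetric])
    also have "\<dots> = B * (\<sigma> g * \<sigma> h)"
      unfolding inter[OF g] by (rule assoc_mult_mat[OF B S[OF g] S[OF h]])
    finally show "\<sigma> (g \<otimes> h) = \<sigma> g * \<sigma> h"
      using cancel[of "\<sigma> g * \<sigma> h" d] S[OF g] S[OF h] by (simp add: \<sigma>_def)
  next
    show "\<sigma> \<one> = 1\<^sub>m d" using CB B by (simp add: \<sigma>_def complex_rep_one[OF \<rho>])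
  qed (rule S)
  have "irreducible_rep G d \<sigma>"
    unfolding irreducible_rep_def subspace_iff_lin_subspace
  proof (intro conjI allI impI rep d0)
    fix U assume "lin_subspace d U \<and> (\<forall>g\<in>carrier G. \<forall>w\<in>U. \<sigma> g *\<^sub>v w \<in> U)"
    then have U: "lin_subspace d U" and Uinv: "\<And>g w. g \<in> carrier G \<Longrightarrow> w \<in> U \<Longrightarrow> \<sigma> g *\<^sub>v w \<in> U" by auto
    obtain e B' C' where B': "B' \<in> carrier_mat d e" and C': "C' \<in> carrier_mat e d" and CB': "C' * B' = 1\<^sub>m e"
      and BU: "\<And>v. v \<in> carrier_vec e \<Longrightarrow> B' *\<^sub>v v \<in> U" and BC': "\<And>w. w \<in> U \<Longrightarrow> B' *\<^sub>v (C' *\<^sub>v w) = w"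
      by (rule subspace_coordinates[OF U], rule that)
    show "U = {0\<^sub>v d} \<or> U = carrier_vec d"
    proof (cases "e = 0")
      case True
      have "w = 0\<^sub>v d" if w: "w \<in> U" for w
      proof -
        have "B' *\<^sub>v (C' *\<^sub>v w) = 0\<^sub>v d"
          using B' C' True by (intro eq_vecI) (auto simp: scalar_prod_def)
        then show ?thesis using BC'[OF w] by simp
      qed
      moreover have "0\<^sub>v d \<in> U" using U by (simp add: lin_subspace_def)
      ultimately show ?thesis by blast
    next
      case False
      have BB: "B * B' \<in> carrier_mat n e" and CC: "C' * C \<in> carrier_mat e n" using B B' C C' by auto
      have CX: "(C' * C) * (B * X) = C' * X" if X: "X \<in> carrier_mat d m" for X m
      proof -
        have "(C' * C) * (B * X) = C' * (C * (B * X))" using assoc_mult_mat[OF C' C, of "B * X" m] B X by simp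
        then show ?thesis using cancel[OF X] by simp
      qed
      have "(C' * C) * (B * B') = 1\<^sub>m e" using CX[OF B'] CB' by simp
      moreover have "(B * B') *\<^sub>v v \<in> W" if v: "v \<in> carrier_vec e" for v
        using BW[of "B' *\<^sub>v v"] B' v assoc_mult_mat_vec[OF B B' v] by simp
      moreover have "\<rho> g * (B * B') = (B * B') * ((C' * C) * (\<rho> g * (B * B')))" if g: "g \<in> carrier G" for g
      proof -
        have r: "\<sigma> g * B' = B' * (C' * (\<sigma> g * B'))"
          by (rule restrict_to_coordinates[OF S[OF g] B' C' BU BC' Uinv[OF g]])
        have SB: "\<sigma> g * B' \<in> carrier_mat d e" and CSB: "C' * (\<sigma> g * B') \<in> carrier_mat e e"
          using S[OF g] B' C' by auto
        have 1: "\<rho> g * (B * B') = B * (\<sigma> g * B')"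
          using assoc_mult_mat[OF R[OF g] B B'] assoc_mult_mat[OF B S[OF g] B'] inter[OF g] by simp
        also have "\<dots> = B * (B' * (C' * (\<sigma> g * B')))" using r by simp
        also have "\<dots> = (B * B') * (C' * (\<sigma> g * B'))" by (rule assoc_mult_mat[OF B B' CSB, symmetric])
        also have "C' * (\<sigma> g * B') = (C' * C) * (\<rho> g * (B * B'))" unfolding 1 by (rule CX[OF SB, symmetric])
        finally show ?thesis .
      qed
      ultimately have "Q e (B * B') (C' * C)" unfolding Q_def using False BB CC by blast
      then have "d \<le> e" using min by blast
      moreover have "e \<le> d" by (rule left_inverse_dim_le[OF B' C' CB'])
      ultimately have "e = d" by simp
      then have "B' * C' = 1\<^sub>m d" using mat_mult_left_right_inverse[of C' d B'] B' C' CB' by simp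
      then have "v \<in> U" if v: "v \<in> carrier_vec d" for v
        using BU[of "C' *\<^sub>v v"] assoc_mult_mat_vec[OF B' C' v] C' v by simp
      then show ?thesis using U by (auto simp: lin_subspace_def)
    qed
  qed
  then show ?thesis using B C CB BW inter by (rule that)
qed

end

context finite_group
begin

definition class_function :: "('a \<Rightarrow> complex) \<Rightarrow> bool" where
  "class_function f \<longleftrightarrow> (\<forall>g\<in>carrier G. \<forall>h\<in>carrier G. f (h \<otimes> g \<otimes> inv h) = f g)"

lemma class_function_commute:
  assumes f: "class_function f" and g: "g \<in> carrier G" and h: "h \<in> carrier G"
  shows "f (g \<otimes> h) = f (h \<otimes> g)"
proof -
  have "f (h \<otimes> (g \<otimes> h) \<otimes> inv h) = f (g \<otimes> h)" using f g h by (simp add: class_function_def)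
  moreover have "h \<otimes> (g \<otimes> h) \<otimes> inv h = h \<otimes> g" using g h by (simp add: m_assoc)
  ultimately show ?thesis by simp
qed

text \<open>
  A class function acts on an irreducible representation by a scalar, which the trace determines.
\<close>
lemma class_function_acts_by_zero:
  assumes irr: "irreducible_rep G d \<sigma>" and f: "class_function f"
    and orth: "(\<Sum>g\<in>carrier G. f g * mat_trace (\<sigma> g)) = 0" and ij: "i < d" "j < d"
  shows "(\<Sum>g\<in>carrier G. f g * \<sigma> g $$ (i, j)) = 0"
proof -
  note sigma = irreducible_repD[OF irr]
  note S = complex_rep_carrier[OF sigma(1)]
  define A where "A = mat d d (\<lambda>(i, j). \<Sum>g\<in>carrier G. f g * \<sigma> g $$ (i, j))"
  have A: "A \<in> carrier_mat d d" by (simp add: A_def)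
  have "\<sigma> h * A = A * \<sigma> h" if h: "h \<in> carrier G" for h
  proof (rule eq_matI)
    fix i j assume "i < dim_row (A * \<sigma> h)" "j < dim_col (A * \<sigma> h)"
    then have ij: "i < d" "j < d" using A S[OF h] by auto
    have "(\<sigma> h * A) $$ (i, j) = (\<Sum>r<d. \<sigma> h $$ (i, r) * A $$ (r, j))"
      by (rule mat_mult_entry[OF S[OF h] A ij])
    also have "\<dots> = (\<Sum>r<d. \<Sum>g\<in>carrier G. f g * (\<sigma> h $$ (i, r) * \<sigma> g $$ (r, j)))"
      using ij by (intro sum.cong) (auto simp: A_def sum_distrib_left mult_ac)
    also have "\<dots> = (\<Sum>g\<in>carrier G. \<Sum>r<d. f g * (\<sigma> h $$ (i, r) * \<sigma> g $$ (r, j)))" by (rule sum.swap)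
    also have "\<dots> = (\<Sum>g\<in>carrier G. f (inv h \<otimes> (h \<otimes> g)) * \<sigma> (h \<otimes> g) $$ (i, j))"
      using h by (intro sum.cong refl)
        (simp add: complex_rep_mult[OF sigma(1) h] mat_mult_entry[OF S[OF h] S ij] sum_distrib_left
          m_assoc[symmetric] del: index_mult_mat)
    also have "\<dots> = (\<Sum>g\<in>carrier G. f (inv h \<otimes> g) * \<sigma> g $$ (i, j))"
      by (rule sum_left_translate[OF h, of "\<lambda>g. f (inv h \<otimes> g) * \<sigma> g $$ (i, j)"])
    also have "\<dots> = (\<Sum>g\<in>carrier G. f (g \<otimes> inv h) * \<sigma> g $$ (i, j))"
      using h by (intro sum.cong refl) (simp add: class_function_commute[OF f])
    also have "\<dots> = (\<Sum>g\<in>carrier G. f (g \<otimes> h \<otimes> inv h) * \<sigma> (g \<otimes> h) $$ (i, j))"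
      by (rule sum_right_translate[OF h, of "\<lambda>g. f (g \<otimes> inv h) * \<sigma> g $$ (i, j)", symmetric])
    also have "\<dots> = (\<Sum>g\<in>carrier G. \<Sum>r<d. f g * \<sigma> g $$ (i, r) * \<sigma> h $$ (r, j))"
      using h by (intro sum.cong refl)
        (simp add: complex_rep_mult[OF sigma(1) _ h] mat_mult_entry[OF S S[OF h] ij] sum_distrib_left
          m_assoc mult.assoc del: index_mult_mat)
    also have "\<dots> = (\<Sum>r<d. A $$ (i, r) * \<sigma> h $$ (r, j))"
      using ij by (subst sum.swap) (auto simp: A_def sum_distrib_right)
    also have "\<dots> = (A * \<sigma> h) $$ (i, j)" by (rule mat_mult_entry[OF A S[OF h] ij, symmetric])
    finally show "(\<sigma> h * A) $$ (i, j) = (A * \<sigma> h) $$ (i, j)" .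
  qed (use A S[OF h] in auto)
  then obtain c where c: "A = c \<cdot>\<^sub>m 1\<^sub>m d" using commuting_matrix_scalar[OF irr A] by blast
  have "of_nat d * c = (\<Sum>i<d. A $$ (i, i))" by (simp add: c)
  also have "\<dots> = (\<Sum>g\<in>carrier G. \<Sum>i<d. f g * \<sigma> g $$ (i, i))"
    by (subst sum.swap) (simp add: A_def)
  also have "\<dots> = (\<Sum>g\<in>carrier G. f g * mat_trace (\<sigma> g))"
    by (intro sum.cong refl) (simp add: mat_trace_carrier[OF S] sum_distrib_left)
  finally have "c = 0" using orth sigma(2) by simp
  then have "A $$ (i, j) = 0" using ij by (simp add: c)
  then show ?thesis using ij by (simp add: A_def)
qed

text \<open>
  Let \<open>T\<close> be the action of \<open>f\<close> on the regular representation. If \<open>f\<close> were nonzero, the image of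
  \<open>T\<close> would contain an irreducible subrepresentation. The adjoint of \<open>T\<close> is the action of the class function
  \<open>f' g = cnj (f (g\<^sup>-\<^sup>1))\<close>, which is orthogonal to all irreducible characters as well, hence kills
  this subrepresentation. So a vector of the subrepresentation is orthogonal to the image of \<open>T\<close>, in which
  it lies, and vanishes.
\<close>
lemma class_function_eq_zero_if_orthogonal:
  assumes f: "class_function f"
    and orth: "\<And>\<chi>. \<chi> \<in> Irr G \<Longrightarrow> (\<Sum>g\<in>carrier G. f g * \<chi> g) = 0"
    and x: "x \<in> carrier G"
  shows "f x = 0"
proof (rule ccontr)
  assume fx: "f x \<noteq> 0"
  define N where "N = card (carrier G)"
  obtain e where e: "bij_betw e {0..<N} (carrier G)" using ex_bij_betw_nat_finite[OF finite_carrier] by (auto simp: N_def)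
  define ix where "ix = inv_into {0..<N} e"
  have e_in: "e a \<in> carrier G" if "a < N" for a using e that by (auto simp: bij_betw_def)
  have ix_lt: "ix y < N" and e_ix: "e (ix y) = y" if "y \<in> carrier G" for y
    using e that by (auto simp: ix_def bij_betw_def f_inv_into_f inv_into_into)
      (metis atLeastLessThan_iff inv_into_into that)
  have ix_e: "ix (e a) = a" if "a < N" for a
    using e that by (auto simp: ix_def bij_betw_def)
  have sum_e: "(\<Sum>a<N. F (e a)) = (\<Sum>y\<in>carrier G. F y)" for F :: "'a \<Rightarrow> complex"
    using sum.reindex_bij_betw[OF e, of F] by (simp add: atLeast0LessThan)
  \<comment> \<open>The left regular representation, with the group enumerated by \<open>e\<close>.\<close>
  define L where "L g = mat N N (\<lambda>(a, b). if e a = g \<otimes> e b then 1 else 0 :: complex)" for g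
  define T where "T = mat N N (\<lambda>(a, b). f (e a \<otimes> inv (e b)))"
  have L: "L g \<in> carrier_mat N N" for g by (simp add: L_def)
  have T: "T \<in> carrier_mat N N" by (simp add: T_def)
  have LX: "(L g * X) $$ (a, c) = X $$ (ix (inv g \<otimes> e a), c)"
    if X: "X \<in> carrier_mat N m" and ac: "a < N" "c < m" and g: "g \<in> carrier G" for g X m a c
  proof -
    have "(L g * X) $$ (a, c) = (\<Sum>b<N. L g $$ (a, b) * X $$ (b, c))" by (rule mat_mult_entry[OF L X ac])
    also have "\<dots> = (\<Sum>b<N. if b = ix (inv g \<otimes> e a) then X $$ (b, c) else 0)"
    proof (rule sum.cong)
      fix b assume "b \<in> {..<N}"
      then have b: "b < N" by simp
      have "e a = g \<otimes> e b \<longleftrightarrow> e b = inv g \<otimes> e a"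
        using g e_in[OF ac(1)] e_in[OF b] by (metis inv_solve_left)
      also have "\<dots> \<longleftrightarrow> b = ix (inv g \<otimes> e a)"
        using ix_e[OF b] e_ix[of "inv g \<otimes> e a"] g e_in[OF ac(1)] by auto
      finally show "L g $$ (a, b) * X $$ (b, c) = (if b = ix (inv g \<otimes> e a) then X $$ (b, c) else 0)"
        using ac b by (simp add: L_def)
    qed simp
    also have "\<dots> = X $$ (ix (inv g \<otimes> e a), c)" using ix_lt[of "inv g \<otimes> e a"] g e_in[OF ac(1)] by simp
    finally show ?thesis .
  qed
  have rep: "complex_rep G N L"
  proof (rule complex_repI)
    fix g h assume g: "g \<in> carrier G" and h: "h \<in> carrier G"
    show "L (g \<otimes> h) = L g * L h"
    proof (rule eq_matI)
      fix a b assume "a < dim_row (L g * L h)" "b < dim_col (L g * L h)"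
      then have ab: "a < N" "b < N" using L[of g] L[of h] by auto
      have "(L g * L h) $$ (a, b) = (if inv g \<otimes> e a = h \<otimes> e b then 1 else 0)"
        using LX[OF L ab g, of h] ab ix_lt[of "inv g \<otimes> e a"] e_ix[of "inv g \<otimes> e a"] g e_in[OF ab(1)]
        by (simp add: L_def)
      also have "inv g \<otimes> e a = h \<otimes> e b \<longleftrightarrow> e a = g \<otimes> h \<otimes> e b"
        using g h e_in[OF ab(1)] e_in[OF ab(2)] by (metis inv_closed inv_inv inv_solve_left m_assoc m_closed)
      finally show "L (g \<otimes> h) $$ (a, b) = (L g * L h) $$ (a, b)" using ab by (simp add: L_def)
    qed (use L[of g] L[of h] L[of "g \<otimes> h"] in auto)
  next
    show "L \<one> = 1\<^sub>m N"
    proof (rule eq_matI)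
      fix a b assume "a < dim_row (1\<^sub>m N :: complex mat)" "b < dim_col (1\<^sub>m N :: complex mat)"
      then have ab: "a < N" "b < N" by auto
      have "e a = e b \<longleftrightarrow> a = b" using ix_e[OF ab(1)] ix_e[OF ab(2)] by metis
      then show "L \<one> $$ (a, b) = 1\<^sub>m N $$ (a, b)" using ab e_in[OF ab(2)] by (simp add: L_def)
    qed (auto simp: L_def)
  qed (rule L)
  define W where "W = {T *\<^sub>v v | v. v \<in> carrier_vec N}"
  have W: "lin_subspace N W" unfolding W_def by (rule lin_subspace_image[OF T])
  have LT: "L g * T = T * L g" if g: "g \<in> carrier G" for g
  proof (rule eq_matI)
    fix a b assume "a < dim_row (T * L g)" "b < dim_col (T * L g)"
    then have ab: "a < N" "b < N" using L[of g] T by auto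
    note ea = e_in[OF ab(1)] and eb = e_in[OF ab(2)]
    have "(L g * T) $$ (a, b) = f (inv g \<otimes> (e a \<otimes> inv (e b)))"
      using LX[OF T ab g] ix_lt[of "inv g \<otimes> e a"] e_ix[of "inv g \<otimes> e a"] g ea eb ab
      by (simp add: T_def m_assoc)
    also have "\<dots> = f (e a \<otimes> inv (g \<otimes> e b))"
      using class_function_commute[OF f, of "inv g" "e a \<otimes> inv (e b)"] g ea eb
      by (simp add: m_assoc inv_mult_group)
    also have "\<dots> = (T * L g) $$ (a, b)"
    proof -
      have "(T * L g) $$ (a, b) = (\<Sum>c<N. T $$ (a, c) * L g $$ (c, b))" by (rule mat_mult_entry[OF T L ab])
      also have "\<dots> = (\<Sum>c<N. (\<lambda>y. f (e a \<otimes> inv y) * (if y = g \<otimes> e b then 1 else 0)) (e c))"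
        using ab by (intro sum.cong) (auto simp: T_def L_def)
      also have "\<dots> = (\<Sum>y\<in>carrier G. f (e a \<otimes> inv y) * (if y = g \<otimes> e b then 1 else 0))"
        by (rule sum_e)
      also have "\<dots> = (\<Sum>y\<in>carrier G. if y = g \<otimes> e b then f (e a \<otimes> inv y) else 0)"
        by (intro sum.cong) auto
      also have "\<dots> = f (e a \<otimes> inv (g \<otimes> e b))" using g eb by simp
      finally show ?thesis by simp
    qed
    finally show "(L g * T) $$ (a, b) = (T * L g) $$ (a, b)" .
  qed (use L[of g] T in auto)
  have Winv: "L g *\<^sub>v w \<in> W" if g: "g \<in> carrier G" and w: "w \<in> W" for g w
  proof -
    obtain v where v: "v \<in> carrier_vec N" "w = T *\<^sub>v v" using w by (auto simp: W_def)
    have "L g *\<^sub>v w = T *\<^sub>v (L g *\<^sub>v v)"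
      unfolding v(2) using assoc_mult_mat_vec[OF L T v(1), of g] assoc_mult_mat_vec[OF T L v(1), of g] LT[OF g] by simp
    moreover have "L g *\<^sub>v v \<in> carrier_vec N" using L[of g] v(1) by simp
    ultimately show ?thesis unfolding W_def by blast
  qed
  have Wnz: "W \<noteq> {0\<^sub>v N}"
  proof
    assume W0: "W = {0\<^sub>v N}"
    have "T *\<^sub>v unit_vec N (ix \<one>) \<in> W" unfolding W_def using unit_vec_carrier by blast
    then have "T *\<^sub>v unit_vec N (ix \<one>) = 0\<^sub>v N" unfolding W0 by (rule singletonD)
    then have "col T (ix \<one>) = 0\<^sub>v N" unfolding mult_unit_vec[OF T ix_lt[OF one_closed]] .
    then have "col T (ix \<one>) $ ix x = 0" using ix_lt[OF x] by simp
    moreover have "col T (ix \<one>) $ ix x = f (e (ix x) \<otimes> inv (e (ix \<one>)))"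
      using ix_lt[OF x] ix_lt[OF one_closed] by (simp add: T_def)
    ultimately show False using fx x unfolding e_ix[OF x] e_ix[OF one_closed] by simp
  qed
  obtain d \<sigma> B C where irr: "irreducible_rep G d \<sigma>" and B: "B \<in> carrier_mat N d" and C: "C \<in> carrier_mat d N"
    and CB: "C * B = 1\<^sub>m d" and BW: "\<And>v. v \<in> carrier_vec d \<Longrightarrow> B *\<^sub>v v \<in> W"
    and LB: "\<And>g. g \<in> carrier G \<Longrightarrow> L g * B = B * \<sigma> g"
    by (rule irreducible_subrepresentation[OF rep W Wnz Winv], assumption, assumption, rule that)
  note sigma = irreducible_repD[OF irr]
  note S = complex_rep_carrier[OF sigma(1)]
  have d: "0 < d" by (rule sigma(2))
  \<comment> \<open>The first basis vector of the subrepresentation, read as a function on the group; it will turn out to be 0.\<close>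
  define \<beta> where "\<beta> y = B $$ (ix y, 0)" for y
  have translate: "\<beta> (inv g \<otimes> y) = (\<Sum>s<d. B $$ (ix y, s) * \<sigma> g $$ (s, 0))"
    if g: "g \<in> carrier G" and y: "y \<in> carrier G" for g y
  proof -
    have "\<beta> (inv g \<otimes> y) = (L g * B) $$ (ix y, 0)"
      unfolding \<beta>_def LX[OF B ix_lt[OF y] d g] e_ix[OF y] ..
    also have "\<dots> = (\<Sum>s<d. B $$ (ix y, s) * \<sigma> g $$ (s, 0))"
      unfolding LB[OF g] by (rule mat_mult_entry[OF B S[OF g] ix_lt[OF y] d])
    finally show ?thesis .
  qed
  define f' where "f' g = cnj (f (inv g))" for g
  have f': "class_function f'"
    using f by (auto simp: class_function_def f'_def inv_mult_group m_assoc)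
  have "(\<Sum>g\<in>carrier G. f' g * mat_trace (\<sigma> g)) = cnj (\<Sum>g\<in>carrier G. f (inv g) * mat_trace (\<sigma> (inv g)))"
  proof -
    have "mat_trace (\<sigma> (inv g)) = cnj (mat_trace (\<sigma> g))" if "g \<in> carrier G" for g
      by (rule character_values[OF sigma(1) that])
    then show ?thesis by (simp add: f'_def)
  qed
  also have "(\<Sum>g\<in>carrier G. f (inv g) * mat_trace (\<sigma> (inv g))) = (\<Sum>g\<in>carrier G. f g * mat_trace (\<sigma> g))"
    by (rule sum_inverse)
  also have "\<dots> = (\<Sum>g\<in>carrier G. f g * rep_character G \<sigma> g)"
    by (intro sum.cong refl) (simp add: rep_character_eq_trace)
  also have "\<dots> = 0" using irr by (intro orth) (auto simp: Irr_def)
  finally have "(\<Sum>g\<in>carrier G. f' g * mat_trace (\<sigma> g)) = 0" by simp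
  note kill = class_function_acts_by_zero[OF irr f' this _ d]
  have adj: "(\<Sum>y\<in>carrier G. cnj (f (y \<otimes> inv z)) * \<beta> y) = 0" if z: "z \<in> carrier G" for z
  proof -
    have "(\<Sum>y\<in>carrier G. cnj (f (y \<otimes> inv z)) * \<beta> y) = (\<Sum>g\<in>carrier G. cnj (f (g \<otimes> z \<otimes> inv z)) * \<beta> (g \<otimes> z))"
      by (rule sum_right_translate[OF z, of "\<lambda>y. cnj (f (y \<otimes> inv z)) * \<beta> y", symmetric])
    also have "\<dots> = (\<Sum>g\<in>carrier G. cnj (f g) * \<beta> (g \<otimes> z))"
      using z by (intro sum.cong refl) (simp add: m_assoc)
    also have "\<dots> = (\<Sum>g\<in>carrier G. cnj (f (inv g)) * \<beta> (inv g \<otimes> z))"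
      by (rule sum_inverse[of "\<lambda>g. cnj (f g) * \<beta> (g \<otimes> z)", symmetric])
    also have "\<dots> = (\<Sum>g\<in>carrier G. \<Sum>s<d. B $$ (ix z, s) * (f' g * \<sigma> g $$ (s, 0)))"
      using z by (intro sum.cong refl) (simp add: translate f'_def sum_distrib_left mult_ac)
    also have "\<dots> = (\<Sum>s<d. B $$ (ix z, s) * (\<Sum>g\<in>carrier G. f' g * \<sigma> g $$ (s, 0)))"
      by (subst sum.swap) (simp add: sum_distrib_left)
    also have "\<dots> = 0" using kill by simp
    finally show ?thesis .
  qed
  obtain u where u: "u \<in> carrier_vec N" "B *\<^sub>v unit_vec d 0 = T *\<^sub>v u"
    using BW[of "unit_vec d 0"] by (auto simp: W_def)
  have \<beta>_T: "\<beta> y = (\<Sum>z\<in>carrier G. f (y \<otimes> inv z) * u $ ix z)" if y: "y \<in> carrier G" for y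
  proof -
    have "\<beta> y = (T *\<^sub>v u) $ ix y"
      using u(2)[symmetric] mult_unit_vec[OF B d] B ix_lt[OF y] d by (simp add: \<beta>_def)
    also have "\<dots> = (\<Sum>b<N. (\<lambda>z. f (y \<otimes> inv z) * u $ ix z) (e b))"
      using ix_lt[OF y] e_ix[OF y] u(1) by (auto simp: T_def scalar_prod_def atLeast0LessThan ix_e intro!: sum.cong)
    also have "\<dots> = (\<Sum>z\<in>carrier G. f (y \<otimes> inv z) * u $ ix z)" by (rule sum_e)
    finally show ?thesis .
  qed
  have "(\<Sum>y\<in>carrier G. \<beta> y * cnj (\<beta> y)) = (\<Sum>y\<in>carrier G. \<Sum>z\<in>carrier G. cnj (u $ ix z) * (cnj (f (y \<otimes> inv z)) * \<beta> y))"
    by (intro sum.cong refl) (subst (2) \<beta>_T, auto simp: sum_distrib_left mult_ac)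
  also have "\<dots> = (\<Sum>z\<in>carrier G. cnj (u $ ix z) * (\<Sum>y\<in>carrier G. cnj (f (y \<otimes> inv z)) * \<beta> y))"
    by (subst sum.swap) (simp add: sum_distrib_left)
  also have "\<dots> = 0" using adj by simp
  finally have "(\<Sum>y\<in>carrier G. complex_of_real ((cmod (\<beta> y))\<^sup>2)) = 0"
    by (simp only: complex_norm_square)
  then have "(\<Sum>y\<in>carrier G. (cmod (\<beta> y))\<^sup>2) = 0" by (simp only: of_real_sum[symmetric] of_real_eq_0_iff)
  then have \<beta>0: "\<beta> y = 0" if "y \<in> carrier G" for y
    using that by (simp add: sum_nonneg_eq_0_iff)
  have "(C * B) $$ (0, 0) = (\<Sum>a<N. C $$ (0, a) * B $$ (a, 0))" by (rule mat_mult_entry[OF C B d d])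
  also have "\<dots> = 0"
  proof (rule sum.neutral, rule ballI)
    fix a assume "a \<in> {..<N}"
    then have "B $$ (a, 0) = \<beta> (e a)" by (simp add: \<beta>_def ix_e)
    also have "\<dots> = 0" using \<beta>0 e_in \<open>a \<in> {..<N}\<close> by simp
    finally show "C $$ (0, a) * B $$ (a, 0) = 0" by simp
  qed
  finally show False using CB d by simp
qed

section \<open>Counting classes with characters\<close>

definition conj_class :: "'a \<Rightarrow> 'a set" where
  "conj_class x = (\<lambda>h. h \<otimes> x \<otimes> inv h) ` carrier G"

lemma conj_class_carrier: "x \<in> carrier G \<Longrightarrow> conj_class x \<subseteq> carrier G"
  by (auto simp: conj_class_def)

lemma conj_class_self: "x \<in> carrier G \<Longrightarrow> x \<in> conj_class x"
  unfolding conj_class_def by (rule image_eqI[of _ _ \<one>]) auto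

lemma conj_in_conj_class_iff:
  assumes x: "x \<in> carrier G" and g: "g \<in> carrier G" and h: "h \<in> carrier G"
  shows "h \<otimes> g \<otimes> inv h \<in> conj_class x \<longleftrightarrow> g \<in> conj_class x"
proof
  assume "g \<in> conj_class x"
  then obtain k where k: "k \<in> carrier G" "g = k \<otimes> x \<otimes> inv k" by (auto simp: conj_class_def)
  then have "h \<otimes> g \<otimes> inv h = (h \<otimes> k) \<otimes> x \<otimes> inv (h \<otimes> k)" using x h by (simp add: inv_mult_group m_assoc)
  then show "h \<otimes> g \<otimes> inv h \<in> conj_class x" unfolding conj_class_def using h k by blast
next
  assume "h \<otimes> g \<otimes> inv h \<in> conj_class x"
  then obtain k where k: "k \<in> carrier G" "h \<otimes> g \<otimes> inv h = k \<otimes> x \<otimes> inv k" by (auto simp: conj_class_def)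
  have "g = inv h \<otimes> (h \<otimes> g \<otimes> inv h) \<otimes> h" using g h by (simp add: m_assoc[symmetric]) (simp add: m_assoc)
  also have "\<dots> = (inv h \<otimes> k) \<otimes> x \<otimes> inv (inv h \<otimes> k)"
    unfolding k(2) using x h k(1) by (simp add: inv_mult_group m_assoc)
  finally show "g \<in> conj_class x" unfolding conj_class_def using h k(1) by blast
qed

lemma trace_conj:
  assumes \<rho>: "complex_rep G n \<rho>" and g: "g \<in> carrier G" and h: "h \<in> carrier G"
  shows "mat_trace (\<rho> (h \<otimes> g \<otimes> inv h)) = mat_trace (\<rho> g)"
proof -
  note R = complex_rep_carrier[OF \<rho>]
  have "\<rho> (h \<otimes> g \<otimes> inv h) = \<rho> (h \<otimes> g) * \<rho> (inv h)" using g h by (intro complex_rep_mult[OF \<rho>]) auto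
  then have "mat_trace (\<rho> (h \<otimes> g \<otimes> inv h)) = mat_trace (\<rho> (inv h) * \<rho> (h \<otimes> g))"
    using mat_trace_mult_commute[OF R[of "h \<otimes> g"] R[of "inv h"]] g h by simp
  also have "\<rho> (inv h) * \<rho> (h \<otimes> g) = \<rho> (inv h \<otimes> (h \<otimes> g))"
    using g h by (intro complex_rep_mult[OF \<rho>, symmetric]) auto
  also have "inv h \<otimes> (h \<otimes> g) = g" using g h by (simp add: m_assoc[symmetric])
  finally show ?thesis .
qed

lemma character_const_on_conj_class:
  assumes "\<chi> \<in> Irr G" "x \<in> carrier G" "g \<in> conj_class x"
  shows "\<chi> g = \<chi> x"
proof -
  obtain n \<rho> where \<rho>: "irreducible_rep G n \<rho>" "\<chi> = rep_character G \<rho>" using assms(1) by (auto simp: Irr_def)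
  obtain h where h: "h \<in> carrier G" "g = h \<otimes> x \<otimes> inv h" using assms(3) by (auto simp: conj_class_def)
  show ?thesis
    unfolding \<rho>(2) h(2) using trace_conj[OF irreducible_repD(1)[OF \<rho>(1)] assms(2) h(1)] assms(2) h(1)
    by (simp add: rep_character_eq_trace)
qed

text \<open>
  If \<open>I\<close> had more elements, a nonzero class function supported on their classes could be chosen orthogonal
  to the characters in \<open>F\<close> and of total weight zero, which makes it orthogonal to every other irreducible
  character, as those are constant on \<open>N\<close>.
\<close>
lemma card_nonconjugate_le:
  assumes F: "finite F" "F \<subseteq> Irr G" and N: "N \<subseteq> carrier G"
    and trivial: "\<And>\<chi> x. \<chi> \<in> Irr G - F \<Longrightarrow> x \<in> N \<Longrightarrow> \<chi> x = \<chi> \<one>"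
    and I: "finite I" "I \<subseteq> N" and nonconj: "\<And>x y. x \<in> I \<Longrightarrow> y \<in> I \<Longrightarrow> y \<in> conj_class x \<Longrightarrow> x = y"
  shows "card I \<le> card F + 1"
proof (rule ccontr)
  assume "\<not> card I \<le> card F + 1"
  then have lt: "card (insert None (Some ` F)) < card I" using F by (simp add: card_image)
  define M where "M k x = (case k of None \<Rightarrow> 1 | Some \<chi> \<Rightarrow> \<chi> x)" for k :: "('a \<Rightarrow> complex) option" and x
  obtain c where c: "\<exists>x\<in>I. c x \<noteq> 0" "\<forall>k\<in>insert None (Some ` F). (\<Sum>x\<in>I. M k x * c x) = 0"
    using homogeneous_system_nontrivial_solution[OF _ I(1) lt, of M] F(1) by auto
  then have c1: "(\<Sum>x\<in>I. c x) = 0" and c2: "\<And>\<chi>. \<chi> \<in> F \<Longrightarrow> (\<Sum>x\<in>I. \<chi> x * c x) = 0"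
    by (auto simp: M_def)
  have IG: "x \<in> carrier G" if "x \<in> I" for x using that I N by blast
  have cl_fin: "finite (conj_class x)" for x by (simp add: conj_class_def)
  have cl_pos: "card (conj_class x) > 0" if "x \<in> I" for x
    using conj_class_self[OF IG[OF that]] cl_fin by (auto simp: card_gt_0_iff)
  define f where "f g = (\<Sum>x\<in>I. if g \<in> conj_class x then c x / of_nat (card (conj_class x)) else 0)" for g
  have "class_function f"
    unfolding class_function_def f_def by (auto intro!: sum.cong simp: conj_in_conj_class_iff IG)
  moreover have "(\<Sum>g\<in>carrier G. f g * \<chi> g) = 0" if \<chi>: "\<chi> \<in> Irr G" for \<chi>
  proof -
    have "(\<Sum>g\<in>carrier G. f g * \<chi> g) =
      (\<Sum>x\<in>I. \<Sum>g\<in>carrier G. if g \<in> conj_class x then c x / of_nat (card (conj_class x)) * \<chi> g else 0)"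
      unfolding f_def sum_distrib_right by (subst sum.swap) (auto intro!: sum.cong)
    also have "\<dots> = (\<Sum>x\<in>I. \<chi> x * c x)"
    proof (rule sum.cong)
      fix x assume x: "x \<in> I"
      have "(\<Sum>g\<in>carrier G. if g \<in> conj_class x then c x / of_nat (card (conj_class x)) * \<chi> g else 0) =
        (\<Sum>g\<in>conj_class x. c x / of_nat (card (conj_class x)) * \<chi> g)"
        using conj_class_carrier[OF IG[OF x]] by (simp add: sum.inter_restrict[symmetric] Int_absorb1)
      also have "\<dots> = (\<Sum>g\<in>conj_class x. c x / of_nat (card (conj_class x)) * \<chi> x)"
        using character_const_on_conj_class[OF \<chi> IG[OF x]] by (intro sum.cong) auto
      also have "\<dots> = \<chi> x * c x" using cl_pos[OF x] by simp
      finally show "(\<Sum>g\<in>carrier G. if g \<in> conj_class x then c x / of_nat (card (conj_class x)) * \<chi> g else 0) = \<chi> x * c x" .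
    qed simp
    also have "\<dots> = 0"
    proof (cases "\<chi> \<in> F")
      case False
      then have "(\<Sum>x\<in>I. \<chi> x * c x) = (\<Sum>x\<in>I. \<chi> \<one> * c x)"
        using trivial[of \<chi>] \<chi> I by (intro sum.cong) auto
      then show ?thesis using c1 by (simp add: sum_distrib_left[symmetric])
    qed (rule c2)
    finally show ?thesis .
  qed
  ultimately have f0: "f x = 0" if "x \<in> carrier G" for x
    using class_function_eq_zero_if_orthogonal that by blast
  have "c x = 0" if x: "x \<in> I" for x
  proof -
    have "f x = (\<Sum>y\<in>I. if y = x then c x / of_nat (card (conj_class x)) else 0)"
      unfolding f_def using nonconj[OF _ x] conj_class_self[OF IG[OF x]] by (intro sum.cong) auto
    also have "\<dots> = c x / of_nat (card (conj_class x))" using x I by simp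
    finally show ?thesis using f0[OF IG[OF x]] cl_pos[OF x] by simp
  qed
  with c(1) show False by blast
qed

end

section \<open>Actions of finite groups and Sylow theory\<close>

lemma only_prime_divisor_imp_power:
  fixes n p :: nat
  assumes n: "n > 0" and p: "prime p" and only: "\<And>r. prime r \<Longrightarrow> r dvd n \<Longrightarrow> r = p"
  obtains k where "n = p ^ k"
proof -
  obtain m where m: "n = p ^ multiplicity p n * m" "\<not> p dvd m"
    by (rule multiplicity_decompose'[of n p]) (use n p in auto)
  have "m = 1"
  proof (rule ccontr)
    assume "m \<noteq> 1"
    then obtain r where r: "prime r" "r dvd m" using prime_factor_nat by blast
    then have "r dvd n" using m(1) by (metis dvd_mult)
    then show False using only[OF r(1)] r(2) m(2) by blast
  qed
  then show ?thesis using m(1) that by simp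
qed

text \<open>
  Actions given by plain functions; in contrast to homomorphisms into a group of bijections, \<open>act g\<close> may be
  arbitrary outside \<open>E\<close>, so that conjugation and translation of cosets are instances as they stand.
\<close>
locale finite_action = finite_group S for S (structure) +
  fixes act :: "'a \<Rightarrow> 'e \<Rightarrow> 'e" and E :: "'e set"
  assumes finite_E: "finite E"
    and act_closed: "\<And>g x. g \<in> carrier S \<Longrightarrow> x \<in> E \<Longrightarrow> act g x \<in> E"
    and act_one: "\<And>x. x \<in> E \<Longrightarrow> act \<one> x = x"
    and act_mult: "\<And>g h x. g \<in> carrier S \<Longrightarrow> h \<in> carrier S \<Longrightarrow> x \<in> E \<Longrightarrow> act (g \<otimes> h) x = act g (act h x)"
begin

definition orb :: "'e \<Rightarrow> 'e set" where "orb x = (\<lambda>g. act g x) ` carrier S"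
definition stab :: "'e \<Rightarrow> 'a set" where "stab x = {g \<in> carrier S. act g x = x}"

lemma act_inv_cancel:
  assumes "g \<in> carrier S" "x \<in> E"
  shows "act (inv g) (act g x) = x" "act g (act (inv g) x) = x"
  using act_mult[of "inv g" g x] act_mult[of g "inv g" x] act_one assms by auto

lemma subgroup_stab: "x \<in> E \<Longrightarrow> subgroup (stab x) S"
proof (rule subgroupI)
  assume x: "x \<in> E"
  show "stab x \<subseteq> carrier S" by (auto simp: stab_def)
  show "stab x \<noteq> {}" using act_one[OF x] by (auto simp: stab_def)
  show "inv g \<in> stab x" if "g \<in> stab x" for g
    using that act_inv_cancel(1)[of g x] x by (auto simp: stab_def)
  show "g \<otimes> h \<in> stab x" if "g \<in> stab x" "h \<in> stab x" for g h
    using that act_mult[of g h x] x by (auto simp: stab_def)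
qed

lemma card_orb_stab:
  assumes x: "x \<in> E"
  shows "card (orb x) * card (stab x) = card (carrier S)"
proof -
  have "card {g \<in> carrier S. act g x = y} = card (stab x)" if y: "y \<in> orb x" for y
  proof -
    obtain k where k: "k \<in> carrier S" "y = act k x" using y by (auto simp: orb_def)
    have "bij_betw (\<lambda>g. k \<otimes> g) (stab x) {g \<in> carrier S. act g x = y}"
    proof (rule bij_betwI[where g = "\<lambda>g. inv k \<otimes> g"])
      show "(\<otimes>) k \<in> stab x \<rightarrow> {g \<in> carrier S. act g x = y}"
        using k x act_mult by (auto simp: stab_def)
      show "(\<otimes>) (inv k) \<in> {g \<in> carrier S. act g x = y} \<rightarrow> stab x"
        using k x act_mult[of "inv k"] act_inv_cancel(1)[OF k(1) x] by (auto simp: stab_def)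
      show "inv k \<otimes> (k \<otimes> g) = g" if "g \<in> stab x" for g
        using that k by (auto simp: stab_def m_assoc[symmetric])
      show "k \<otimes> (inv k \<otimes> g) = g" if "g \<in> {g \<in> carrier S. act g x = y}" for g
        using that k by (auto simp: m_assoc[symmetric])
    qed
    then show ?thesis by (simp add: bij_betw_same_card)
  qed
  moreover have "card (carrier S) = (\<Sum>y\<in>orb x. card {g \<in> carrier S. act g x = y})"
    using sum.image_gen[OF finite_carrier, of "\<lambda>_. 1 :: nat" "\<lambda>g. act g x"] by (simp add: orb_def)
  ultimately show ?thesis by simp
qed

lemma orb_self: "x \<in> E \<Longrightarrow> x \<in> orb x"
  unfolding orb_def using act_one by (intro image_eqI[of _ _ \<one>]) auto

lemma orb_eq:
  assumes x: "x \<in> E" and y: "y \<in> orb x"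
  shows "orb y = orb x"
proof -
  obtain k where k: "k \<in> carrier S" "y = act k x" using y by (auto simp: orb_def)
  have "act g y \<in> orb x" if "g \<in> carrier S" for g
    unfolding orb_def k(2) using that k(1) x act_mult[of g k x] by (intro image_eqI[of _ _ "g \<otimes> k"]) auto
  moreover have "act g x \<in> orb y" if "g \<in> carrier S" for g
  proof -
    have "act g x = act (g \<otimes> inv k) y"
      using that k x act_mult[of g "inv k" y] act_closed[OF k(1) x] act_inv_cancel(1)[OF k(1) x] by simp
    then show ?thesis unfolding orb_def using that k(1) by blast
  qed
  ultimately show ?thesis by (auto simp: orb_def)
qed

text \<open>
  Without a fixed point every orbit would have a size divisible by \<open>p\<close>.
\<close>
theorem prime_power_fixed_point:
  assumes p: "prime p" and card: "card (carrier S) = p ^ a" and ndvd: "\<not> p dvd card E"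
  obtains x where "x \<in> E" "\<And>g. g \<in> carrier S \<Longrightarrow> act g x = x"
proof (rule ccontr)
  note fixed = that
  assume "\<not> thesis"
  then have nofix: "\<exists>g\<in>carrier S. act g x \<noteq> x" if "x \<in> E" for x using fixed that by blast
  have orbE: "orb x \<subseteq> E" if "x \<in> E" for x using act_closed that by (auto simp: orb_def)
  have "p dvd card (orb x)" if x: "x \<in> E" for x
  proof -
    have "card (orb x) dvd p ^ a" using card_orb_stab[OF x] card by (metis dvd_triv_left)
    then obtain i where i: "card (orb x) = p ^ i" using p by (auto simp: divides_primepow_nat)
    have "i \<noteq> 0"
    proof
      assume "i = 0"
      then have "card (orb x) = 1" using i by simp
      then obtain y where "orb x = {y}" by (auto simp: card_1_singleton_iff)
      then have "orb x = {x}" using orb_self[OF x] by auto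
      then show False using nofix[OF x] by (auto simp: orb_def)
    qed
    then show ?thesis using i by (cases i) auto
  qed
  then have "p dvd card (\<Union>(orb ` E))"
  proof (intro dvd_partition)
    have "\<Union>(orb ` E) \<subseteq> E" using orbE by auto
    then show "finite (\<Union>(orb ` E))" using finite_E by (rule finite_subset)
    show "\<forall>c1\<in>orb ` E. \<forall>c2\<in>orb ` E. c1 \<noteq> c2 \<longrightarrow> c1 \<inter> c2 = {}"
    proof (intro ballI impI)
      fix c1 c2 assume "c1 \<in> orb ` E" "c2 \<in> orb ` E" "c1 \<noteq> c2"
      then obtain x y where "x \<in> E" "y \<in> E" "c1 = orb x" "c2 = orb y" by auto
      then show "c1 \<inter> c2 = {}" using orb_eq \<open>c1 \<noteq> c2\<close> by blast
    qed
  qed auto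
  moreover have "\<Union>(orb ` E) = E" using orbE orb_self by blast
  ultimately show False using ndvd by simp
qed

end

context finite_group
begin

lemma subgroup_finite_group: "subgroup H G \<Longrightarrow> finite_group (G\<lparr>carrier := H\<rparr>)"
  by (simp add: finite_group_def finite_group_axioms_def subgroup_imp_group finite_subset[OF subgroup.subset])

lemma subgroup_card_dvd:
  assumes "subgroup H G" shows "card H dvd card (carrier G)"
  using lagrange[OF assms] by (metis Coset.order_def dvd_triv_right)

lemma Cauchy_element:
  assumes H: "subgroup H G" and r: "prime r" "r dvd card H"
  obtains x where "x \<in> H" "x \<noteq> \<one>" "x [^] r = \<one>"
proof -
  interpret H: finite_group "G\<lparr>carrier := H\<rparr>" by (rule subgroup_finite_group[OF H])
  obtain m where "card H = r ^ 1 * m" using r by (auto simp: dvd_def)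
  then obtain P where P: "subgroup P (G\<lparr>carrier := H\<rparr>)" "card P = r"
    using sylow_thm[OF r(1) H.is_group, of 1 m] H.finite_carrier by (auto simp: Coset.order_def)
  have PG: "subgroup P G" using incl_subgroup[OF H P(1)] .
  have "\<exists>x\<in>P. x \<noteq> \<one>"
  proof (rule ccontr)
    assume "\<not> (\<exists>x\<in>P. x \<noteq> \<one>)"
    then have "P \<subseteq> {\<one>}" by auto
    then have "card P \<le> 1" by (metis card.empty card_mono finite.emptyI finite.insertI card_insert_disjoint empty_iff One_nat_def)
    then show False using P(2) prime_gt_1_nat[OF r(1)] by simp
  qed
  then obtain x where x: "x \<in> P" "x \<noteq> \<one>" by blast
  interpret P: finite_group "G\<lparr>carrier := P\<rparr>" by (rule subgroup_finite_group[OF PG])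
  have "x [^]\<^bsub>G\<lparr>carrier := P\<rparr>\<^esub> r = \<one>" using P.pow_order_eq_one[of x] x P(2) by simp
  then have "x [^] r = \<one>" by (simp add: nat_pow_consistent[symmetric])
  moreover have "P \<subseteq> H" using P(1) by (simp add: subgroup.subset[of P "G\<lparr>carrier := H\<rparr>", simplified])
  ultimately show ?thesis using x that by blast
qed

lemma coprime_exponents_imp_one:
  assumes x: "x \<in> carrier G" "x [^] a = \<one>" "x [^] b = \<one>" and "coprime (a :: nat) b"
  shows "x = \<one>"
proof -
  have "ord x dvd a" "ord x dvd b" using x pow_eq_id by auto
  then have "ord x = 1" using \<open>coprime a b\<close> by (metis coprime_common_divisor nat_dvd_1_iff_1)
  then show ?thesis using x by (metis ord_eq_1)
qed

text \<open>
  By Cauchy's theorem no other prime divides the order.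
\<close>
lemma exponent_prime_imp_card_prime_power:
  assumes H: "subgroup H G" and p: "prime p" and ex: "\<And>x. x \<in> H \<Longrightarrow> x [^] p = \<one>"
  obtains k where "card H = p ^ k"
proof -
  have pos: "card H > 0" using H finite_subset[OF subgroup.subset[OF H] finite_carrier] subgroup.one_closed[OF H] by (auto simp: card_gt_0_iff)
  show ?thesis
  proof (rule only_prime_divisor_imp_power[OF pos p])
    fix r assume r: "prime r" "r dvd card H"
    then obtain x where x: "x \<in> H" "x \<noteq> \<one>" "x [^] r = \<one>" using Cauchy_element[OF H r] by blast
    show "r = p"
    proof (rule ccontr)
      assume "r \<noteq> p"
      then have "coprime r p" using r(1) p by (simp add: primes_coprime)
      then show False using coprime_exponents_imp_one[of x r p] x ex subgroup.mem_carrier[OF H] by auto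
    qed
  qed (rule that)
qed

text \<open>
  Sylow conjugacy: \<open>P\<close> acts by translation on the cosets of \<open>Q\<close>, and a fixed coset \<open>Q h\<close> yields the
  conjugating element.
\<close>
lemma prime_power_subgroup_conj_into:
  assumes P: "subgroup P G" and Q: "subgroup Q G" and p: "prime p" and cP: "card P = p ^ a"
    and ndvd: "\<not> p dvd card (rcosets Q)"
  obtains h where "h \<in> carrier G" "\<And>g. g \<in> P \<Longrightarrow> h \<otimes> g \<otimes> inv h \<in> Q"
proof -
  interpret P: finite_group "G\<lparr>carrier := P\<rparr>" by (rule subgroup_finite_group[OF P])
  have PG: "g \<in> carrier G" if "g \<in> P" for g using subgroup.mem_carrier[OF P that] .
  have QG: "Q \<subseteq> carrier G" by (rule subgroup.subset[OF Q])
  interpret A: finite_action "G\<lparr>carrier := P\<rparr>" "\<lambda>g X. X #> inv g" "rcosets Q"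
  proof
    show "finite (rcosets Q)" by (simp add: RCOSETS_def)
  qed (use PG QG in \<open>auto simp: RCOSETS_def coset_mult_assoc inv_mult_group m_assoc\<close>)
  obtain X where X: "X \<in> rcosets Q" "\<And>g. g \<in> P \<Longrightarrow> X #> inv g = X"
    using A.prime_power_fixed_point[OF p, of a] cP ndvd by auto
  obtain h where h: "h \<in> carrier G" "X = Q #> h" using X(1) by (auto simp: RCOSETS_def)
  have "h \<otimes> g \<otimes> inv h \<in> Q" if g: "g \<in> P" for g
  proof -
    have "Q #> (h \<otimes> g) = Q #> h"
      using X(2)[of "inv g"] g h QG PG subgroup.m_inv_closed[OF P g] by (simp add: coset_mult_assoc)
    moreover have "h \<otimes> g \<in> Q #> (h \<otimes> g)" using subgroup.one_closed[OF Q] h g PG by (force simp: r_coset_def)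
    ultimately have "h \<otimes> g \<in> Q #> h" by simp
    then obtain u where "u \<in> Q" "h \<otimes> g = u \<otimes> h" by (auto simp: r_coset_def)
    then show ?thesis using h QG by (auto simp: m_assoc)
  qed
  with h(1) show ?thesis using that by blast
qed

text \<open>
  \<open>P\<close> acts by conjugation on \<open>P - {\<one>}\<close>, a set of size \<open>p\<^sup>a - 1\<close>.
\<close>
lemma prime_power_group_centre_nontrivial:
  assumes P: "subgroup P G" and p: "prime p" and cP: "card P = p ^ a" and a: "a > 0"
  obtains z where "z \<in> P" "z \<noteq> \<one>" "\<And>g. g \<in> P \<Longrightarrow> g \<otimes> z = z \<otimes> g"
proof -
  interpret P: finite_group "G\<lparr>carrier := P\<rparr>" by (rule subgroup_finite_group[OF P])
  have PG: "g \<in> carrier G" if "g \<in> P" for g using subgroup.mem_carrier[OF P that] .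
  have fin: "finite P" using P.finite_carrier by simp
  note Pc = subgroup.m_closed[OF P] subgroup.m_inv_closed[OF P]
  interpret A: finite_action "G\<lparr>carrier := P\<rparr>" "\<lambda>g x. g \<otimes> x \<otimes> inv g" "P - {\<one>}"
  proof
    fix g x assume g: "g \<in> carrier (G\<lparr>carrier := P\<rparr>)" and x: "x \<in> P - {\<one>}"
    have "g \<otimes> x \<otimes> inv g \<noteq> \<one>"
    proof
      assume e: "g \<otimes> x \<otimes> inv g = \<one>"
      have gx: "g \<in> carrier G" "x \<in> carrier G" using g x PG by auto
      then have "x = inv g \<otimes> (g \<otimes> x \<otimes> inv g) \<otimes> g"
        by (simp add: m_assoc) (simp add: m_assoc[symmetric])
      also have "\<dots> = \<one>" unfolding e using gx by simp
      finally show False using x by simp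
    qed
    then show "g \<otimes> x \<otimes> inv g \<in> P - {\<one>}" using g x Pc by auto
  qed (use PG fin in \<open>auto simp: inv_mult_group m_assoc\<close>)
  have "card (P - {\<one>}) = p ^ a - 1" using cP subgroup.one_closed[OF P] fin by simp
  moreover have "\<not> p dvd p ^ a - 1"
  proof
    assume "p dvd p ^ a - 1"
    moreover have "p dvd p ^ a" using a by simp
    moreover have "p ^ a > 0" using p prime_gt_0_nat by simp
    ultimately have "p dvd p ^ a - (p ^ a - 1)" using dvd_diff_nat by blast
    then have "p dvd 1" using \<open>p ^ a > 0\<close> by simp
    then show False using p by (simp add: prime_nat_iff)
  qed
  ultimately obtain z where z: "z \<in> P - {\<one>}" "\<And>g. g \<in> P \<Longrightarrow> g \<otimes> z \<otimes> inv g = z"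
    using A.prime_power_fixed_point[OF p, of a] cP by auto
  have "g \<otimes> z = z \<otimes> g" if g: "g \<in> P" for g
  proof -
    have gz: "g \<in> carrier G" "z \<in> carrier G" using g z(1) PG by auto
    then have "(g \<otimes> z \<otimes> inv g) \<otimes> g = g \<otimes> z" by (simp add: m_assoc)
    then show ?thesis unfolding z(2)[OF g] by simp
  qed
  with z show ?thesis using that by blast
qed

end

section \<open>Groups whose elements have order one, p or q\<close>

context finite_group
begin

definition centralizer :: "'a \<Rightarrow> 'a set" where
  "centralizer x = {g \<in> carrier G. g \<otimes> x = x \<otimes> g}"

definition conj_set :: "'a \<Rightarrow> 'a set \<Rightarrow> 'a set" where
  "conj_set g X = (\<lambda>u. g \<otimes> u \<otimes> inv g) ` X"

lemma subgroup_centralizer: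
  assumes x: "x \<in> carrier G"
  shows "subgroup (centralizer x) G"
proof (rule subgroupI)
  show "centralizer x \<noteq> {}" using x by (auto simp: centralizer_def)
  fix g assume g: "g \<in> centralizer x"
  then have gG: "g \<in> carrier G" "g \<otimes> x = x \<otimes> g" by (auto simp: centralizer_def)
  have "inv g \<otimes> x = inv g \<otimes> (x \<otimes> g) \<otimes> inv g" using x gG(1) by (simp add: m_assoc)
  also have "\<dots> = x \<otimes> inv g" unfolding gG(2)[symmetric] using x gG(1) by (simp add: m_assoc[symmetric])
  finally show "inv g \<in> centralizer x" using gG by (simp add: centralizer_def)
  fix h assume "h \<in> centralizer x"
  then have h: "h \<in> carrier G" "h \<otimes> x = x \<otimes> h" by (auto simp: centralizer_def)
  have "g \<otimes> h \<otimes> x = g \<otimes> x \<otimes> h" using x gG(1) h by (simp add: m_assoc)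
  also have "\<dots> = x \<otimes> (g \<otimes> h)" using x gG h(1) by (simp add: m_assoc)
  finally show "g \<otimes> h \<in> centralizer x" using gG h by (simp add: centralizer_def)
qed (auto simp: centralizer_def)

lemma conj_mult: "g \<in> carrier G \<Longrightarrow> x \<in> carrier G \<Longrightarrow> y \<in> carrier G \<Longrightarrow>
   g \<otimes> (x \<otimes> y) \<otimes> inv g = (g \<otimes> x \<otimes> inv g) \<otimes> (g \<otimes> y \<otimes> inv g)"
  by (simp add: m_assoc) (simp add: m_assoc[symmetric])

lemma conj_conj: "g \<in> carrier G \<Longrightarrow> h \<in> carrier G \<Longrightarrow> x \<in> carrier G \<Longrightarrow>
   g \<otimes> (h \<otimes> x \<otimes> inv h) \<otimes> inv g = (g \<otimes> h) \<otimes> x \<otimes> inv (g \<otimes> h)"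
  by (simp add: m_assoc inv_mult_group)

lemma conj_cancel: "g \<in> carrier G \<Longrightarrow> x \<in> carrier G \<Longrightarrow> g \<otimes> (inv g \<otimes> x \<otimes> inv (inv g)) \<otimes> inv g = x"
  by (simp only: conj_conj inv_closed) simp

lemma conj_inj: "g \<in> carrier G \<Longrightarrow> x \<in> carrier G \<Longrightarrow> y \<in> carrier G \<Longrightarrow>
   g \<otimes> x \<otimes> inv g = g \<otimes> y \<otimes> inv g \<longleftrightarrow> x = y"
  by auto

lemma conj_pow:
  assumes "g \<in> carrier G" "x \<in> carrier G"
  shows "(g \<otimes> x \<otimes> inv g) [^] (n :: nat) = g \<otimes> x [^] n \<otimes> inv g"
  using assms by (induction n) (auto simp: conj_mult)

lemma conj_eq_one_iff: "g \<in> carrier G \<Longrightarrow> x \<in> carrier G \<Longrightarrow> g \<otimes> x \<otimes> inv g = \<one> \<longleftrightarrow> x = \<one>"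
  using conj_inj[of g x \<one>] by simp

lemma centralizer_conj:
  assumes g: "g \<in> carrier G" and x: "x \<in> carrier G"
  shows "centralizer (g \<otimes> x \<otimes> inv g) = conj_set g (centralizer x)"
proof -
  have sub: "conj_set g (centralizer x) \<subseteq> centralizer (g \<otimes> x \<otimes> inv g)"
    if g: "g \<in> carrier G" and x: "x \<in> carrier G" for g x
    using g x by (auto simp: conj_set_def centralizer_def conj_mult[symmetric])
  have "centralizer (g \<otimes> x \<otimes> inv g) \<subseteq> conj_set g (centralizer x)"
  proof
    fix u assume u: "u \<in> centralizer (g \<otimes> x \<otimes> inv g)"
    then have uG: "u \<in> carrier G" by (simp add: centralizer_def)
    have "inv g \<otimes> u \<otimes> inv (inv g) \<in> centralizer (inv g \<otimes> (g \<otimes> x \<otimes> inv g) \<otimes> inv (inv g))"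
      using sub[of "inv g" "g \<otimes> x \<otimes> inv g"] u g x by (auto simp: conj_set_def)
    also have "inv g \<otimes> (g \<otimes> x \<otimes> inv g) \<otimes> inv (inv g) = x" using conj_cancel[of "inv g" x] g x by simp
    finally show "u \<in> conj_set g (centralizer x)"
      unfolding conj_set_def using conj_cancel[OF g uG] by (metis imageI)
  qed
  then show ?thesis using sub[OF g x] by blast
qed

lemma card_conj_set: "g \<in> carrier G \<Longrightarrow> X \<subseteq> carrier G \<Longrightarrow> card (conj_set g X) = card X"
  unfolding conj_set_def by (intro card_image inj_onI) (simp add: conj_inj subset_iff)

lemma conj_set_action: "finite_action G conj_set (Pow (carrier G))"
proof
  fix g h X assume "g \<in> carrier G" "h \<in> carrier G" "X \<in> Pow (carrier G)"
  then show "conj_set (g \<otimes> h) X = conj_set g (conj_set h X)"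
    unfolding conj_set_def image_image by (intro image_cong) (auto simp: conj_conj)
next
  fix X assume "X \<in> Pow (carrier G)"
  then have "conj_set \<one> X = (\<lambda>u. u) ` X" unfolding conj_set_def by (intro image_cong) auto
  then show "conj_set \<one> X = X" by simp
qed (auto simp: conj_set_def)

lemma subgroup_of_subgroup_card_dvd:
  assumes "subgroup H G" "subgroup K G" "H \<subseteq> K"
  shows "card H dvd card K"
proof -
  interpret K: finite_group "G\<lparr>carrier := K\<rparr>" by (rule subgroup_finite_group[OF assms(2)])
  show ?thesis using K.subgroup_card_dvd[OF subgroup_incl[OF assms]] by simp
qed

text \<open>
  Let \<open>U\<close> be the set of elements of order \<open>p\<close>. Their centralizers are Sylow \<open>p\<close>-subgroups, so
  they form a single conjugacy class, of size \<open>s\<close> say. For \<open>x\<close> in \<open>U\<close>, the elements with the same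
  centralizer \<open>P\<close> as \<open>x\<close> are exactly the nonidentity elements of the centre of \<open>P\<close>; \<open>z\<close> is the
  order of this centre. Hence \<open>|U| = s (z - 1)\<close>, which is stated without subtraction.
\<close>
lemma prime_order_element_count:
  assumes p: "prime p" and cG: "card (carrier G) = p ^ a * m" and pm: "\<not> p dvd m"
  defines "U \<equiv> {x \<in> carrier G. x \<noteq> \<one> \<and> x [^] p = \<one>}"
  assumes ne: "U \<noteq> {}" and cen: "\<And>x. x \<in> U \<Longrightarrow> card (centralizer x) = p ^ a"
    and ex: "\<And>x y. x \<in> U \<Longrightarrow> y \<in> centralizer x \<Longrightarrow> y [^] p = \<one>"
  obtains s z where "card U + s = s * z" "s > 0" "s dvd m" "z dvd p ^ a"
proof -
  interpret C: finite_action G conj_set "Pow (carrier G)" by (rule conj_set_action)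
  obtain x where x: "x \<in> U" using ne by blast
  have UG: "u \<in> carrier G" if "u \<in> U" for u using that by (simp add: U_def)
  have p0: "p ^ a > 0" using p prime_gt_0_nat by simp
  have finU: "finite U" by (simp add: U_def)
  note xG = UG[OF x]
  define P where "P = centralizer x"
  have P: "subgroup P G" unfolding P_def by (rule subgroup_centralizer[OF xG])
  note PG = subgroup.subset[OF P]
  have cP: "card P = p ^ a" unfolding P_def by (rule cen[OF x])
  have finP: "finite P" using PG finite_carrier by (rule finite_subset)
  have conjU: "g \<otimes> u \<otimes> inv g \<in> U" if "g \<in> carrier G" "u \<in> U" for g u
    using that by (simp add: U_def conj_pow conj_eq_one_iff)
  have conj: "\<exists>g\<in>carrier G. centralizer u = conj_set g P" if u: "u \<in> U" for u
  proof -
    have Q: "subgroup (centralizer u) G" by (rule subgroup_centralizer[OF UG[OF u]])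
    have "card (rcosets (centralizer u)) * p ^ a = p ^ a * m"
      using lagrange[OF Q] cen[OF u] cG by (simp add: Coset.order_def)
    then have "card (rcosets (centralizer u)) = m" using p0 prime_gt_0_nat[OF p] by (simp add: mult.commute)
    then have "\<not> p dvd card (rcosets (centralizer u))" using pm by simp
    then obtain h where h: "h \<in> carrier G" "\<And>g. g \<in> P \<Longrightarrow> h \<otimes> g \<otimes> inv h \<in> centralizer u"
      using prime_power_subgroup_conj_into[OF P Q p cP] by blast
    have "conj_set h P \<subseteq> centralizer u" using h(2) by (auto simp: conj_set_def)
    moreover have "card (conj_set h P) = card (centralizer u)" using card_conj_set[OF h(1) PG] cP cen[OF u] by simp
    moreover have "finite (centralizer u)" by (simp add: centralizer_def)
    ultimately have "conj_set h P = centralizer u" by (intro card_subset_eq)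
    then show ?thesis using h(1) by auto
  qed
  have orb: "centralizer ` U = C.orb P"
  proof
    show "centralizer ` U \<subseteq> C.orb P" using conj by (fastforce simp: C.orb_def)
    show "C.orb P \<subseteq> centralizer ` U"
    proof
      fix Q assume "Q \<in> C.orb P"
      then obtain g where g: "g \<in> carrier G" "Q = conj_set g P" by (auto simp: C.orb_def)
      then have "Q = centralizer (g \<otimes> x \<otimes> inv g)" by (simp add: P_def centralizer_conj[OF _ xG])
      then show "Q \<in> centralizer ` U" using conjU[OF g(1) x] by blast
    qed
  qed
  define s where "s = card (centralizer ` U)"
  have s0: "s > 0" using ne finU by (auto simp: s_def card_gt_0_iff)
  have "s dvd m"
  proof -
    have PE: "P \<in> Pow (carrier G)" using PG by simp
    have "P \<subseteq> C.stab P"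
    proof
      fix g assume g: "g \<in> P"
      then have gG: "g \<in> carrier G" using PG by blast
      have "g \<otimes> u \<otimes> inv g \<in> P" if "u \<in> P" for u
        using subgroup.m_closed[OF P subgroup.m_closed[OF P g that] subgroup.m_inv_closed[OF P g]] .
      then have "conj_set g P \<subseteq> P" by (auto simp: conj_set_def)
      moreover have "card (conj_set g P) = card P" by (rule card_conj_set[OF gG PG])
      ultimately have "conj_set g P = P" using finP by (intro card_subset_eq)
      then show "g \<in> C.stab P" using gG by (simp add: C.stab_def)
    qed
    then have "card P dvd card (C.stab P)" by (rule subgroup_of_subgroup_card_dvd[OF P C.subgroup_stab[OF PE]])
    then obtain k where "card (C.stab P) = p ^ a * k" using cP by auto
    then have "s * (p ^ a * k) = p ^ a * m" using C.card_orb_stab[OF PE] orb cG by (simp add: s_def)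
    then have "p ^ a * (s * k) = p ^ a * m" by (simp only: mult_ac)
    then have "s * k = m" using p0 prime_gt_0_nat[OF p] by simp
    then show ?thesis by (metis dvd_triv_left)
  qed
  \<comment> \<open>the centre of \<open>P\<close>\<close>
  define Z where "Z = {u \<in> P. \<forall>v\<in>P. v \<in> centralizer u}"
  have Zsub: "subgroup Z G"
  proof -
    have "Z = P \<inter> \<Inter>(centralizer ` P)"
      using PG by (auto simp: Z_def centralizer_def)
    moreover have "subgroup (\<Inter>(insert P (centralizer ` P))) G"
      using P PG subgroup_centralizer by (intro subgroups_Inter) auto
    ultimately show ?thesis by simp
  qed
  define z where "z = card Z"
  have "z dvd p ^ a"
    unfolding z_def cP[symmetric] by (rule subgroup_of_subgroup_card_dvd[OF Zsub P]) (auto simp: Z_def)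
  have finZ: "finite Z" using finP by (simp add: Z_def)
  have one_Z: "\<one> \<in> Z" by (rule subgroup.one_closed[OF Zsub])
  have fibre_x: "{u \<in> U. centralizer u = P} = Z - {\<one>}"
  proof (intro equalityI subsetI)
    fix u assume "u \<in> {u \<in> U. centralizer u = P}"
    then have u: "u \<in> U" "centralizer u = P" by auto
    moreover have "u \<in> centralizer u" using UG[OF u(1)] by (simp add: centralizer_def)
    ultimately show "u \<in> Z - {\<one>}" by (auto simp: Z_def U_def)
  next
    fix u assume u: "u \<in> Z - {\<one>}"
    then have "u \<in> P" by (simp add: Z_def)
    then have "u [^] p = \<one>" using ex[OF x] by (simp add: P_def)
    then have uU: "u \<in> U" using u \<open>u \<in> P\<close> PG by (auto simp: U_def)
    have "P \<subseteq> centralizer u" using u by (auto simp: Z_def)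
    then have "P = centralizer u"
      using cP cen[OF uU] by (intro card_subset_eq) (auto simp: centralizer_def)
    then show "u \<in> {u \<in> U. centralizer u = P}" using uU by simp
  qed
  have fibre: "card {u \<in> U. centralizer u = Q} = z - 1" if Q: "Q \<in> centralizer ` U" for Q
  proof -
    obtain g where g: "g \<in> carrier G" "Q = conj_set g P" using Q conj by auto
    have ig: "inv g \<in> carrier G" using g by simp
    have "bij_betw (\<lambda>u. g \<otimes> u \<otimes> inv g) {u \<in> U. centralizer u = P} {u \<in> U. centralizer u = Q}"
    proof (rule bij_betwI[where g = "\<lambda>u. inv g \<otimes> u \<otimes> inv (inv g)"])
      show "(\<lambda>u. g \<otimes> u \<otimes> inv g) \<in> {u \<in> U. centralizer u = P} \<rightarrow> {u \<in> U. centralizer u = Q}"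
        using g conjU by (auto simp: centralizer_conj UG)
      show "(\<lambda>u. inv g \<otimes> u \<otimes> inv (inv g)) \<in> {u \<in> U. centralizer u = Q} \<rightarrow> {u \<in> U. centralizer u = P}"
      proof
        fix u assume "u \<in> {u \<in> U. centralizer u = Q}"
        then have u: "u \<in> U" "centralizer u = Q" by auto
        have "centralizer (inv g \<otimes> u \<otimes> inv (inv g)) = conj_set (inv g) (conj_set g P)"
          using centralizer_conj[OF ig UG[OF u(1)]] u(2) g(2) by simp
        also have "\<dots> = P" using C.act_inv_cancel(1)[OF g(1), of P] PG by simp
        finally show "inv g \<otimes> u \<otimes> inv (inv g) \<in> {u \<in> U. centralizer u = P}" using conjU[OF ig u(1)] by simp
      qed
      show "inv g \<otimes> (g \<otimes> u \<otimes> inv g) \<otimes> inv (inv g) = u" if "u \<in> {u \<in> U. centralizer u = P}" for u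
        using conj_cancel[OF ig, of u] that g UG by simp
      show "g \<otimes> (inv g \<otimes> u \<otimes> inv (inv g)) \<otimes> inv g = u" if "u \<in> {u \<in> U. centralizer u = Q}" for u
        using conj_cancel[OF g(1), of u] that UG by simp
    qed
    from bij_betw_same_card[OF this] have "card {u \<in> U. centralizer u = Q} = card (Z - {\<one>})"
      unfolding fibre_x by (rule sym)
    then show ?thesis using one_Z finZ by (simp add: z_def)
  qed
  have "card U = (\<Sum>Q\<in>centralizer ` U. card {u \<in> U. centralizer u = Q})"
    using sum.image_gen[OF finU, of "\<lambda>_. 1 :: nat" centralizer] by simp
  also have "\<dots> = s * (z - 1)" using fibre by (simp add: s_def)
  finally have cU: "card U = s * (z - 1)" .
  have "z > 0" using one_Z finZ by (auto simp: z_def card_gt_0_iff)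
  then have "card U + s = s * z" unfolding cU by (cases z) simp_all
  then show ?thesis using s0 \<open>s dvd m\<close> \<open>z dvd p ^ a\<close> by (rule that)
qed

text \<open>
  The product of commuting elements of orders \<open>p\<close> and \<open>q\<close> would have order \<open>p q\<close>, which \<open>E\<close> excludes.
\<close>
lemma centralizer_exponent:
  fixes p q :: nat
  assumes p: "prime p" and q: "prime q" and neq: "p \<noteq> q"
    and E: "\<And>u. u \<in> carrier G \<Longrightarrow> u [^] p = \<one> \<or> u [^] q = \<one>"
    and x: "x \<in> carrier G" "x \<noteq> \<one>" "x [^] p = \<one>" and y: "y \<in> centralizer x"
  shows "y [^] p = \<one>"
proof (rule ccontr)
  assume yp: "y [^] p \<noteq> \<one>"
  have yG: "y \<in> carrier G" and comm: "x \<otimes> y = y \<otimes> x" using y by (auto simp: centralizer_def)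
  have yq: "y [^] q = \<one>" using E[OF yG] yp by blast
  have cop: "coprime p q" using p q neq by (simp add: primes_coprime)
  have "(x \<otimes> y) [^] p = y [^] p" using pow_mult_distrib[OF comm x(1) yG, of p] x(3) yG by simp
  moreover have "(x \<otimes> y) [^] q = x [^] q" using pow_mult_distrib[OF comm x(1) yG, of q] yq x(1) by simp
  ultimately have "x [^] q = \<one>" using E[of "x \<otimes> y"] yp x(1) yG by simp
  then show False using coprime_exponents_imp_one[OF x(1,3) _ cop] x(2) by simp
qed

lemma sylow_subgroup_exponent:
  fixes p q :: nat
  assumes p: "prime p" and q: "prime q" and neq: "p \<noteq> q"
    and E: "\<And>u. u \<in> carrier G \<Longrightarrow> u [^] p = \<one> \<or> u [^] q = \<one>"
    and P: "subgroup P G" "card P = p ^ a" and x: "x \<in> P"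
  shows "x [^] p = \<one>"
proof -
  have xG: "x \<in> carrier G" by (rule subgroup.mem_carrier[OF P(1) x])
  interpret P: finite_group "G\<lparr>carrier := P\<rparr>" by (rule subgroup_finite_group[OF P(1)])
  have "x [^] (p ^ a) = \<one>" using P.pow_order_eq_one[of x] x P(2) by (simp add: nat_pow_consistent[symmetric])
  moreover have "coprime (p ^ a) q" using p q neq by (simp add: primes_coprime)
  ultimately have "x [^] q = \<one> \<Longrightarrow> x = \<one>" using coprime_exponents_imp_one[OF xG, of "p ^ a" q] by blast
  then show ?thesis using E[OF xG] by auto
qed

text \<open>
  A central element of a Sylow \<open>p\<close>-subgroup has a centralizer containing it; being a \<open>p\<close>-group, this
  centralizer is no larger. By assumption all other elements of order \<open>p\<close> have centralizers of the same size.
\<close>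
lemma centralizer_card_sylow:
  fixes p q :: nat
  assumes p: "prime p" and q: "prime q" and neq: "p \<noteq> q"
    and E: "\<And>u. u \<in> carrier G \<Longrightarrow> u [^] p = \<one> \<or> u [^] q = \<one>"
    and cG: "card (carrier G) = p ^ a * m" and pm: "\<not> p dvd m" and a: "a > 0"
    and hom: "\<And>x y. \<lbrakk>x \<in> carrier G; x \<noteq> \<one>; x [^] p = \<one>; y \<in> carrier G; y \<noteq> \<one>; y [^] p = \<one>\<rbrakk> \<Longrightarrow>
      card (centralizer x) = card (centralizer y)"
    and x: "x \<in> carrier G" "x \<noteq> \<one>" "x [^] p = \<one>"
  shows "card (centralizer x) = p ^ a"
proof -
  obtain P where P: "subgroup P G" "card P = p ^ a"
    using sylow_thm[OF p is_group, of a m] cG by (auto simp: Coset.order_def)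
  obtain z where z: "z \<in> P" "z \<noteq> \<one>" "\<And>g. g \<in> P \<Longrightarrow> g \<otimes> z = z \<otimes> g"
    using prime_power_group_centre_nontrivial[OF P(1) p P(2) a] by blast
  have zG: "z \<in> carrier G" by (rule subgroup.mem_carrier[OF P(1) z(1)])
  have zp: "z [^] p = \<one>" by (rule sylow_subgroup_exponent[OF p q neq E P z(1)])
  have C: "subgroup (centralizer z) G" by (rule subgroup_centralizer[OF zG])
  obtain k where k: "card (centralizer z) = p ^ k"
    using exponent_prime_imp_card_prime_power[OF C p] centralizer_exponent[OF p q neq E zG z(2) zp] by blast
  have "p ^ k dvd p ^ a * m" using subgroup_card_dvd[OF C] k cG by simp
  moreover have "coprime (p ^ k) m" using p pm by (simp add: prime_imp_coprime)
  ultimately have "p ^ k dvd p ^ a" by (simp add: coprime_dvd_mult_left_iff)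
  then have "p ^ k \<le> p ^ a" using p prime_gt_0_nat by (intro dvd_imp_le) auto
  moreover have "P \<subseteq> centralizer z" using z(3) subgroup.subset[OF P(1)] by (auto simp: centralizer_def)
  then have "card P \<le> card (centralizer z)" by (intro card_mono) (auto simp: centralizer_def)
  ultimately have "card (centralizer z) = p ^ a" using k P(2) by simp
  then show ?thesis using hom[OF x zG z(2) zp] by simp
qed

text \<open>
  Write \<open>|G| = p\<^sup>a q\<^sup>b\<close>. There are \<open>s (z - 1)\<close> elements of order \<open>p\<close> and \<open>t (w - 1)\<close> of order
  \<open>q\<close>, where \<open>s z\<close> and \<open>t w\<close> divide \<open>|G|\<close>. If both products were proper divisors, hence at most
  \<open>|G| / 2\<close>, the total count would be at most \<open>1 + |G| - s - t < |G|\<close>. So, say, \<open>s z = |G|\<close>. Then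
  \<open>s = q\<^sup>b\<close>, which leaves only \<open>q\<^sup>b - 1\<close> elements of order \<open>q\<close>, as many as one Sylow
  \<open>q\<close>-subgroup contains.
\<close>
lemma two_prime_exponents_sylow_unique:
  fixes p q :: nat
  assumes p: "prime p" "p dvd card (carrier G)" and q: "prime q" "q dvd card (carrier G)" and neq: "p \<noteq> q"
    and E: "\<And>u. u \<in> carrier G \<Longrightarrow> u [^] p = \<one> \<or> u [^] q = \<one>"
    and hom: "\<And>r x y. \<lbrakk>r \<in> {p, q}; x \<in> carrier G; x \<noteq> \<one>; x [^] r = \<one>; y \<in> carrier G; y \<noteq> \<one>; y [^] r = \<one>\<rbrakk> \<Longrightarrow>
      card (centralizer x) = card (centralizer y)"
  shows "\<exists>r\<in>{p, q}. subgroup {x \<in> carrier G. x [^] r = \<one>} G"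
proof -
  define N where "N = card (carrier G)"
  have N0: "N > 0" unfolding N_def by (rule card_carrier_pos)
  have E': "u [^] q = \<one> \<or> u [^] p = \<one>" if "u \<in> carrier G" for u using E[OF that] by blast
  obtain m where m: "N = p ^ multiplicity p N * m" "\<not> p dvd m"
    by (rule multiplicity_decompose'[of N p]) (use N0 p in auto)
  have m0: "m > 0" using m N0 by (cases m) auto
  obtain m' where m': "m = q ^ multiplicity q m * m'" "\<not> q dvd m'"
    by (rule multiplicity_decompose'[of m q]) (use m0 q in auto)
  define a b where "a = multiplicity p N" and "b = multiplicity q m"
  have "m' = 1"
  proof (rule ccontr)
    assume "m' \<noteq> 1"
    then obtain r where r: "prime r" "r dvd m'" using prime_factor_nat by blast
    have "r dvd m" using r(2) m'(1) by (metis dvd_mult)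
    then have "r \<noteq> p" "r \<noteq> q" using m(2) m'(2) r(2) by auto
    have "r dvd card (carrier G)" using \<open>r dvd m\<close> m(1) unfolding N_def by (metis dvd_mult)
    then obtain x where x: "x \<in> carrier G" "x \<noteq> \<one>" "x [^] r = \<one>" using Cauchy_element[OF subgroup_self r(1)] by blast
    have "coprime r p" "coprime r q" using r(1) p(1) q(1) \<open>r \<noteq> p\<close> \<open>r \<noteq> q\<close> by (auto simp: primes_coprime)
    then show False using E[OF x(1)] coprime_exponents_imp_one[OF x(1,3)] x(2) by blast
  qed
  then have Npq: "N = p ^ a * q ^ b" using m(1) m'(1) by (simp add: a_def b_def)
  have cGp: "card (carrier G) = p ^ a * q ^ b" and cGq: "card (carrier G) = q ^ b * p ^ a"
    using Npq by (auto simp: N_def mult.commute)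
  define U where "U r = {x \<in> carrier G. x \<noteq> \<one> \<and> x [^] r = \<one>}" for r :: nat
  have count: "\<exists>s z. card (U r) + s = s * z \<and> s > 0 \<and> s dvd r' ^ f \<and> z dvd r ^ e"
    if r: "r \<in> {p, q}" "prime r" "r dvd card (carrier G)" "prime r'" "r \<noteq> r'"
      and Er: "\<And>u. u \<in> carrier G \<Longrightarrow> u [^] r = \<one> \<or> u [^] r' = \<one>"
      and c: "card (carrier G) = r ^ e * r' ^ f" for r r' e f
  proof (rule prime_order_element_count[OF r(2) c, folded U_def])
    show nd: "\<not> r dvd r' ^ f"
      using r(2,4,5) primes_dvd_imp_eq prime_dvd_power_nat by blast
    have e: "e > 0" using r(3) c nd by (cases e) auto
    obtain x where "x \<in> carrier G" "x \<noteq> \<one>" "x [^] r = \<one>" by (rule Cauchy_element[OF subgroup_self r(2,3)])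
    then have "x \<in> U r" by (simp add: U_def)
    then show "U r \<noteq> {}" by blast
    show "card (centralizer x) = r ^ e" if "x \<in> U r" for x
      by (rule centralizer_card_sylow[OF r(2,4,5) Er c nd e hom[OF r(1)]]) (use that in \<open>auto simp: U_def\<close>)
    show "y [^] r = \<one>" if "x \<in> U r" "y \<in> centralizer x" for x y
      by (rule centralizer_exponent[OF r(2,4,5) Er _ _ _ that(2)]) (use that(1) in \<open>auto simp: U_def\<close>)
  qed blast
  obtain s z where sz: "card (U p) + s = s * z" "s > 0" "s dvd q ^ b" "z dvd p ^ a"
    using count[OF _ p q(1) neq E cGp] by auto
  obtain t w where tw: "card (U q) + t = t * w" "t > 0" "t dvd p ^ a" "w dvd q ^ b"
    using count[OF _ q p(1) neq[symmetric] E' cGq] by auto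
  have cop: "coprime p q" using p q neq by (simp add: primes_coprime)
  have total: "1 + card (U p) + card (U q) = N"
  proof -
    have "carrier G = {\<one>} \<union> U p \<union> U q" using E by (auto simp: U_def)
    moreover have "U p \<inter> U q = {}" using coprime_exponents_imp_one[OF _ _ _ cop] by (auto simp: U_def)
    moreover have "\<one> \<notin> U p" "\<one> \<notin> U q" "finite (U p)" "finite (U q)" by (auto simp: U_def)
    ultimately show ?thesis unfolding N_def by (simp add: card_Un_disjoint)
  qed
  have power_pos: "p ^ a > 0" "q ^ b > 0" using p q prime_gt_0_nat by auto
  have full: "d = x" if "d * d' = x * y" "d dvd x" "d' dvd y" "x > 0" "y > 0" for d d' x y :: nat
  proof (rule ccontr)
    assume "d \<noteq> x"
    then have "d < x" using dvd_imp_le[OF that(2,4)] by simp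
    then have "d * y < x * y" using that(5) by simp
    moreover have "d * d' \<le> d * y" using dvd_imp_le[OF that(3,5)] by simp
    ultimately show False using that(1) by simp
  qed
  have half: "2 * d \<le> N" if dvd: "d dvd N" and ne: "d \<noteq> N" for d
  proof -
    obtain k where k: "N = d * k" using dvd by (rule dvdE)
    then have "k \<noteq> 0" "k \<noteq> 1" using ne N0 by auto
    then have "2 \<le> k" by simp
    then show ?thesis unfolding k by (metis mult.commute mult_le_mono1)
  qed
  have sub: "subgroup {x \<in> carrier G. x [^] r = \<one>} G"
    if r: "prime r" "prime r'" "r \<noteq> r'" and Er: "\<And>u. u \<in> carrier G \<Longrightarrow> u [^] r = \<one> \<or> u [^] r' = \<one>"
      and c: "card (carrier G) = r ^ e * l" and cU: "card (U r) + 1 = r ^ e" for r r' e l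
  proof -
    obtain R where R: "subgroup R G" "card R = r ^ e"
      using sylow_thm[OF r(1) is_group, of e l] c by (auto simp: Coset.order_def)
    have "R \<subseteq> insert \<one> (U r)"
      using sylow_subgroup_exponent[OF r Er R] subgroup.subset[OF R(1)] by (auto simp: U_def)
    moreover have "card R = card (insert \<one> (U r))" using R(2) cU by (simp add: U_def)
    ultimately have "R = insert \<one> (U r)" by (intro card_subset_eq) (auto simp: U_def)
    also have "\<dots> = {x \<in> carrier G. x [^] r = \<one>}" by (auto simp: U_def)
    finally show ?thesis using R(1) by simp
  qed
  have szN: "s * z dvd N" unfolding Npq using mult_dvd_mono[OF sz(4,3)] by (simp add: mult.commute)
  have twN: "t * w dvd N" unfolding Npq using mult_dvd_mono[OF tw(3,4)] .
  show ?thesis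
  proof (cases "s * z = N")
    case True
    have "s = q ^ b" using True Npq by (intro full[OF _ sz(3,4) power_pos(2,1)]) (simp add: mult.commute)
    then have cU: "card (U q) + 1 = q ^ b" using True total sz(1) by simp
    have "subgroup {x \<in> carrier G. x [^] q = \<one>} G"
      by (rule sub[OF q(1) p(1) neq[symmetric] _ cGq cU]) (rule E')
    then show ?thesis by blast
  next
    case False
    have "t * w = N"
    proof (rule ccontr)
      assume "t * w \<noteq> N"
      then have "2 * (t * w) \<le> N" using half twN by blast
      moreover have "2 * (s * z) \<le> N" using half szN False by blast
      ultimately show False using total sz(1,2) tw(1,2) by linarith
    qed
    have "t = p ^ a" using \<open>t * w = N\<close> Npq by (intro full[OF _ tw(3,4) power_pos]) simp
    then have cU: "card (U p) + 1 = p ^ a" using \<open>t * w = N\<close> total tw(1) by simp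
    have "subgroup {x \<in> carrier G. x [^] p = \<one>} G"
      by (rule sub[OF p(1) q(1) neq _ cGp cU]) (rule E)
    then show ?thesis by blast
  qed
qed

end

section \<open>Perfect minimal normal subgroups\<close>

context finite_group
begin

lemma conj_class_sym:
  assumes "x \<in> carrier G" "y \<in> conj_class x" shows "x \<in> conj_class y"
proof -
  obtain h where h: "h \<in> carrier G" "y = h \<otimes> x \<otimes> inv h" using assms(2) by (auto simp: conj_class_def)
  then have "inv h \<otimes> y \<otimes> inv (inv h) = x" using conj_cancel[of "inv h" x] assms(1) by simp
  then show ?thesis unfolding conj_class_def using h(1) by (intro image_eqI[of _ _ "inv h"]) auto
qed

lemma conj_class_pow_eq_one:
  assumes "x \<in> carrier G" "y \<in> conj_class x" "x [^] (n :: nat) = \<one>" shows "y [^] n = \<one>"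
  using assms by (auto simp: conj_class_def conj_pow)

text \<open>
  With at most three classes in \<open>N\<close>, one of them that of the identity, the order of \<open>N\<close> has at most two prime
  divisors. If there is one, the centre of \<open>N\<close> contradicts perfection. If there are two, each nontrivial class
  consists of the elements of one prime order, and the subgroup of elements of exponent \<open>p\<close> or of exponent \<open>q\<close>
  contradicts minimality.
\<close>
lemma perfect_minimal_normal_four_classes:
  assumes N: "N \<lhd> G" and ne: "N \<noteq> {\<one>}" and perfect: "derived G N = N"
    and min: "\<And>L. L \<lhd> G \<Longrightarrow> L \<noteq> {\<one>} \<Longrightarrow> N \<subseteq> L"
  shows "\<exists>I\<subseteq>N. card I = 4 \<and> (\<forall>x\<in>I. \<forall>y\<in>I. y \<in> conj_class x \<longrightarrow> x = y)"
proof (rule ccontr)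
  assume few: "\<not> ?thesis"
  have sub: "subgroup N G" and normal: "\<And>g x. g \<in> carrier G \<Longrightarrow> x \<in> N \<Longrightarrow> g \<otimes> x \<otimes> inv g \<in> N"
    using N by (auto simp: normal_inv_iff)
  have NG: "x \<in> carrier G" if "x \<in> N" for x by (rule subgroup.mem_carrier[OF sub that])
  have one: "\<one> \<in> N" by (rule subgroup.one_closed[OF sub])
  have finN: "finite N" using finite_subset[OF subgroup.subset[OF sub] finite_carrier] .
  interpret K: finite_group "G\<lparr>carrier := N\<rparr>" by (rule subgroup_finite_group[OF sub])
  have "card N \<noteq> 1"
  proof
    assume "card N = 1"
    then have "N = {\<one>}" using one by (auto simp: card_1_singleton_iff)
    then show False using ne by simp
  qed
  then obtain p where p: "prime p" "p dvd card N" using prime_factor_nat by blast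
  obtain x where x: "x \<in> N" "x \<noteq> \<one>" "x [^] p = \<one>" using Cauchy_element[OF sub p] by blast
  show False
  proof (cases "\<forall>q. prime q \<longrightarrow> q dvd card N \<longrightarrow> q = p")
    case True
    have N0: "card N > 0" using one finN by (auto simp: card_gt_0_iff)
    obtain k where ck: "card N = p ^ k"
      by (rule only_prime_divisor_imp_power[OF N0 p(1)]) (use True in auto)
    then have "k > 0" using \<open>card N \<noteq> 1\<close> by (cases k) auto
    obtain z where z: "z \<in> N" "z \<noteq> \<one>" "\<And>g. g \<in> N \<Longrightarrow> g \<otimes> z = z \<otimes> g"
      using prime_power_group_centre_nontrivial[OF sub p(1) ck \<open>k > 0\<close>] by blast
    \<comment> \<open>the centre of \<open>N\<close>\<close>
    define Z where "Z = N \<inter> \<Inter>(centralizer ` N)"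
    have Z_iff: "u \<in> Z \<longleftrightarrow> u \<in> N \<and> (\<forall>v\<in>N. u \<otimes> v = v \<otimes> u)" for u
      using NG by (auto simp: Z_def centralizer_def)
    have "subgroup (\<Inter>(insert N (centralizer ` N))) G"
      using sub NG subgroup_centralizer by (intro subgroups_Inter) auto
    then have "subgroup Z G" by (simp add: Z_def)
    moreover have "g \<otimes> u \<otimes> inv g \<in> Z" if g: "g \<in> carrier G" and u: "u \<in> Z" for g u
    proof -
      have uN: "u \<in> N" and uc: "\<And>v. v \<in> N \<Longrightarrow> u \<otimes> v = v \<otimes> u" using u by (auto simp: Z_iff)
      have "(g \<otimes> u \<otimes> inv g) \<otimes> v = v \<otimes> (g \<otimes> u \<otimes> inv g)" if v: "v \<in> N" for v
      proof -
        define v' where "v' = inv g \<otimes> v \<otimes> inv (inv g)"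
        have v': "v' \<in> N" unfolding v'_def using normal[of "inv g" v] g v by simp
        have "g \<otimes> (u \<otimes> v') \<otimes> inv g = g \<otimes> (v' \<otimes> u) \<otimes> inv g" using uc[OF v'] by simp
        then have "(g \<otimes> u \<otimes> inv g) \<otimes> (g \<otimes> v' \<otimes> inv g) = (g \<otimes> v' \<otimes> inv g) \<otimes> (g \<otimes> u \<otimes> inv g)"
          using g NG[OF uN] NG[OF v'] by (simp only: conj_mult)
        moreover have "g \<otimes> v' \<otimes> inv g = v" unfolding v'_def by (rule conj_cancel[OF g NG[OF v]])
        ultimately show ?thesis by simp
      qed
      then show ?thesis using normal[OF g uN] by (simp add: Z_iff)
    qed
    ultimately have "Z \<lhd> G" by (simp add: normal_inv_iff)
    moreover have "Z \<noteq> {\<one>}" using z by (auto simp: Z_iff)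
    ultimately have "N \<subseteq> Z" by (rule min)
    then have comm: "u \<otimes> v = v \<otimes> u" if "u \<in> N" "v \<in> N" for u v using that by (auto simp: Z_iff)
    have "derived_set G N \<subseteq> {\<one>}"
    proof (clarsimp)
      fix u v assume uv: "u \<in> N" "v \<in> N"
      have "u \<otimes> v \<otimes> inv u \<otimes> inv v = v \<otimes> u \<otimes> inv u \<otimes> inv v" using comm[OF uv] by simp
      also have "\<dots> = \<one>" using NG[OF uv(1)] NG[OF uv(2)] by (simp add: m_assoc)
      finally show "u \<otimes> v \<otimes> inv u \<otimes> inv v = \<one>" .
    qed
    then have "derived G N \<subseteq> {\<one>}" unfolding derived_def using mono_generate generate_one by blast
    then show False using perfect ne one by blast
  next
    case False
    then obtain q where q: "prime q" "q dvd card N" "p \<noteq> q" by blast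
    obtain y where y: "y \<in> N" "y \<noteq> \<one>" "y [^] q = \<one>" using Cauchy_element[OF sub q(1,2)] by blast
    have cop: "coprime p q" using p q by (simp add: primes_coprime)
    have xq: "x [^] q \<noteq> \<one>" using coprime_exponents_imp_one[OF NG[OF x(1)] x(3) _ cop] x(2) by blast
    have yp: "y [^] p \<noteq> \<one>" using coprime_exponents_imp_one[OF NG[OF y(1)] _ y(3) cop] y(2) by blast
    have one_class: "v = \<one>" if "v \<in> conj_class \<one>" for v using that by (auto simp: conj_class_def)
    have two: "u \<in> conj_class x \<or> u \<in> conj_class y" if u: "u \<in> N" "u \<noteq> \<one>" for u
    proof (rule ccontr)
      assume n: "\<not> (u \<in> conj_class x \<or> u \<in> conj_class y)"
      have xy: "y \<notin> conj_class x" "x \<notin> conj_class y"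
        using conj_class_pow_eq_one[OF NG[OF x(1)] _ x(3)] conj_class_pow_eq_one[OF NG[OF y(1)] _ y(3)] xq yp by auto
      have ux: "x \<notin> conj_class u" "y \<notin> conj_class u"
        using n conj_class_sym[OF NG[OF u(1)]] by auto
      have o: "\<one> \<notin> conj_class v" if "v \<in> N" "v \<noteq> \<one>" for v
        using conj_class_sym[OF NG[OF that(1)], of \<one>] one_class[of v] that(2) by blast
      have self: "v \<in> conj_class v" if "v \<in> N" for v by (rule conj_class_self[OF NG[OF that]])
      have ne: "x \<noteq> y" "x \<noteq> u" "y \<noteq> u" using xy n self x(1) y(1) u(1) by auto
      have "card {\<one>, x, y, u} = 4" using ne x(2) y(2) u(2) by auto
      moreover have "\<forall>a\<in>{\<one>, x, y, u}. \<forall>b\<in>{\<one>, x, y, u}. b \<in> conj_class a \<longrightarrow> a = b"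
        using n xy ux o[OF x(1,2)] o[OF y(1,2)] o[OF u] one_class by blast
      moreover have "{\<one>, x, y, u} \<subseteq> N" using one x(1) y(1) u(1) by simp
      ultimately show False using few by blast
    qed
    have KE: "u [^] p = \<one> \<or> u [^] q = \<one>" if u: "u \<in> N" for u
    proof (cases "u = \<one>")
      case False
      then show ?thesis using two[OF u] conj_class_pow_eq_one[OF NG[OF x(1)] _ x(3)]
          conj_class_pow_eq_one[OF NG[OF y(1)] _ y(3)] by blast
    qed simp
    have pow: "u [^]\<^bsub>G\<lparr>carrier := N\<rparr>\<^esub> n = u [^] n" for u and n :: nat
      by (simp add: nat_pow_consistent[symmetric])
    have Kcen: "K.centralizer u = N \<inter> centralizer u" if "u \<in> N" for u
      using NG by (auto simp: K.centralizer_def centralizer_def)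
    have cen_le: "card (K.centralizer u) \<le> card (K.centralizer (g \<otimes> u \<otimes> inv g))"
      if u: "u \<in> N" and g: "g \<in> carrier G" for u g
    proof -
      have "conj_set g (N \<inter> centralizer u) \<subseteq> N \<inter> conj_set g (centralizer u)"
        using normal[OF g] by (auto simp: conj_set_def)
      also have "\<dots> = K.centralizer (g \<otimes> u \<otimes> inv g)"
        using Kcen[OF normal[OF g u]] centralizer_conj[OF g NG[OF u]] by simp
      finally have "conj_set g (N \<inter> centralizer u) \<subseteq> K.centralizer (g \<otimes> u \<otimes> inv g)" .
      moreover have "finite (K.centralizer (g \<otimes> u \<otimes> inv g))" using finN by (simp add: K.centralizer_def)
      moreover have "card (conj_set g (N \<inter> centralizer u)) = card (N \<inter> centralizer u)"
        using NG by (intro card_conj_set[OF g]) auto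
      ultimately show ?thesis using Kcen[OF u] card_mono by metis
    qed
    have cen_eq: "card (K.centralizer u) = card (K.centralizer v)" if v: "v \<in> N" and u: "u \<in> conj_class v" for u v
    proof -
      obtain g where g: "g \<in> carrier G" "u = g \<otimes> v \<otimes> inv g" using u by (auto simp: conj_class_def)
      have uN: "u \<in> N" using normal[OF g(1) v] g(2) by simp
      have "inv g \<otimes> u \<otimes> inv (inv g) = v" using conj_cancel[of "inv g" v] g NG[OF v] by simp
      then show ?thesis using cen_le[OF v g(1)] cen_le[OF uN, of "inv g"] g by auto
    qed
    have cen_hom: "card (K.centralizer u) = card (K.centralizer v)"
      if r: "r \<in> {p, q}" and u: "u \<in> N" "u \<noteq> \<one>" "u [^] r = \<one>" and v: "v \<in> N" "v \<noteq> \<one>" "v [^] r = \<one>" for r u v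
    proof -
      \<comment> \<open>All elements of order \<open>r\<close> are conjugate to \<open>c\<close>.\<close>
      define c where "c = (if r = p then x else y)"
      have "w \<in> conj_class c" if w: "w \<in> N" "w \<noteq> \<one>" "w [^] r = \<one>" for w
      proof -
        have "w \<notin> conj_class (if r = p then y else x)"
        proof
          assume "w \<in> conj_class (if r = p then y else x)"
          then have "(if r = p then y else x) \<in> conj_class w"
            using conj_class_sym NG x(1) y(1) by (auto split: if_splits)
          from conj_class_pow_eq_one[OF NG[OF w(1)] this w(3)] show False
            using xq yp r by (auto split: if_splits)
        qed
        then show ?thesis using two[OF w(1,2)] by (auto simp: c_def split: if_splits)
      qed
      moreover have "c \<in> N" using x(1) y(1) by (simp add: c_def)
      ultimately show ?thesis using cen_eq[of c] u v by metis
    qed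
    have "\<exists>r\<in>{p, q}. subgroup {u \<in> carrier (G\<lparr>carrier := N\<rparr>). u [^]\<^bsub>G\<lparr>carrier := N\<rparr>\<^esub> r = \<one>\<^bsub>G\<lparr>carrier := N\<rparr>\<^esub>} (G\<lparr>carrier := N\<rparr>)"
    proof (rule K.two_prime_exponents_sylow_unique[OF p(1) _ q(1) _ q(3)])
      show "p dvd card (carrier (G\<lparr>carrier := N\<rparr>))" "q dvd card (carrier (G\<lparr>carrier := N\<rparr>))" using p(2) q(2) by auto
    next
      fix u assume "u \<in> carrier (G\<lparr>carrier := N\<rparr>)"
      then show "u [^]\<^bsub>G\<lparr>carrier := N\<rparr>\<^esub> p = \<one>\<^bsub>G\<lparr>carrier := N\<rparr>\<^esub> \<or> u [^]\<^bsub>G\<lparr>carrier := N\<rparr>\<^esub> q = \<one>\<^bsub>G\<lparr>carrier := N\<rparr>\<^esub>"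
        using KE by (simp add: pow)
    next
      fix r u v
      assume "r \<in> {p, q}" "u \<in> carrier (G\<lparr>carrier := N\<rparr>)" "u \<noteq> \<one>\<^bsub>G\<lparr>carrier := N\<rparr>\<^esub>" "u [^]\<^bsub>G\<lparr>carrier := N\<rparr>\<^esub> r = \<one>\<^bsub>G\<lparr>carrier := N\<rparr>\<^esub>"
        "v \<in> carrier (G\<lparr>carrier := N\<rparr>)" "v \<noteq> \<one>\<^bsub>G\<lparr>carrier := N\<rparr>\<^esub>" "v [^]\<^bsub>G\<lparr>carrier := N\<rparr>\<^esub> r = \<one>\<^bsub>G\<lparr>carrier := N\<rparr>\<^esub>"
      then show "card (K.centralizer u) = card (K.centralizer v)"
        using cen_hom[of r u v] by (simp add: pow)
    qed
    then obtain r where r: "r \<in> {p, q}" and Qsub: "subgroup {u \<in> N. u [^] r = \<one>} (G\<lparr>carrier := N\<rparr>)"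
      by (auto simp: pow)
    define Q where "Q = {u \<in> N. u [^] r = \<one>}"
    have "subgroup Q G" unfolding Q_def by (rule incl_subgroup[OF sub Qsub])
    moreover have "g \<otimes> u \<otimes> inv g \<in> Q" if "g \<in> carrier G" "u \<in> Q" for g u
      using that normal NG by (auto simp: Q_def conj_pow)
    ultimately have "Q \<lhd> G" by (simp add: normal_inv_iff)
    moreover have "Q \<noteq> {\<one>}" using r x y by (auto simp: Q_def)
    ultimately have "N \<subseteq> Q" by (rule min)
    then have "x [^] r = \<one>" "y [^] r = \<one>" using x(1) y(1) by (auto simp: Q_def)
    then show False using r xq yp by auto
  qed
qed

section \<open>Inflation of characters from quotients\<close>

lemma normal_rep_kernel:
  assumes "complex_rep G n \<rho>"
  shows "{g \<in> carrier G. \<rho> g = 1\<^sub>m n} \<lhd> G"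
  using group_hom.normal_kernel[OF complex_rep_group_hom[OF assms]]
  by (simp add: kernel_def units_of_def ring_mat_def)

text \<open>
  By the homomorphism theorem the index of the kernel is the order of the image; in this form the index is
  visibly unchanged by inflation.
\<close>
lemma card_cosets_character_kernel:
  assumes \<rho>: "complex_rep G n \<rho>"
  shows "card (rcosets (character_kernel G (rep_character G \<rho>))) = card (\<rho> ` carrier G)"
proof -
  interpret h: group_hom G "GL_complex n" \<rho> by (rule complex_rep_group_hom[OF \<rho>])
  let ?I = "(GL_complex n)\<lparr>carrier := \<rho> ` carrier G\<rparr>"
  have "group ?I" by (rule group.subgroup_imp_group[OF h.H.is_group h.img_is_subgroup])
  then interpret i: group_hom G ?I \<rho>
    using is_group h.homh by (auto simp: group_hom_def group_hom_axioms_def hom_def)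
  have "kernel G ?I \<rho> = character_kernel G (rep_character G \<rho>)"
    unfolding character_kernel_rep[OF \<rho>] by (simp add: kernel_def units_of_def ring_mat_def)
  then have "bij_betw (\<lambda>X. the_elem (\<rho> ` X)) (rcosets (character_kernel G (rep_character G \<rho>))) (\<rho> ` carrier G)"
    using i.FactGroup_iso_set by (simp add: iso_def FactGroup_def)
  then show ?thesis by (rule bij_betw_same_card)
qed

end

definition inflate :: "('a, 'b) monoid_scheme \<Rightarrow> 'a set \<Rightarrow> ('a set \<Rightarrow> complex) \<Rightarrow> 'a \<Rightarrow> complex" where
  "inflate G M \<chi> = (\<lambda>g\<in>carrier G. \<chi> (M #>\<^bsub>G\<^esub> g))"

context finite_group
begin

lemma finite_group_quotient:
  assumes "M \<lhd> G" shows "finite_group (G Mod M)"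
  using normal.factorgroup_is_group[OF assms]
  by (simp add: finite_group_def finite_group_axioms_def FactGroup_def RCOSETS_def)

lemma quotient_carrier: "carrier (G Mod M) = (\<lambda>g. M #> g) ` carrier G"
  by (auto simp: FactGroup_def RCOSETS_def)

lemma irreducible_rep_inflate:
  assumes M: "M \<lhd> G" and irr: "irreducible_rep (G Mod M) n \<rho>"
  shows "irreducible_rep G n (\<lambda>g. \<rho> (M #> g))"
    and "rep_character G (\<lambda>g. \<rho> (M #> g)) = inflate G M (rep_character (G Mod M) \<rho>)"
proof -
  have "(\<lambda>g. M #> g) \<in> hom G (G Mod M)" by (rule normal.r_coset_hom_Mod[OF M])
  moreover have "\<rho> \<in> hom (G Mod M) (GL_complex n)"
    using irr by (simp add: irreducible_rep_def complex_rep_def)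
  ultimately have "\<rho> \<circ> (\<lambda>g. M #> g) \<in> hom G (GL_complex n)" by (auto simp: hom_def Pi_iff)
  then have "complex_rep G n (\<lambda>g. \<rho> (M #> g))" by (simp add: complex_rep_def comp_def)
  then show "irreducible_rep G n (\<lambda>g. \<rho> (M #> g))"
    using irr unfolding irreducible_rep_def quotient_carrier by auto
  show "rep_character G (\<lambda>g. \<rho> (M #> g)) = inflate G M (rep_character (G Mod M) \<rho>)"
    by (auto simp: rep_character_def inflate_def quotient_carrier)
qed

lemma inflate_Irr:
  assumes M: "M \<lhd> G" and \<chi>: "\<chi> \<in> Irr (G Mod M)"
  shows "inflate G M \<chi> \<in> Irr G"
proof -
  obtain n \<rho> where "irreducible_rep (G Mod M) n \<rho>" "\<chi> = rep_character (G Mod M) \<rho>"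
    using \<chi> by (auto simp: Irr_def)
  then show ?thesis unfolding Irr_def using irreducible_rep_inflate[OF M, of n \<rho>] by (metis (mono_tags, lifting) mem_Collect_eq)
qed

lemma codegree_inflate:
  assumes M: "M \<lhd> G" and \<chi>: "\<chi> \<in> Irr (G Mod M)"
  shows "codegree G (inflate G M \<chi>) = codegree (G Mod M) \<chi>"
proof -
  interpret H: finite_group "G Mod M" by (rule finite_group_quotient[OF M])
  obtain n \<rho> where irr: "irreducible_rep (G Mod M) n \<rho>" and \<chi>\<rho>: "\<chi> = rep_character (G Mod M) \<rho>"
    using \<chi> by (auto simp: Irr_def)
  note infl = irreducible_rep_inflate[OF M irr]
  have rep: "complex_rep G n (\<lambda>g. \<rho> (M #> g))" by (rule irreducible_repD(1)[OF infl(1)])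
  have rep': "complex_rep (G Mod M) n \<rho>" by (rule H.irreducible_repD(1)[OF irr])
  show ?thesis
    unfolding codegree_def \<chi>\<rho> infl(2)[symmetric] card_cosets_character_kernel[OF rep]
      H.card_cosets_character_kernel[OF rep'] rep_character_one[OF rep] H.rep_character_one[OF rep']
    by (simp add: quotient_carrier image_image)
qed

lemma Irr_extensional: "\<chi> \<in> Irr H \<Longrightarrow> \<chi> \<in> extensional (carrier H)"
  by (auto simp: Irr_def rep_character_def)

lemma inflate_inj:
  assumes "\<chi> \<in> extensional (carrier (G Mod M))" "\<psi> \<in> extensional (carrier (G Mod M))"
    and eq: "inflate G M \<chi> = inflate G M \<psi>"
  shows "\<chi> = \<psi>"
proof (rule extensionalityI[OF assms(1,2)])
  fix X assume "X \<in> carrier (G Mod M)"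
  then obtain g where g: "g \<in> carrier G" "X = M #> g" by (auto simp: quotient_carrier)
  then show "\<chi> X = \<psi> X" using fun_cong[OF eq, of g] by (simp add: inflate_def)
qed

lemma inflate_principal:
  "inflate G M (principal_character (G Mod M)) = principal_character G"
  by (auto simp: inflate_def principal_character_def quotient_carrier)

text \<open>
  Three pairwise adjacent characters of the quotient would inflate to a triangle.
\<close>
lemma adjacent_inflated_characters_le_two:
  assumes M: "M \<lhd> G" and no_triangle: "\<nexists>T. is_triangle (codegree_graph G) T"
    and F: "F \<subseteq> Irr (G Mod M)" "principal_character (G Mod M) \<notin> F"
    and adj: "\<And>\<chi> \<psi>. \<chi> \<in> F \<Longrightarrow> \<psi> \<in> F \<Longrightarrow> \<chi> \<noteq> \<psi> \<Longrightarrow> gcd (codegree (G Mod M) \<chi>) (codegree (G Mod M) \<psi>) \<noteq> 1"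
  shows "finite F \<and> card F \<le> 2"
proof (rule ccontr)
  assume "\<not> (finite F \<and> card F \<le> 2)"
  then have "infinite F \<or> 3 \<le> card F" by auto
  then obtain T where T: "T \<subseteq> F" "card T = 3"
    using obtain_subset_with_card_n[of 3 F] infinite_arbitrarily_large[of F 3] by metis
  have ext: "\<chi> \<in> extensional (carrier (G Mod M))" if "\<chi> \<in> F" for \<chi>
    using F(1) that by (blast intro: Irr_extensional)
  have np: "inflate G M \<chi> \<noteq> principal_character G" if "\<chi> \<in> F" for \<chi>
  proof
    assume "inflate G M \<chi> = principal_character G"
    then have "inflate G M \<chi> = inflate G M (principal_character (G Mod M))"
      by (simp only: inflate_principal)
    then have "\<chi> = principal_character (G Mod M)"
      using inflate_inj[OF ext[OF that]] by (simp add: principal_character_def)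
    then show False using that F(2) by simp
  qed
  have inj: "inj_on (inflate G M) T" using inflate_inj ext T by (intro inj_onI) blast
  have "is_triangle (codegree_graph G) (inflate G M ` T)"
    unfolding is_triangle_def
  proof (intro conjI ballI impI)
    show "inflate G M ` T \<subseteq> pverts (codegree_graph G)"
      using T F np inflate_Irr[OF M] by (auto simp: codegree_graph_def)
    show "card (inflate G M ` T) = 3" using inj T by (simp add: card_image)
    fix u v assume "u \<in> inflate G M ` T" "v \<in> inflate G M ` T" "u \<noteq> v"
    then obtain \<chi> \<psi> where c: "\<chi> \<in> T" "\<psi> \<in> T" "u = inflate G M \<chi>" "v = inflate G M \<psi>" "\<chi> \<noteq> \<psi>" by blast
    have I: "\<chi> \<in> Irr (G Mod M)" "\<psi> \<in> Irr (G Mod M)" using c T F by auto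
    have TF: "\<chi> \<in> F" "\<psi> \<in> F" using c(1,2) T(1) by auto
    have gcd: "gcd (codegree G u) (codegree G v) \<noteq> 1"
      using adj[OF TF c(5)] unfolding c(3,4) codegree_inflate[OF M I(1)] codegree_inflate[OF M I(2)] .
    have uv: "u \<in> Irr G - {principal_character G}" "v \<in> Irr G - {principal_character G}"
      unfolding c(3,4) using inflate_Irr[OF M I(1)] inflate_Irr[OF M I(2)] np[OF TF(1)] np[OF TF(2)] by simp_all
    show "(u, v) \<in> parcs (codegree_graph G)"
      unfolding codegree_graph_def pair_pre_digraph.select_convs
      using gcd uv \<open>u \<noteq> v\<close> by blast
  qed
  then show False using no_triangle by blast
qed

section \<open>Triangle-free groups are solvable\<close>

text \<open>
  A term of the derived series of least order is perfect.
\<close>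
lemma nonsolvable_imp_perfect_normal:
  assumes "\<not> solvable G"
  obtains D where "D \<lhd> G" "D \<noteq> {\<one>}" "derived G D = D"
proof -
  define d where "d n = (derived G ^^ n) (carrier G)" for n
  have dn: "d n \<lhd> G" for n
    by (induction n) (auto simp: d_def normal_self derived_is_normal)
  obtain n where n: "\<And>k. card (d n) \<le> card (d k)"
    using ex_has_least_nat[of "\<lambda>_. True" 0 "\<lambda>k. card (d k)"] by auto
  have sub: "subgroup (d n) G" using dn by (simp add: normal_inv_iff)
  have "derived G (d n) \<subseteq> d n" by (rule derived_incl[OF subset_refl sub])
  moreover have "derived G (d n) = d (Suc n)" by (simp add: d_def)
  moreover have "finite (d n)" using finite_subset[OF subgroup.subset[OF sub] finite_carrier] .
  ultimately have "derived G (d n) = d n" using n[of "Suc n"] by (metis card_seteq)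
  moreover have "d n \<noteq> {\<one>}" using assms solvable_iff_trivial_derived_seq by (auto simp: d_def)
  ultimately show ?thesis using dn that by blast
qed

text \<open>
  Choose \<open>M\<close> maximal among the normal subgroups that do not contain a given perfect normal subgroup \<open>D\<close>.
  The preimage of a nontrivial normal subgroup of the quotient properly contains \<open>M\<close>, hence contains \<open>D\<close>.
\<close>
lemma quotient_with_perfect_minimal_normal:
  assumes "\<not> solvable G"
  obtains M N where "M \<lhd> G" "N \<lhd> (G Mod M)" "N \<noteq> {\<one>\<^bsub>G Mod M\<^esub>}" "derived (G Mod M) N = N"
    "\<And>L. L \<lhd> (G Mod M) \<Longrightarrow> L \<noteq> {\<one>\<^bsub>G Mod M\<^esub>} \<Longrightarrow> N \<subseteq> L"
proof -
  obtain D where D: "D \<lhd> G" "D \<noteq> {\<one>}" "derived G D = D" by (rule nonsolvable_imp_perfect_normal[OF assms])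
  have Dsub: "subgroup D G" using D(1) by (simp add: normal_inv_iff)
  define S where "S = {M. M \<lhd> G \<and> \<not> D \<subseteq> M}"
  have "L \<subseteq> carrier G" if "L \<in> S" for L
    using that subgroup.subset[of L G] by (simp add: S_def normal_inv_iff)
  then have "S \<subseteq> Pow (carrier G)" by blast
  then have "finite S" by (rule finite_subset) simp
  moreover have "{\<one>} \<in> S"
    using one_is_normal D(2) subgroup.one_closed[OF Dsub] by (auto simp: S_def)
  then have "S \<noteq> {}" by blast
  ultimately obtain M where MS: "M \<in> S" and max: "\<And>L. L \<in> S \<Longrightarrow> M \<subseteq> L \<Longrightarrow> M = L"
    by (metis finite_has_maximal)
  have M: "M \<lhd> G" and DM: "\<not> D \<subseteq> M" using MS by (auto simp: S_def)
  have Msub: "subgroup M G" using M by (simp add: normal_inv_iff)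
  define \<pi> where "\<pi> g = M #> g" for g
  interpret H: finite_group "G Mod M" by (rule finite_group_quotient[OF M])
  have "\<pi> \<in> hom G (G Mod M)" unfolding \<pi>_def by (rule normal.r_coset_hom_Mod[OF M])
  then interpret h: group_hom G "G Mod M" \<pi>
    by (simp add: group_hom_def group_hom_axioms_def is_group H.is_group)
  have surj: "carrier (G Mod M) = \<pi> ` carrier G" by (simp add: quotient_carrier \<pi>_def)
  have ker: "\<pi> g = \<one>\<^bsub>G Mod M\<^esub> \<longleftrightarrow> g \<in> M" if "g \<in> carrier G" for g
    using that coset_join1[OF _ that Msub] coset_join2[OF that Msub]
    by (auto simp: \<pi>_def FactGroup_def)
  have N: "\<pi> ` D \<lhd> (G Mod M)"
    unfolding H.normal_inv_iff
  proof (intro conjI ballI)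
    show "subgroup (\<pi> ` D) (G Mod M)" by (rule h.subgroup_img_is_subgroup[OF Dsub])
    fix X Y assume "X \<in> carrier (G Mod M)" "Y \<in> \<pi> ` D"
    then obtain g d where gd: "g \<in> carrier G" "d \<in> D" "X = \<pi> g" "Y = \<pi> d" by (auto simp: surj)
    have dG: "d \<in> carrier G" by (rule subgroup.mem_carrier[OF Dsub gd(2)])
    have "X \<otimes>\<^bsub>G Mod M\<^esub> Y \<otimes>\<^bsub>G Mod M\<^esub> inv\<^bsub>G Mod M\<^esub> X = \<pi> (g \<otimes> d \<otimes> inv g)"
      using gd(1,3,4) dG by (simp add: h.hom_mult h.hom_inv)
    moreover have "g \<otimes> d \<otimes> inv g \<in> D" using D(1) gd(1,2) by (simp add: normal_inv_iff)
    ultimately show "X \<otimes>\<^bsub>G Mod M\<^esub> Y \<otimes>\<^bsub>G Mod M\<^esub> inv\<^bsub>G Mod M\<^esub> X \<in> \<pi> ` D" by simp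
  qed
  have ne: "\<pi> ` D \<noteq> {\<one>\<^bsub>G Mod M\<^esub>}"
  proof
    assume e: "\<pi> ` D = {\<one>\<^bsub>G Mod M\<^esub>}"
    have "D \<subseteq> M"
    proof
      fix d assume d: "d \<in> D"
      then have "\<pi> d = \<one>\<^bsub>G Mod M\<^esub>" using e by blast
      then show "d \<in> M" using ker subgroup.mem_carrier[OF Dsub d] by simp
    qed
    then show False using DM by simp
  qed
  have perfect: "derived (G Mod M) (\<pi> ` D) = \<pi> ` D"
    using h.derived_img[OF subgroup.subset[OF Dsub]] D(3) by simp
  have min: "\<pi> ` D \<subseteq> L" if L: "L \<lhd> (G Mod M)" and Lne: "L \<noteq> {\<one>\<^bsub>G Mod M\<^esub>}" for L
  proof -
    define L' where "L' = {g \<in> carrier G. \<pi> g \<in> L}"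
    have Lsub: "subgroup L (G Mod M)" using L by (simp add: H.normal_inv_iff)
    have "L' \<lhd> G"
      unfolding normal_inv_iff
    proof (intro conjI ballI)
      show "subgroup L' G"
      proof (rule subgroupI)
        have "\<pi> \<one> \<in> L" unfolding h.hom_one by (rule subgroup.one_closed[OF Lsub])
        then show "L' \<noteq> {}" by (auto simp: L'_def)
        show "inv x \<in> L'" if "x \<in> L'" for x
          using that subgroup.m_inv_closed[OF Lsub, of "\<pi> x"] h.hom_inv[of x] by (auto simp: L'_def)
        show "x \<otimes> y \<in> L'" if "x \<in> L'" "y \<in> L'" for x y
          using that subgroup.m_closed[OF Lsub, of "\<pi> x" "\<pi> y"] h.hom_mult[of x y] by (auto simp: L'_def)
      qed (auto simp: L'_def)
      fix g x assume "g \<in> carrier G" "x \<in> L'"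
      then show "g \<otimes> x \<otimes> inv g \<in> L'"
        using L by (auto simp: L'_def h.hom_mult h.hom_inv H.normal_inv_iff)
    qed
    moreover have "M \<subseteq> L'"
      using ker subgroup.subset[OF Msub] subgroup.one_closed[OF Lsub] by (auto simp: L'_def)
    moreover have "M \<noteq> L'"
    proof
      assume e: "M = L'"
      have "X = \<one>\<^bsub>G Mod M\<^esub>" if X: "X \<in> L" for X
      proof -
        obtain g where g: "g \<in> carrier G" "X = \<pi> g" using subgroup.mem_carrier[OF Lsub X] by (auto simp: surj)
        then have "g \<in> M" using X e by (simp add: L'_def)
        then show ?thesis using ker[OF g(1)] g(2) by simp
      qed
      then show False using Lne subgroup.one_closed[OF Lsub] by blast
    qed
    ultimately have "D \<subseteq> L'" using max[of L'] by (auto simp: S_def)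
    then show ?thesis by (auto simp: L'_def)
  qed
  show ?thesis by (rule that[OF M N ne perfect min])
qed

end

theorem corollary1p5:
  fixes G :: "('a, 'b) monoid_scheme"
  assumes "group G"
    and "finite (carrier G)"
    and "\<not> trivial_group G"
    and "\<nexists>T. is_triangle (codegree_graph G) T"
  shows "solvable G"
proof (rule ccontr)
  assume nonsolv: "\<not> solvable G"
  interpret finite_group G using assms(1,2) by (simp add: finite_group_def finite_group_axioms_def)
  obtain M N where M: "M \<lhd> G" and N: "N \<lhd> (G Mod M)" and ne: "N \<noteq> {\<one>\<^bsub>G Mod M\<^esub>}"
    and perfect: "derived (G Mod M) N = N"
    and min: "\<And>L. L \<lhd> (G Mod M) \<Longrightarrow> L \<noteq> {\<one>\<^bsub>G Mod M\<^esub>} \<Longrightarrow> N \<subseteq> L"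
    by (rule quotient_with_perfect_minimal_normal[OF nonsolv], rule that)
  interpret H: finite_group "G Mod M" by (rule finite_group_quotient[OF M])
  have NH: "N \<subseteq> carrier (G Mod M)" using N normal_imp_subgroup subgroup.subset by blast
  define F where "F = {\<chi> \<in> Irr (G Mod M). \<not> N \<subseteq> character_kernel (G Mod M) \<chi>}"
  have faithful: "\<exists>n \<rho>. irreducible_rep (G Mod M) n \<rho> \<and> \<chi> = rep_character (G Mod M) \<rho> \<and>
      (\<forall>X\<in>carrier (G Mod M). \<rho> X = 1\<^sub>m n \<longrightarrow> X = \<one>\<^bsub>G Mod M\<^esub>)" if \<chi>: "\<chi> \<in> F" for \<chi>
  proof -
    obtain n \<rho> where irr: "irreducible_rep (G Mod M) n \<rho>" and \<chi>\<rho>: "\<chi> = rep_character (G Mod M) \<rho>"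
      using \<chi> by (auto simp: F_def Irr_def)
    note rep = H.irreducible_repD(1)[OF irr]
    define L where "L = {X \<in> carrier (G Mod M). \<rho> X = 1\<^sub>m n}"
    have Lk: "character_kernel (G Mod M) \<chi> = L" unfolding \<chi>\<rho> L_def by (rule H.character_kernel_rep[OF rep])
    have "L \<lhd> (G Mod M)" unfolding L_def by (rule H.normal_rep_kernel[OF rep])
    then have "L = {\<one>\<^bsub>G Mod M\<^esub>}" using min[of L] \<chi> Lk by (auto simp: F_def)
    then show ?thesis using irr \<chi>\<rho> by (intro exI[of _ n] exI[of _ \<rho>]) (auto simp: L_def)
  qed
  have "finite F \<and> card F \<le> 2"
  proof (rule adjacent_inflated_characters_le_two[OF M assms(4)])
    show "F \<subseteq> Irr (G Mod M)" by (auto simp: F_def)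
    have "X \<in> character_kernel (G Mod M) (principal_character (G Mod M))" if "X \<in> carrier (G Mod M)" for X
      using that H.one_closed
      by (simp only: character_kernel_def principal_character_def mem_Collect_eq restrict_apply' simp_thms)
    then show "principal_character (G Mod M) \<notin> F" using NH by (auto simp: F_def)
    fix \<chi> \<psi> assume "\<chi> \<in> F" "\<psi> \<in> F" "\<chi> \<noteq> \<psi>"
    with faithful[of \<chi>] faithful[of \<psi>]
    show "gcd (codegree (G Mod M) \<chi>) (codegree (G Mod M) \<psi>) \<noteq> 1"
      using H.faithful_codegrees_not_coprime by metis
  qed
  moreover obtain I where I: "I \<subseteq> N" "card I = 4"
    "\<forall>x\<in>I. \<forall>y\<in>I. y \<in> H.conj_class x \<longrightarrow> x = y"
    using H.perfect_minimal_normal_four_classes[OF N ne perfect min] by blast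
  moreover have "card I \<le> card F + 1"
  proof (rule H.card_nonconjugate_le)
    show "finite F" using \<open>finite F \<and> card F \<le> 2\<close> by simp
    show "F \<subseteq> Irr (G Mod M)" by (auto simp: F_def)
    show "N \<subseteq> carrier (G Mod M)" by (rule NH)
    show "finite I" using I(2) card.infinite by fastforce
    show "\<chi> X = \<chi> \<one>\<^bsub>G Mod M\<^esub>" if "\<chi> \<in> Irr (G Mod M) - F" "X \<in> N" for \<chi> X
      using that by (auto simp: F_def character_kernel_def)
  qed (use I in auto)
  ultimately show False by simp
qed

end
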